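(* Let $f\colon(\mathbb{R}^2,0)\to(\mathbb{R}^3,0)$ be a frontal with pure-frontal singular point $0$. Suppose that its normal ruled surface $NR$ is noncylindrical and nondevelopable. Let $(u_0,w_0)\in S(NR)$. Then: (1) $NR$ has a cross cap at $(u_0,w_0)$ if and only if $\kappa_t'(u_0)\neq0$. (2) $NR$ has an $S_1^-$ singularity at $(u_0,w_0)$ if and only if $\kappa_t'(u_0)=0$ and $\kappa_t''(u_0)\bigl(2\kappa_s(u_0)\kappa_\nu'(u_0)+\kappa_t''(u_0)\bigr)<0$. (3) $NR$ has an $S_1^+$ singularity at $(u_0,w_0)$ if and only if $\kappa_t'(u_0)=0$, $\kappa_\nu'(u_0)\neq0$ and $\kappa_t''(u_0)\bigl(2\kappa_s(u_0)\kappa_\nu'(u_0)+\kappa_t''(u_0)\bigr)>0$.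
   Context: All maps are $C^\infty$. A map germ $f\colon(\mathbb{R}^2,0)\to(\mathbb{R}^3,0)$ is a frontal if there is a smooth $\nu\colon(\mathbb{R}^2,0)\to\mathbb{S}^2$ (a unit normal vector field) with $\langle df_q(X),\nu(q)\rangle=0$ for all $q$ and $X\in T_q\mathbb{R}^2$. Put $\lambda=\det(f_u,f_v,\nu)$ and $S(f)=\{q: \operatorname{rank}df_q<2\}=\lambda^{-1}(0)$. A singular point is non-degenerate if $d\lambda\ne0$ there; then near it $S(f)$ is a regular curve $\gamma$ (the singular curve) and there is a nowhere vanishing vector field $\eta$ (null vector field) with $df(\eta)=0$ along $\gamma$. It is of the first kind if $\gamma'$ and $\eta$ are linearly independent there. A singular point of the first kind is a pure-frontal singular point if $\psi(t)=\det((f\circ\gamma)'(t),\nu(\gamma(t)),d\nu_{\gamma(t)}(\eta))$ vanishes identically along $\gamma$. Adapted coordinates: around a pure-frontal singular point there are coordinates $(u,v)$ with $S(f)=\{v=0\}$, $\partial_v$ a null vector field, and $\{f_u,f_{vv},\nu\}$ orthonormal along the $u$-axis; fix such coordinates. Write $f_v=vh$ with $h$ smooth, $\hat\gamma(u)=f(u,0)$, $\hat h(u)=h(u,0)$, $\hat\nu(u)=\nu(u,0)$. Then $\{\hat\gamma',\hat h,\hat\nu\}$ is an orthonormal frame, and the singular curvature $\kappa_s$, limiting normal curvature $\kappa_\nu$ and cuspidal torsion $\kappa_t$ (functions of $u$) satisfy $\hat\gamma''=\kappa_s\hat h+\kappa_\nu\hat\nu$, $\hat h'=-\kappa_s\hat\gamma'+\kappa_t\hat\nu$,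 $\hat\nu'=-\kappa_\nu\hat\gamma'-\kappa_t\hat h$. Primes denote $d/du$. The normal ruled surface is $NR(u,w)=\hat\gamma(u)+w\hat\nu(u)$, with $u$ in the (germ of the) $u$-axis $S(f)$ and $w\in\mathbb{R}$; $S(NR)$ is its set of singular points (points where $\operatorname{rank}\,dNR<2$), which equals $\{(u_0,w_0): \kappa_t(u_0)=0,\ 1-w_0\kappa_\nu(u_0)=0\}$. $NR$ is noncylindrical if $\hat\nu'\neq0$ everywhere, i.e. $(\kappa_\nu,\kappa_t)\neq(0,0)$ along $\gamma$; it is developable if $\det(\hat\gamma',\hat\nu,\hat\nu')\equiv0$, and nondevelopable otherwise. Two map germs from the plane to $\mathbb{R}^3$ are $\mathcal{A}$-equivalent if they agree up to diffeomorphism germs of source and target. A map has at a point a cross cap (resp. an $S_1^{\pm}$ singularity) if its germ there is $\mathcal{A}$-equivalent to the germ at the origin of $(u,v)\mapsto(u,uv,v^2)$ (resp. $(u,v)\mapsto(u,v^2,v(u^2\pm v^2))$). *)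

theory Defs
  imports "HOL-Analysis.Analysis"
begin

section \<open>Smooth maps and germs\<close>

text \<open>The source plane is \<^typ>\<open>real \<times> real\<close> and the target space is \<^typ>\<open>real^3\<close>.
  A germ is given by a map on the whole type together with an open domain (or a base point);
  nothing is assumed about the map off that domain.\<close>

fun Ck_on :: "nat \<Rightarrow> 'a::real_normed_vector set \<Rightarrow> ('a \<Rightarrow> 'b::real_normed_vector) \<Rightarrow> bool" where
  "Ck_on 0 S f \<longleftrightarrow> continuous_on S f"
| "Ck_on (Suc k) S f \<longleftrightarrow>
     (\<forall>x\<in>S. f differentiable (at x)) \<and>
     (\<forall>v. Ck_on k S (\<lambda>x. frechet_derivative f (at x) v))"

text \<open>Meant for open \<open>S\<close> only, since the derivatives are taken in the ambient space.\<close>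

definition smooth_on :: "'a::real_normed_vector set \<Rightarrow> ('a \<Rightarrow> 'b::real_normed_vector) \<Rightarrow> bool" where
  "smooth_on S f \<longleftrightarrow> (\<forall>k. Ck_on k S f)"

definition diffeo_on :: "'a::real_normed_vector set \<Rightarrow> ('a \<Rightarrow> 'b::real_normed_vector) \<Rightarrow> bool" where
  "diffeo_on U \<phi> \<longleftrightarrow>
     open U \<and> smooth_on U \<phi> \<and> inj_on \<phi> U \<and> open (\<phi> ` U) \<and> smooth_on (\<phi> ` U) (inv_into U \<phi>)"

definition A_equivalent ::
  "('a::real_normed_vector \<Rightarrow> 'b::real_normed_vector) \<Rightarrow> 'a \<Rightarrow> ('a \<Rightarrow> 'b) \<Rightarrow> 'a \<Rightarrow> bool" where
  "A_equivalent F p G q \<longleftrightarrow>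
     (\<exists>U W \<phi> \<psi>. diffeo_on U \<phi> \<and> p \<in> U \<and> \<phi> p = q \<and>
                diffeo_on W \<psi> \<and> F p \<in> W \<and> \<psi> (F p) = G q \<and>
                (\<forall>\<^sub>F x in nhds p. \<psi> (F x) = G (\<phi> x)))"

definition has_cross_cap :: "(real \<times> real \<Rightarrow> real^3) \<Rightarrow> real \<times> real \<Rightarrow> bool" where
  "has_cross_cap F p \<longleftrightarrow> A_equivalent F p (\<lambda>(u, v). vector [u, u * v, v^2]) (0, 0)"

definition has_S1_plus :: "(real \<times> real \<Rightarrow> real^3) \<Rightarrow> real \<times> real \<Rightarrow> bool" where
  "has_S1_plus F p \<longleftrightarrow> A_equivalent F p (\<lambda>(u, v). vector [u, v^2, v * (u^2 + v^2)]) (0, 0)"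

definition has_S1_minus :: "(real \<times> real \<Rightarrow> real^3) \<Rightarrow> real \<times> real \<Rightarrow> bool" where
  "has_S1_minus F p \<longleftrightarrow> A_equivalent F p (\<lambda>(u, v). vector [u, v^2, v * (u^2 - v^2)]) (0, 0)"

section \<open>Frontals and pure-frontal singular points\<close>

definition pdu :: "(real \<times> real \<Rightarrow> 'b::real_normed_vector) \<Rightarrow> real \<times> real \<Rightarrow> 'b" where
  "pdu F q = frechet_derivative F (at q) (1, 0)"

definition pdv :: "(real \<times> real \<Rightarrow> 'b::real_normed_vector) \<Rightarrow> real \<times> real \<Rightarrow> 'b" where
  "pdv F q = frechet_derivative F (at q) (0, 1)"

abbreviation det3 :: "real^3 \<Rightarrow> real^3 \<Rightarrow> real^3 \<Rightarrow> real" where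
  "det3 a b c \<equiv> det (vector [a, b, c] :: real^3^3)"

definition rank_at :: "(real \<times> real \<Rightarrow> real^3) \<Rightarrow> real \<times> real \<Rightarrow> nat" where
  "rank_at F q = dim (range (frechet_derivative F (at q)))"

definition singular_set :: "(real \<times> real) set \<Rightarrow> (real \<times> real \<Rightarrow> real^3) \<Rightarrow> (real \<times> real) set" where
  "singular_set U F = {q \<in> U. rank_at F q < 2}"

definition frontal_on ::
  "(real \<times> real) set \<Rightarrow> (real \<times> real \<Rightarrow> real^3) \<Rightarrow> (real \<times> real \<Rightarrow> real^3) \<Rightarrow> bool" where
  "frontal_on U f \<nu> \<longleftrightarrow>
     open U \<and> smooth_on U f \<and> smooth_on U \<nu> \<and>
     (\<forall>q\<in>U. norm (\<nu> q) = 1 \<and> (\<forall>X. frechet_derivative f (at q) X \<bullet> \<nu> q = 0))"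

definition area_density ::
  "(real \<times> real \<Rightarrow> real^3) \<Rightarrow> (real \<times> real \<Rightarrow> real^3) \<Rightarrow> real \<times> real \<Rightarrow> real" where
  "area_density f \<nu> q = det3 (pdu f q) (pdv f q) (\<nu> q)"

definition nondegenerate_singular_point ::
  "(real \<times> real) set \<Rightarrow> (real \<times> real \<Rightarrow> real^3) \<Rightarrow> (real \<times> real \<Rightarrow> real^3) \<Rightarrow> real \<times> real \<Rightarrow> bool" where
  "nondegenerate_singular_point U f \<nu> p \<longleftrightarrow>
     p \<in> singular_set U f \<and> frechet_derivative (area_density f \<nu>) (at p) \<noteq> (\<lambda>X. 0)"

text \<open>\<open>\<gamma>\<close>, defined on \<open>]-\<epsilon>,\<epsilon>[\<close>, is a regular parametrization of the singular set inside the
  neighbourhood \<open>N\<close> of \<open>p\<close>, passing through \<open>p\<close> at parameter 0.\<close>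

definition singular_curve ::
  "(real \<times> real) set \<Rightarrow> (real \<times> real \<Rightarrow> real^3) \<Rightarrow> real \<times> real \<Rightarrow>
   (real \<times> real) set \<Rightarrow> real \<Rightarrow> (real \<Rightarrow> real \<times> real) \<Rightarrow> bool" where
  "singular_curve U f p N \<epsilon> \<gamma> \<longleftrightarrow>
     open N \<and> p \<in> N \<and> N \<subseteq> U \<and> 0 < \<epsilon> \<and>
     smooth_on {-\<epsilon><..<\<epsilon>} \<gamma> \<and> inj_on \<gamma> {-\<epsilon><..<\<epsilon>} \<and> \<gamma> 0 = p \<and>
     (\<forall>t\<in>{-\<epsilon><..<\<epsilon>}. vector_derivative \<gamma> (at t) \<noteq> 0) \<and>
     singular_set N f = \<gamma> ` {-\<epsilon><..<\<epsilon>}"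

definition null_vector_field ::
  "(real \<times> real \<Rightarrow> real^3) \<Rightarrow> (real \<times> real) set \<Rightarrow> real \<Rightarrow> (real \<Rightarrow> real \<times> real) \<Rightarrow>
   (real \<times> real \<Rightarrow> real \<times> real) \<Rightarrow> bool" where
  "null_vector_field f N \<epsilon> \<gamma> \<eta> \<longleftrightarrow>
     smooth_on N \<eta> \<and> (\<forall>q\<in>N. \<eta> q \<noteq> 0) \<and>
     (\<forall>t\<in>{-\<epsilon><..<\<epsilon>}. frechet_derivative f (at (\<gamma> t)) (\<eta> (\<gamma> t)) = 0)"

text \<open>The conjunct \<open>\<noteq>\<close> is needed because \<open>{x, x}\<close> is independent as a set for \<open>x \<noteq> 0\<close>.\<close>

definition pure_frontal_singular_point ::
  "(real \<times> real) set \<Rightarrow> (real \<times> real \<Rightarrow> real^3) \<Rightarrow> (real \<times> real \<Rightarrow> real^3) \<Rightarrow> real \<times> real \<Rightarrow> bool" where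
  "pure_frontal_singular_point U f \<nu> p \<longleftrightarrow>
     nondegenerate_singular_point U f \<nu> p \<and>
     (\<exists>N \<epsilon> \<gamma> \<eta>. singular_curve U f p N \<epsilon> \<gamma> \<and> null_vector_field f N \<epsilon> \<gamma> \<eta> \<and>
        vector_derivative \<gamma> (at 0) \<noteq> \<eta> p \<and> independent {vector_derivative \<gamma> (at 0), \<eta> p} \<and>
        (\<forall>t\<in>{-\<epsilon><..<\<epsilon>}.
           det3 (vector_derivative (f \<circ> \<gamma>) (at t)) (\<nu> (\<gamma> t))
                (frechet_derivative \<nu> (at (\<gamma> t)) (\<eta> (\<gamma> t))) = 0))"

section \<open>Adapted coordinates and the frame along the singular curve\<close>

definition orthonormal3 :: "real^3 \<Rightarrow> real^3 \<Rightarrow> real^3 \<Rightarrow> bool" where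
  "orthonormal3 a b c \<longleftrightarrow>
     norm a = 1 \<and> norm b = 1 \<and> norm c = 1 \<and> a \<bullet> b = 0 \<and> a \<bullet> c = 0 \<and> b \<bullet> c = 0"

text \<open>The coordinates \<open>(u, v)\<close> range over \<open>V\<close>, and \<open>\<phi>\<close> takes them to points of the source \<open>U\<close>;
  in these coordinates the frontal is \<open>f \<circ> \<phi>\<close> with unit normal \<open>\<nu> \<circ> \<phi>\<close>. The map \<open>h\<close> is the smooth
  factor with \<open>f\<^sub>v = v h\<close>.\<close>

definition adapted_coordinates ::
  "(real \<times> real) set \<Rightarrow> (real \<times> real \<Rightarrow> real^3) \<Rightarrow> (real \<times> real \<Rightarrow> real^3) \<Rightarrow>
   (real \<times> real) set \<Rightarrow> (real \<times> real \<Rightarrow> real \<times> real) \<Rightarrow> (real \<times> real \<Rightarrow> real^3) \<Rightarrow> bool" where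
  "adapted_coordinates U f \<nu> V \<phi> h \<longleftrightarrow>
     diffeo_on V \<phi> \<and> (0, 0) \<in> V \<and> \<phi> (0, 0) = (0, 0) \<and> \<phi> ` V \<subseteq> U \<and>
     singular_set V (f \<circ> \<phi>) = {(u, v) \<in> V. v = 0} \<and>
     (\<forall>u. (u, 0) \<in> V \<longrightarrow> pdv (f \<circ> \<phi>) (u, 0) = 0) \<and>
     (\<forall>u. (u, 0) \<in> V \<longrightarrow>
        orthonormal3 (pdu (f \<circ> \<phi>) (u, 0)) (pdv (pdv (f \<circ> \<phi>)) (u, 0)) (\<nu> (\<phi> (u, 0)))) \<and>
     smooth_on V h \<and> (\<forall>(u, v) \<in> V. pdv (f \<circ> \<phi>) (u, v) = v *\<^sub>R h (u, v))"

abbreviation D1 :: "(real \<Rightarrow> 'b::real_normed_vector) \<Rightarrow> real \<Rightarrow> 'b" where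
  "D1 c u \<equiv> vector_derivative c (at u)"

text \<open>The frame \<open>{c', h, n}\<close> being orthonormal, these equations determine the singular curvature
  \<open>\<kappa>s\<close>, the limiting normal curvature \<open>\<kappa>\<nu>\<close> and the cuspidal torsion \<open>\<kappa>t\<close> uniquely on \<open>I\<close>.\<close>

definition frame_curvatures ::
  "real set \<Rightarrow> (real \<Rightarrow> real^3) \<Rightarrow> (real \<Rightarrow> real^3) \<Rightarrow> (real \<Rightarrow> real^3) \<Rightarrow>
   (real \<Rightarrow> real) \<Rightarrow> (real \<Rightarrow> real) \<Rightarrow> (real \<Rightarrow> real) \<Rightarrow> bool" where
  "frame_curvatures I c h n \<kappa>s \<kappa>\<nu> \<kappa>t \<longleftrightarrow>
     (\<forall>u\<in>I. D1 (D1 c) u = \<kappa>s u *\<^sub>R h u + \<kappa>\<nu> u *\<^sub>R n u \<and>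
            D1 h u = - \<kappa>s u *\<^sub>R D1 c u + \<kappa>t u *\<^sub>R n u \<and>
            D1 n u = - \<kappa>\<nu> u *\<^sub>R D1 c u - \<kappa>t u *\<^sub>R h u)"

section \<open>The normal ruled surface\<close>

definition normal_ruled_surface ::
  "(real \<Rightarrow> real^3) \<Rightarrow> (real \<Rightarrow> real^3) \<Rightarrow> real \<times> real \<Rightarrow> real^3" where
  "normal_ruled_surface c n = (\<lambda>(u, w). c u + w *\<^sub>R n u)"

definition noncylindrical :: "real set \<Rightarrow> (real \<Rightarrow> real^3) \<Rightarrow> bool" where
  "noncylindrical I n \<longleftrightarrow> (\<forall>u\<in>I. D1 n u \<noteq> 0)"

definition developable :: "real set \<Rightarrow> (real \<Rightarrow> real^3) \<Rightarrow> (real \<Rightarrow> real^3) \<Rightarrow> bool" where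
  "developable I c n \<longleftrightarrow> (\<forall>u\<in>I. det3 (D1 c u) (n u) (D1 n u) = 0)"

end

theory Submission
  imports Defs
begin

text \<open>
  At a singular point \<open>p\<^sub>0\<close> of the normal ruled surface \<open>c (u) + w n (u)\<close> the kernel of the differential is spanned by
  \<open>\<partial>\<^sub>u\<close>, and the line through \<open>p\<^sub>0\<close> has the direction \<open>n\<^sub>0\<close> of the normal there. In coordinates of the target adapted to the
  orthonormal frame at that point, with first coordinate \<open>x\<close> in the direction \<open>n\<^sub>0\<close>, every nearby line of the surface is a
  graph over the \<open>x\<close>-axis. Hence the surface is equivalent to a family of lines
  \<open>(x, y\<^sub>0 (s) + x y\<^sub>1 (s), z\<^sub>0 (s) + x z\<^sub>1 (s))\<close> with \<open>s = u - u\<^sub>0\<close>, and the derivatives of the four functions at \<open>0\<close> follow from the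
  frame equations: \<open>y\<^sub>0'' = - w\<^sub>0 \<kappa>\<^sub>\<nu>'\<close>, \<open>y\<^sub>1' = - \<kappa>\<^sub>\<nu>\<close>, \<open>z\<^sub>0'' = - w\<^sub>0 \<kappa>\<^sub>t'\<close>, and, if \<open>\<kappa>\<^sub>t' = 0\<close>, also \<open>z\<^sub>1'' = - \<kappa>\<^sub>\<nu> \<kappa>\<^sub>s\<close> and
  \<open>z\<^sub>0''' = - w\<^sub>0 (2 \<kappa>\<^sub>s \<kappa>\<^sub>\<nu>' + \<kappa>\<^sub>t'')\<close> (\<open>normal_ruled_surface_line_family\<close>).

  If \<open>y\<^sub>0'' \<noteq> 0\<close> or \<open>z\<^sub>0'' \<noteq> 0\<close>, one component has a fold in \<open>s\<close>, with \<open>x\<close> as a parameter. The Morse lemma with a parameter makes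
  that component equal to \<open>r (x) \<plusminus> y\<^sup>2\<close>. The remaining component is the sum of an even and an odd function of \<open>y\<close>, and the even
  one is a smooth function of \<open>x\<close> and \<open>y\<^sup>2\<close> by Whitney's theorem (\<open>even_function_of_square\<close>), hence can be removed by a
  diffeomorphism of the target. What remains is \<open>(x, y\<^sup>2, y W (y\<^sup>2, x))\<close> (\<open>fold_normal_form\<close>), and the type of the singularity
  depends on the leading terms of \<open>W\<close>:
  a nonzero derivative in \<open>x\<close> gives a cross cap (\<open>folded_form_cross_cap\<close>); otherwise, nonzero coefficients of \<open>z\<close> and \<open>x\<^sup>2\<close> give
  \<open>S\<^sub>1\<^sup>+\<close> or \<open>S\<^sub>1\<^sup>-\<close>, according to whether their signs agree (\<open>folded_form_S1\<close>). The first case occurs for \<open>\<kappa>\<^sub>t' \<noteq> 0\<close>. In the second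
  case, for \<open>\<kappa>\<^sub>t' = 0\<close> and \<open>\<kappa>\<^sub>\<nu>' \<noteq> 0\<close>, the product of the two coefficients is a positive multiple of
  \<open>\<kappa>\<^sub>t'' (2 \<kappa>\<^sub>s \<kappa>\<^sub>\<nu>' + \<kappa>\<^sub>t'')\<close> (\<open>line_family_S1\<close>).

  For the converse directions the cases have to exclude each other. If \<open>\<kappa>\<^sub>t' = \<kappa>\<^sub>\<nu>' = 0\<close>, the surface contains a curve which is
  tangent to the kernel and constant up to terms of third order, which none of the three normal forms admits
  (\<open>not_equivalent_to_folded_form\<close>). The orders of vanishing of \<open>W\<close> along its two axes
  distinguish the cross cap, \<open>S\<^sub>1\<^sup>\<plusminus>\<close>, and the case where one of the two coefficients vanishes. Finally, \<open>S\<^sub>1\<^sup>+\<close> is injective and \<open>S\<^sub>1\<^sup>-\<close> is not.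

  Whitney's theorem needs an extension of a function of \<open>z = y\<^sup>2\<close> across \<open>z = 0\<close>, which is obtained by Seeley's reflection
  formula. All smoothness statements that involve integrals or series are proved by exhibiting a family of functions closed
  under partial derivatives (\<open>smooth_on_partials_coinduct\<close>).
\<close>

section \<open>Calculus of smooth maps\<close>

lemma Ck_on_SucD:
  assumes "Ck_on (Suc k) S f"
  shows "x \<in> S \<Longrightarrow> (f has_derivative frechet_derivative f (at x)) (at x)"
    and "Ck_on k S (\<lambda>x. frechet_derivative f (at x) v)"
  using assms frechet_derivative_works by auto

lemma Ck_on_cong:
  assumes "open S" "\<And>x. x \<in> S \<Longrightarrow> g x = h x" "Ck_on k S g"
  shows "Ck_on k S h"
  using assms(2,3)
proof (induction k arbitrary: g h)
  case 0
  then show ?case using continuous_on_cong by (metis Ck_on.simps(1))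
next
  case (Suc k)
  have D: "(h has_derivative frechet_derivative g (at x)) (at x)" if "x \<in> S" for x
  proof -
    have "(g has_derivative frechet_derivative g (at x)) (at x)"
      using Suc.prems(2) frechet_derivative_works that by auto
    then show ?thesis
      by (rule has_derivative_transform_within_open[OF _ assms(1) that]) (use Suc.prems in auto)
  qed
  have "Ck_on k S (\<lambda>x. frechet_derivative h (at x) v)" for v
    by (rule Suc.IH[OF fun_cong[OF frechet_derivative_at[OF D]] Ck_on_SucD(2)[OF Suc.prems(2)]])
  then show ?case using D by (auto simp: differentiable_def)
qed

lemma Ck_on_Suc_intro:
  assumes "open S" and D: "\<And>x. x \<in> S \<Longrightarrow> (f has_derivative f' x) (at x)"
    and "\<And>v. Ck_on k S (\<lambda>x. f' x v)"
  shows "Ck_on (Suc k) S f"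
proof -
  have "Ck_on k S (\<lambda>x. frechet_derivative f (at x) v)" for v
    by (rule Ck_on_cong[OF assms(1) fun_cong[OF frechet_derivative_at[OF D]] assms(3)])
  then show ?thesis using D by (auto simp: differentiable_def)
qed

lemma Ck_on_lower: "Ck_on (Suc k) S f \<Longrightarrow> Ck_on k S f"
proof (induction k arbitrary: f)
  case 0
  then show ?case
    by (auto intro!: continuous_at_imp_continuous_on differentiable_imp_continuous_within)
next
  case (Suc k)
  then show ?case by (metis Ck_on.simps(2))
qed

lemma Ck_on_subset: "Ck_on k S f \<Longrightarrow> T \<subseteq> S \<Longrightarrow> Ck_on k T f"
  by (induction k arbitrary: f) (auto intro: continuous_on_subset)

lemma Ck_on_const: "open S \<Longrightarrow> Ck_on k S (\<lambda>x. c)"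
proof (induction k arbitrary: c)
  case (Suc k)
  show ?case by (rule Ck_on_Suc_intro[where f' = "\<lambda>x v. 0"]) (use Suc in auto)
qed simp

lemma Ck_on_linear:
  assumes "bounded_linear L" "open S"
  shows "Ck_on k S L"
proof (cases k)
  case 0
  then show ?thesis using assms by (simp add: linear_continuous_on)
next
  case (Suc j)
  show ?thesis unfolding Suc
    by (rule Ck_on_Suc_intro[where f' = "\<lambda>x. L"])
      (use assms Ck_on_const bounded_linear_imp_has_derivative in auto)
qed

lemma Ck_on_add:
  assumes "open S" "Ck_on k S f" "Ck_on k S g"
  shows "Ck_on k S (\<lambda>x. f x + g x)"
  using assms(2,3)
proof (induction k arbitrary: f g)
  case 0
  then show ?case by (auto intro: continuous_intros)
next
  case (Suc k)
  show ?case
    by (rule Ck_on_Suc_intro[OF assms(1) has_derivative_add[OF Ck_on_SucD(1) Ck_on_SucD(1)]])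
      (use Suc Ck_on_SucD(2) in blast)+
qed

lemma Ck_on_sum:
  assumes "open S" "\<And>i. i \<in> A \<Longrightarrow> Ck_on k S (f i)"
  shows "Ck_on k S (\<lambda>x. \<Sum>i\<in>A. f i x)"
  using assms(2)
  by (induction A rule: infinite_finite_induct)
    (auto intro!: Ck_on_const Ck_on_add assms(1))

lemma Ck_on_bilinear:
  assumes "bounded_bilinear B" "open S" "Ck_on k S f" "Ck_on k S g"
  shows "Ck_on k S (\<lambda>x. B (f x) (g x))"
  using assms(3,4)
proof (induction k arbitrary: f g)
  case 0
  then show ?case by (auto intro: bounded_bilinear.continuous_on[OF assms(1)])
next
  case (Suc k)
  note lower = Ck_on_lower[OF Suc.prems(1)] Ck_on_lower[OF Suc.prems(2)]
  show ?case
  proof (rule Ck_on_Suc_intro[OF assms(2) bounded_bilinear.FDERIV[OF assms(1) Ck_on_SucD(1)[OF Suc.prems(1)] Ck_on_SucD(1)[OF Suc.prems(2)]]])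
    show "Ck_on k S (\<lambda>x. B (f x) (frechet_derivative g (at x) v) + B (frechet_derivative f (at x) v) (g x))" for v
      by (intro Ck_on_add assms(2) Suc.IH lower Ck_on_SucD(2)[OF Suc.prems(1)] Ck_on_SucD(2)[OF Suc.prems(2)])
  qed auto
qed

text \<open>The derivative of \<open>f\<close> is expanded in a basis of the middle space, which turns the chain rule into a finite sum of
  products of functions of class \<open>C\<^sup>k\<close>; the partial derivatives of \<open>f\<close> composed with \<open>g\<close> are covered by the induction
  hypothesis.\<close>

lemma Ck_on_compose:
  fixes f :: "'b::euclidean_space \<Rightarrow> 'c::real_normed_vector" and g :: "'a::real_normed_vector \<Rightarrow> 'b"
  assumes "open S" "open T" "g ` S \<subseteq> T" "Ck_on k T f" "Ck_on k S g"
  shows "Ck_on k S (\<lambda>x. f (g x))"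
  using assms(4,5)
proof (induction k arbitrary: f)
  case 0
  then show ?case using assms(3) by (auto intro: continuous_on_compose2)
next
  case (Suc k)
  have gT: "g x \<in> T" if "x \<in> S" for x using assms(3) that by auto
  have lin: "linear (frechet_derivative f (at y))" if "y \<in> T" for y
    using Ck_on_SucD(1)[OF Suc.prems(1) that] has_derivative_linear by blast
  have "Ck_on k S (\<lambda>x. \<Sum>b\<in>Basis. (frechet_derivative g (at x) v \<bullet> b) *\<^sub>R frechet_derivative f (at (g x)) b)" for v
    by (intro Ck_on_sum Ck_on_bilinear[OF bounded_bilinear_scaleR] Ck_on_bilinear[OF bounded_bilinear_inner]
       Ck_on_const assms(1) Suc.IH Ck_on_lower[OF Suc.prems(2)] Ck_on_SucD(2)[OF Suc.prems(1)] Ck_on_SucD(2)[OF Suc.prems(2)])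
  then show ?case
    using Ck_on_SucD(1)[OF Suc.prems(1)] Ck_on_SucD(1)[OF Suc.prems(2)]
  proof (intro Ck_on_Suc_intro[OF assms(1), where f' = "\<lambda>x v. \<Sum>b\<in>Basis. (frechet_derivative g (at x) v \<bullet> b) *\<^sub>R frechet_derivative f (at (g x)) b"])
    fix x assume x: "x \<in> S"
    have chain: "((\<lambda>x. f (g x)) has_derivative (\<lambda>v. frechet_derivative f (at (g x)) (frechet_derivative g (at x) v))) (at x)"
      using has_derivative_compose[OF Ck_on_SucD(1)[OF Suc.prems(2) x] Ck_on_SucD(1)[OF Suc.prems(1) gT[OF x]]] by simp
    have eq: "frechet_derivative f (at (g x)) w = (\<Sum>b\<in>Basis. (w \<bullet> b) *\<^sub>R frechet_derivative f (at (g x)) b)" for w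
    proof -
      have "frechet_derivative f (at (g x)) w = frechet_derivative f (at (g x)) (\<Sum>b\<in>Basis. (w \<bullet> b) *\<^sub>R b)"
        by (simp only: euclidean_representation)
      also have "\<dots> = (\<Sum>b\<in>Basis. frechet_derivative f (at (g x)) ((w \<bullet> b) *\<^sub>R b))"
        by (rule linear_sum[OF lin[OF gT[OF x]]])
      finally show ?thesis by (simp only: linear_cmul[OF lin[OF gT[OF x]]])
    qed
    have "(\<lambda>v. frechet_derivative f (at (g x)) (frechet_derivative g (at x) v)) =
        (\<lambda>v. \<Sum>b\<in>Basis. (frechet_derivative g (at x) v \<bullet> b) *\<^sub>R frechet_derivative f (at (g x)) b)"
      by (rule ext, rule eq)
    from chain[unfolded this] show "((\<lambda>x. f (g x)) has_derivative (\<lambda>v. \<Sum>b\<in>Basis. (frechet_derivative g (at x) v \<bullet> b) *\<^sub>R frechet_derivative f (at (g x)) b)) (at x)" .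
  qed
qed

lemma smooth_on_derivative:
  "smooth_on S f \<Longrightarrow> smooth_on S (\<lambda>x. frechet_derivative f (at x) v)"
  unfolding smooth_on_def by (metis Ck_on.simps(2))

lemma smooth_on_has_derivative:
  "smooth_on S f \<Longrightarrow> x \<in> S \<Longrightarrow> (f has_derivative frechet_derivative f (at x)) (at x)"
  unfolding smooth_on_def using Ck_on_SucD(1) by blast

lemma smooth_on_continuous: "smooth_on S f \<Longrightarrow> continuous_on S f"
  unfolding smooth_on_def by (metis Ck_on.simps(1))

lemma smooth_on_subset: "smooth_on S f \<Longrightarrow> T \<subseteq> S \<Longrightarrow> smooth_on T f"
  unfolding smooth_on_def using Ck_on_subset by blast

lemma smooth_on_cong:
  "open S \<Longrightarrow> (\<And>x. x \<in> S \<Longrightarrow> g x = h x) \<Longrightarrow> smooth_on S g \<Longrightarrow> smooth_on S h"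
  unfolding smooth_on_def using Ck_on_cong by blast

lemma smooth_on_compose:
  fixes f :: "'b::euclidean_space \<Rightarrow> 'c::real_normed_vector" and g :: "'a::real_normed_vector \<Rightarrow> 'b"
  shows "open S \<Longrightarrow> open T \<Longrightarrow> g ` S \<subseteq> T \<Longrightarrow> smooth_on T f \<Longrightarrow> smooth_on S g \<Longrightarrow> smooth_on S (\<lambda>x. f (g x))"
  unfolding smooth_on_def using Ck_on_compose by blast

lemma smooth_on_bilinear:
  "bounded_bilinear B \<Longrightarrow> open S \<Longrightarrow> smooth_on S f \<Longrightarrow> smooth_on S g \<Longrightarrow> smooth_on S (\<lambda>x. B (f x) (g x))"
  unfolding smooth_on_def using Ck_on_bilinear by blast

lemma smooth_on_add: "open S \<Longrightarrow> smooth_on S f \<Longrightarrow> smooth_on S g \<Longrightarrow> smooth_on S (\<lambda>x. f x + g x)"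
  unfolding smooth_on_def using Ck_on_add by blast

lemma smooth_on_const: "open S \<Longrightarrow> smooth_on S (\<lambda>x. c)"
  unfolding smooth_on_def using Ck_on_const by blast

lemma smooth_on_linear: "bounded_linear L \<Longrightarrow> open S \<Longrightarrow> smooth_on S L"
  unfolding smooth_on_def using Ck_on_linear by blast

text \<open>The principle by which all smoothness proofs below run without counting derivatives: a family
  of functions that contains, with each member, its two partial derivatives consists of smooth functions.\<close>

lemma smooth_on_partials_coinduct:
  fixes F :: "real \<times> real \<Rightarrow> 'b::real_normed_vector"
  assumes "open S" "P F"
    and step: "\<And>F. P F \<Longrightarrow> \<exists>F1 F2. P F1 \<and> P F2 \<and>
      (\<forall>p\<in>S. (F has_derivative (\<lambda>v. fst v *\<^sub>R F1 p + snd v *\<^sub>R F2 p)) (at p))"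
  shows "smooth_on S F"
proof -
  have "Ck_on k S F" if "P F" for k F
    using that
  proof (induction k arbitrary: F)
    case 0
    then obtain F1 F2 where "\<And>p. p \<in> S \<Longrightarrow> (F has_derivative (\<lambda>v. fst v *\<^sub>R F1 p + snd v *\<^sub>R F2 p)) (at p)"
      using step by blast
    then have "isCont F p" if "p \<in> S" for p
      using has_derivative_continuous that by blast
    then show ?case by (simp add: continuous_at_imp_continuous_on)
  next
    case (Suc k)
    then obtain F1 F2 where F: "P F1" "P F2"
      "\<And>p. p \<in> S \<Longrightarrow> (F has_derivative (\<lambda>v. fst v *\<^sub>R F1 p + snd v *\<^sub>R F2 p)) (at p)"
      using step by blast
    show ?case
      by (rule Ck_on_Suc_intro[OF assms(1) F(3)])
        (assumption, intro Ck_on_add Ck_on_bilinear[OF bounded_bilinear_scaleR] Ck_on_const assms(1) Suc.IH F(1,2))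
  qed
  then show ?thesis using assms(2) by (auto simp: smooth_on_def)
qed

lemma smooth_on_inverse: "smooth_on {x::real. x \<noteq> 0} inverse"
proof -
  have "Ck_on k {x::real. x \<noteq> 0} inverse" for k
  proof (induction k)
    case 0
    then show ?case by (auto intro!: continuous_intros)
  next
    case (Suc k)
    have o: "open {x::real. x \<noteq> 0}" by (simp add: open_delete Collect_neg_eq[symmetric] open_Collect_neq)
    show ?case
    proof (rule Ck_on_Suc_intro[OF o, where f' = "\<lambda>x v. (inverse x * v) * (- inverse x)"])
      have "Ck_on k {x::real. x \<noteq> 0} (\<lambda>x. - inverse x)"
        using Ck_on_bilinear[OF bounded_bilinear_mult o Ck_on_const[OF o, of k "-1"] Suc] by simp
      then show "Ck_on k {x::real. x \<noteq> 0} (\<lambda>x. (inverse x * v) * (- inverse x))" for v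
        by (intro Ck_on_bilinear[OF bounded_bilinear_mult o] Ck_on_const o Suc)
    qed (auto intro!: derivative_eq_intros)
  qed
  then show ?thesis by (simp add: smooth_on_def)
qed

lemma smooth_on_sqrt: "smooth_on {0<..} sqrt"
proof -
  have "Ck_on k {0<..} sqrt" for k
  proof (induction k)
    case 0
    then show ?case by (auto intro!: continuous_intros)
  next
    case (Suc k)
    have "Ck_on k {0<..} (\<lambda>x. inverse (sqrt x))"
      by (rule Ck_on_compose[where T = "{x. x \<noteq> 0}"])
        (use Suc smooth_on_inverse in \<open>auto simp: smooth_on_def open_Collect_neq\<close>)
    then have "Ck_on k {0<..} (\<lambda>x. v / 2 * inverse (sqrt x))" for v
      by (intro Ck_on_bilinear[OF bounded_bilinear_mult] Ck_on_const) auto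
    then show ?case
      by (intro Ck_on_Suc_intro[where f' = "\<lambda>x v. v / 2 * inverse (sqrt x)"])
        (auto intro!: derivative_eq_intros simp: field_simps)
  qed
  then show ?thesis by (simp add: smooth_on_def)
qed

lemma smooth_on_Pair:
  fixes f :: "'a::real_normed_vector \<Rightarrow> 'b::real_normed_vector" and g :: "'a \<Rightarrow> 'c::real_normed_vector"
  assumes "open S" "smooth_on S f" "smooth_on S g"
  shows "smooth_on S (\<lambda>x. (f x, g x))"
proof -
  have "Ck_on k S (\<lambda>x. (f x, g x))" if "Ck_on k S f" "Ck_on k S g"
    for k and f :: "'a \<Rightarrow> 'b" and g :: "'a \<Rightarrow> 'c"
    using that
  proof (induction k arbitrary: f g)
    case 0
    then show ?case by (auto intro: continuous_intros)
  next
    case (Suc k)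
    show ?case
      by (rule Ck_on_Suc_intro[OF assms(1) has_derivative_Pair[OF Ck_on_SucD(1)[OF Suc.prems(1)] Ck_on_SucD(1)[OF Suc.prems(2)]]])
        (use Suc.IH Ck_on_SucD(2)[OF Suc.prems(1)] Ck_on_SucD(2)[OF Suc.prems(2)] in auto)
  qed
  then show ?thesis using assms(2,3) by (simp add: smooth_on_def)
qed

text \<open>For parametric integrals and series it is the partial derivatives that are accessible.\<close>

lemma has_derivative_of_partials:
  fixes F F1 F2 :: "real \<times> real \<Rightarrow> real"
  assumes "open S" "p \<in> S" "continuous_on S F2"
    and 1: "\<And>x y. (x, y) \<in> S \<Longrightarrow> ((\<lambda>x. F (x, y)) has_field_derivative F1 (x, y)) (at x)"
    and 2: "\<And>x y. (x, y) \<in> S \<Longrightarrow> ((\<lambda>y. F (x, y)) has_field_derivative F2 (x, y)) (at y)"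
  shows "(F has_derivative (\<lambda>v. fst v *\<^sub>R F1 p + snd v *\<^sub>R F2 p)) (at p)"
proof -
  obtain x y where p: "p = (x, y)" by force
  obtain A B where "open A" "open B" "p \<in> A \<times> B" "A \<times> B \<subseteq> S"
    by (rule open_prod_elim[OF assms(1,2)])
  then have AB: "open A" "open B" "x \<in> A" "y \<in> B" "A \<times> B \<subseteq> S" by (simp_all add: p)
  obtain e where e: "e > 0" "ball y e \<subseteq> B" using AB open_contains_ball by blast
  define Y where "Y = ball y e"
  have Y: "open Y" "y \<in> Y" "convex Y" "A \<times> Y \<subseteq> S" using e AB by (auto simp: Y_def)
  have "((\<lambda>(x, y). F (x, y)) has_derivative (\<lambda>(tx, ty). (F1 (x,y) * tx) + blinfun_apply (blinfun_mult_right (F2 (x, y))) ty)) (at (x, y) within A \<times> Y)"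
  proof (rule has_derivative_partialsI[where fy = "\<lambda>x y. blinfun_mult_right (F2 (x, y))"])
    show "((\<lambda>x. F (x, y)) has_derivative (*) (F1 (x, y))) (at x within A)"
      using 1[of x y] assms(2) p by (simp add: has_field_derivative_def has_derivative_at_withinI)
    show "((\<lambda>y. F (x, y)) has_derivative blinfun_apply (blinfun_mult_right (F2 (x, y)))) (at y within Y)"
      if "x \<in> A" "y \<in> Y" for x y
      using 2[of x y] that Y by (auto simp: has_field_derivative_def has_derivative_at_withinI)
    have "continuous_on (A \<times> Y) (\<lambda>p. blinfun_mult_right (F2 p))"
      using continuous_on_subset[OF assms(3) Y(4)] by (intro continuous_intros)
    then show "continuous (at (x, y) within A \<times> Y) (\<lambda>(x, y). blinfun_mult_right (F2 (x, y)))"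
      using AB Y by (auto simp: continuous_on_eq_continuous_within case_prod_unfold)
  qed (use Y in auto)
  moreover have "at (x, y) within A \<times> Y = at (x, y)"
    using AB Y by (intro at_within_open) (auto intro: open_Times)
  ultimately show ?thesis by (simp add: p case_prod_unfold mult.commute)
qed

lemma smooth_on_partials_coinduct_real:
  fixes F :: "real \<times> real \<Rightarrow> real"
  assumes "open S" "P F"
    and cont: "\<And>F. P F \<Longrightarrow> continuous_on S F"
    and step: "\<And>F. P F \<Longrightarrow> \<exists>F1 F2. P F1 \<and> P F2 \<and>
      (\<forall>x y. (x, y) \<in> S \<longrightarrow> ((\<lambda>x. F (x, y)) has_field_derivative F1 (x, y)) (at x) \<and>
         ((\<lambda>y. F (x, y)) has_field_derivative F2 (x, y)) (at y))"
  shows "smooth_on S F"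
proof (rule smooth_on_partials_coinduct[where P = P])
  fix F assume "P F"
  then obtain F1 F2 where F: "P F1" "P F2" "\<forall>x y. (x, y) \<in> S \<longrightarrow> ((\<lambda>x. F (x, y)) has_field_derivative F1 (x, y)) (at x) \<and>
         ((\<lambda>y. F (x, y)) has_field_derivative F2 (x, y)) (at y)"
    using step by blast
  have "(F has_derivative (\<lambda>v. fst v *\<^sub>R F1 p + snd v *\<^sub>R F2 p)) (at p)" if "p \<in> S" for p
    by (rule has_derivative_of_partials[OF assms(1) that cont[OF F(2)]]) (use F in auto)
  then show "\<exists>F1 F2. P F1 \<and> P F2 \<and>
      (\<forall>p\<in>S. (F has_derivative (\<lambda>v. fst v *\<^sub>R F1 p + snd v *\<^sub>R F2 p)) (at p))"
    using F by blast
qed (use assms in auto)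

section \<open>Germs of smooth maps\<close>

definition smooth_near :: "'a::real_normed_vector \<Rightarrow> ('a \<Rightarrow> 'b::real_normed_vector) \<Rightarrow> bool" where
  "smooth_near p f \<longleftrightarrow> (\<exists>S. open S \<and> p \<in> S \<and> smooth_on S f)"

lemma smooth_nearI: "smooth_on S f \<Longrightarrow> open S \<Longrightarrow> p \<in> S \<Longrightarrow> smooth_near p f"
  by (auto simp: smooth_near_def)

lemma smooth_nearE:
  assumes "smooth_near p f"
  obtains S where "open S" "p \<in> S" "smooth_on S f"
  using assms by (auto simp: smooth_near_def)

lemma smooth_near2E:
  assumes "smooth_near p f" "smooth_near p g"
  obtains S where "open S" "p \<in> S" "smooth_on S f" "smooth_on S g"
proof -
  obtain S where S: "open S" "p \<in> S" "smooth_on S f" using assms(1) by (rule smooth_nearE)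
  obtain T where T: "open T" "p \<in> T" "smooth_on T g" using assms(2) by (rule smooth_nearE)
  show thesis
    by (rule that[of "S \<inter> T"]) (use S T in \<open>auto intro: smooth_on_subset\<close>)
qed

lemma smooth_near_eventually: "smooth_near p f \<Longrightarrow> \<forall>\<^sub>F q in nhds p. smooth_near q f"
  unfolding eventually_nhds smooth_near_def by blast

lemma smooth_near_cong:
  assumes "smooth_near p f" "\<forall>\<^sub>F x in nhds p. f x = g x"
  shows "smooth_near p g"
proof -
  obtain S where S: "open S" "p \<in> S" "smooth_on S f" using assms(1) by (rule smooth_nearE)
  obtain T where T: "open T" "p \<in> T" "\<And>x. x \<in> T \<Longrightarrow> f x = g x"
    using assms(2) by (auto simp: eventually_nhds)
  have "smooth_on (S \<inter> T) g"
    by (rule smooth_on_cong[of _ f]) (use S T in \<open>auto intro: smooth_on_subset\<close>)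
  then show ?thesis using S T by (auto simp: smooth_near_def)
qed

lemma smooth_near_compose:
  fixes f :: "'b::euclidean_space \<Rightarrow> 'c::real_normed_vector" and g :: "'a::real_normed_vector \<Rightarrow> 'b"
  assumes "smooth_near (g p) f" "smooth_near p g"
  shows "smooth_near p (\<lambda>x. f (g x))"
proof -
  obtain T where T: "open T" "g p \<in> T" "smooth_on T f" using assms(1) by (rule smooth_nearE)
  obtain S where S: "open S" "p \<in> S" "smooth_on S g" using assms(2) by (rule smooth_nearE)
  have o: "open (S \<inter> g -` T)"
    using continuous_open_preimage[OF smooth_on_continuous[OF S(3)] S(1) T(1)] by simp
  have "smooth_on (S \<inter> g -` T) (\<lambda>x. f (g x))"
    by (rule smooth_on_compose[OF o T(1) _ T(3)]) (use S in \<open>auto intro: smooth_on_subset\<close>)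
  then show ?thesis using o S T by (auto simp: smooth_near_def)
qed

lemma smooth_near_const [intro, simp]: "smooth_near p (\<lambda>x. c)"
  by (auto intro!: smooth_nearI[of UNIV] smooth_on_const)

lemma smooth_near_linear: "bounded_linear L \<Longrightarrow> smooth_near p L"
  by (auto intro!: smooth_nearI[of UNIV] smooth_on_linear)

lemma smooth_near_id [intro, simp]: "smooth_near p (\<lambda>x. x)"
  by (rule smooth_near_linear[OF bounded_linear_ident])

lemma smooth_near_fst: "smooth_near p fst" and smooth_near_snd: "smooth_near p snd"
  by (rule smooth_near_linear, rule bounded_linear_fst, rule smooth_near_linear, rule bounded_linear_snd)

lemma smooth_near_linear_compose:
  fixes f :: "'a::real_normed_vector \<Rightarrow> 'b::euclidean_space"
  assumes "bounded_linear L" "smooth_near p f"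
  shows "smooth_near p (\<lambda>x. L (f x))"
  by (rule smooth_near_compose[OF smooth_near_linear[OF assms(1)] assms(2)])

lemma smooth_near_bilinear:
  assumes "bounded_bilinear B" "smooth_near p f" "smooth_near p g"
  shows "smooth_near p (\<lambda>x. B (f x) (g x))"
proof -
  obtain S where "open S" "p \<in> S" "smooth_on S f" "smooth_on S g"
    using assms(2,3) by (rule smooth_near2E)
  then show ?thesis using smooth_on_bilinear[OF assms(1)] by (auto intro: smooth_nearI)
qed

lemmas smooth_near_mult [intro] = smooth_near_bilinear[OF bounded_bilinear_mult]
lemmas smooth_near_scaleR [intro] = smooth_near_bilinear[OF bounded_bilinear_scaleR]
lemmas smooth_near_inner [intro] = smooth_near_bilinear[OF bounded_bilinear_inner]

lemma smooth_near_add [intro]: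
  assumes "smooth_near p f" "smooth_near p g"
  shows "smooth_near p (\<lambda>x. f x + g x)"
proof -
  obtain S where "open S" "p \<in> S" "smooth_on S f" "smooth_on S g"
    using assms by (rule smooth_near2E)
  then show ?thesis using smooth_on_add by (auto intro: smooth_nearI)
qed

lemma smooth_near_minus [intro]: "smooth_near p f \<Longrightarrow> smooth_near p (\<lambda>x. - f x)"
  using smooth_near_scaleR[OF smooth_near_const[of p "-1"], of f] by simp

lemma smooth_near_diff [intro]:
  "smooth_near p f \<Longrightarrow> smooth_near p g \<Longrightarrow> smooth_near p (\<lambda>x. f x - g x)"
  using smooth_near_add[OF _ smooth_near_minus, of p f g] by simp

lemma smooth_near_power [intro]:
  fixes f :: "'a::real_normed_vector \<Rightarrow> real"
  shows "smooth_near p f \<Longrightarrow> smooth_near p (\<lambda>x. f x ^ n)"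
  by (induction n) auto

lemma smooth_near_Pair [intro]:
  assumes "smooth_near p f" "smooth_near p g"
  shows "smooth_near p (\<lambda>x. (f x, g x))"
proof -
  obtain S where "open S" "p \<in> S" "smooth_on S f" "smooth_on S g"
    using assms by (rule smooth_near2E)
  then show ?thesis using smooth_on_Pair by (auto intro: smooth_nearI)
qed

lemma smooth_near_inverse [intro]:
  fixes f :: "'a::real_normed_vector \<Rightarrow> real"
  assumes "smooth_near p f" "f p \<noteq> 0"
  shows "smooth_near p (\<lambda>x. inverse (f x))"
  by (rule smooth_near_compose[OF smooth_nearI[OF smooth_on_inverse] assms(1)])
    (use assms(2) in \<open>auto simp: open_Collect_neq\<close>)

lemma smooth_near_divide [intro]:
  fixes f :: "'a::real_normed_vector \<Rightarrow> real"
  shows "smooth_near p f \<Longrightarrow> smooth_near p g \<Longrightarrow> g p \<noteq> 0 \<Longrightarrow> smooth_near p (\<lambda>x. f x / g x)"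
  using smooth_near_mult[OF _ smooth_near_inverse, of p f g] by (simp add: divide_inverse)

lemma smooth_near_sqrt [intro]:
  fixes f :: "'a::real_normed_vector \<Rightarrow> real"
  assumes "smooth_near p f" "f p > 0"
  shows "smooth_near p (\<lambda>x. sqrt (f x))"
  by (rule smooth_near_compose[OF smooth_nearI[OF smooth_on_sqrt] assms(1)]) (use assms(2) in auto)

lemma smooth_near_fst' [intro]:
  "smooth_near p (f :: 'a::real_normed_vector \<Rightarrow> 'b::euclidean_space \<times> 'c::euclidean_space) \<Longrightarrow> smooth_near p (\<lambda>x. fst (f x))"
  by (rule smooth_near_linear_compose[OF bounded_linear_fst])

lemma smooth_near_snd' [intro]:
  "smooth_near p (f :: 'a::real_normed_vector \<Rightarrow> 'b::euclidean_space \<times> 'c::euclidean_space) \<Longrightarrow> smooth_near p (\<lambda>x. snd (f x))"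
  by (rule smooth_near_linear_compose[OF bounded_linear_snd])

lemma smooth_near_compose2:
  fixes F :: "'b::euclidean_space \<times> 'c::euclidean_space \<Rightarrow> 'd::real_normed_vector"
  assumes "smooth_near (a p, b p) F" "smooth_near p a" "smooth_near p b"
  shows "smooth_near p (\<lambda>q. F (a q, b q))"
  by (rule smooth_near_compose[where g = "\<lambda>q. (a q, b q)"]) (use assms in auto)

lemma smooth_near_has_derivative:
  "smooth_near p f \<Longrightarrow> (f has_derivative frechet_derivative f (at p)) (at p)"
  using smooth_on_has_derivative by (auto simp: smooth_near_def)

lemma smooth_near_isCont: "smooth_near p f \<Longrightarrow> isCont f p"
  using smooth_near_has_derivative has_derivative_continuous by blast

lemma smooth_near_derivative: "smooth_near p f \<Longrightarrow> smooth_near p (\<lambda>x. frechet_derivative f (at x) v)"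
  using smooth_on_derivative by (metis smooth_near_def)

lemma smooth_near_pdv: "smooth_near p F \<Longrightarrow> smooth_near p (pdv F)"
  unfolding pdv_def by (rule smooth_near_derivative)

lemma eventually_nhds_compose:
  "\<forall>\<^sub>F y in nhds (f p). P y \<Longrightarrow> isCont f p \<Longrightarrow> \<forall>\<^sub>F x in nhds p. P (f x)"
  by (metis continuous_at filterlim_iff tendsto_at_iff_tendsto_nhds)

lemma has_derivative_pd:
  assumes "smooth_near p (F :: real \<times> real \<Rightarrow> 'b::real_normed_vector)"
  shows "(F has_derivative (\<lambda>v. fst v *\<^sub>R pdu F p + snd v *\<^sub>R pdv F p)) (at p)"
proof -
  have D: "(F has_derivative frechet_derivative F (at p)) (at p)"
    by (rule smooth_near_has_derivative[OF assms])
  interpret bounded_linear "frechet_derivative F (at p)" using has_derivative_bounded_linear[OF D] .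
  have "frechet_derivative F (at p) v = fst v *\<^sub>R pdu F p + snd v *\<^sub>R pdv F p" for v
  proof -
    have "v = fst v *\<^sub>R (1, 0) + snd v *\<^sub>R (0, 1)" by (simp add: prod_eq_iff)
    then show ?thesis unfolding pdu_def pdv_def by (metis add scaleR)
  qed
  then have "frechet_derivative F (at p) = (\<lambda>v. fst v *\<^sub>R pdu F p + snd v *\<^sub>R pdv F p)" by blast
  with D show ?thesis by simp
qed

lemma has_vector_derivative_pdu:
  assumes "smooth_near (x, y) (F :: real \<times> real \<Rightarrow> 'b::real_normed_vector)"
  shows "((\<lambda>x. F (x, y)) has_vector_derivative pdu F (x, y)) (at x)"
proof -
  have "((\<lambda>x. F (x, y)) has_derivative (\<lambda>t. fst (t, 0::real) *\<^sub>R pdu F (x, y) + snd (t, 0::real) *\<^sub>R pdv F (x, y))) (at x)"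
    by (rule has_derivative_compose[of "\<lambda>x. (x, y)" "\<lambda>t. (t, 0)"])
      (auto intro!: derivative_eq_intros has_derivative_pd[OF assms, simplified])
  then show ?thesis by (simp add: has_vector_derivative_def)
qed

lemma has_vector_derivative_pdv:
  assumes "smooth_near (x, y) (F :: real \<times> real \<Rightarrow> 'b::real_normed_vector)"
  shows "((\<lambda>y. F (x, y)) has_vector_derivative pdv F (x, y)) (at y)"
proof -
  have "((\<lambda>y. F (x, y)) has_derivative (\<lambda>t. fst (0::real, t) *\<^sub>R pdu F (x, y) + snd (0::real, t) *\<^sub>R pdv F (x, y))) (at y)"
    by (rule has_derivative_compose[of "\<lambda>y. (x, y)" "\<lambda>t. (0, t)"])
      (auto intro!: derivative_eq_intros has_derivative_pd[OF assms, simplified])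
  then show ?thesis by (simp add: has_vector_derivative_def)
qed

lemma DERIV_pdu: "smooth_near (x, y) F \<Longrightarrow> ((\<lambda>x. F (x, y)) has_field_derivative pdu F (x, y)) (at x)"
  and DERIV_pdv: "smooth_near (x, y) F \<Longrightarrow> ((\<lambda>y. F (x, y)) has_field_derivative pdv F (x, y)) (at y)"
  for F :: "real \<times> real \<Rightarrow> real"
  using has_vector_derivative_pdu has_vector_derivative_pdv
  by (auto simp: has_real_derivative_iff_has_vector_derivative)

lemma has_vector_derivative_along_curve:
  fixes F :: "real \<times> real \<Rightarrow> 'b::real_normed_vector"
  assumes "smooth_near (a t, b t) F" "(a has_field_derivative a') (at t)" "(b has_field_derivative b') (at t)"
  shows "((\<lambda>t. F (a t, b t)) has_vector_derivative (a' *\<^sub>R pdu F (a t, b t) + b' *\<^sub>R pdv F (a t, b t))) (at t)"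
proof -
  have "((\<lambda>t. F (a t, b t)) has_derivative (\<lambda>h. fst (a' * h, b' * h) *\<^sub>R pdu F (a t, b t) + snd (a' * h, b' * h) *\<^sub>R pdv F (a t, b t))) (at t)"
    by (rule has_derivative_compose[of "\<lambda>t. (a t, b t)" "\<lambda>h. (a' * h, b' * h)"])
      (use assms(2,3) in \<open>auto intro!: has_derivative_Pair has_derivative_pd[OF assms(1), simplified] simp: has_field_derivative_def\<close>)
  then show ?thesis by (simp add: has_vector_derivative_def scaleR_add_right mult.commute)
qed

lemma DERIV_along_curve:
  fixes F :: "real \<times> real \<Rightarrow> real"
  assumes "smooth_near (a t, b t) F" "(a has_field_derivative a') (at t)" "(b has_field_derivative b') (at t)"
  shows "((\<lambda>t. F (a t, b t)) has_field_derivative (a' * pdu F (a t, b t) + b' * pdv F (a t, b t))) (at t)"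
  using has_vector_derivative_along_curve[OF assms] by (simp add: has_real_derivative_iff_has_vector_derivative)

section \<open>Local diffeomorphisms and equivalence of germs\<close>

lemma diffeo_on_from_inverse_germ:
  assumes "smooth_near p f" "smooth_near (f p) g"
    and "\<forall>\<^sub>F x in nhds p. g (f x) = x" "\<forall>\<^sub>F y in nhds (f p). f (g y) = y"
  shows "\<exists>U. p \<in> U \<and> diffeo_on U f"
proof -
  obtain S0 where S0: "open S0" "p \<in> S0" "smooth_on S0 f" using assms(1) by (rule smooth_nearE)
  obtain T0 where T0: "open T0" "f p \<in> T0" "smooth_on T0 g" using assms(2) by (rule smooth_nearE)
  obtain S1 where S1: "open S1" "p \<in> S1" "\<And>x. x \<in> S1 \<Longrightarrow> g (f x) = x"
    using assms(3) by (auto simp: eventually_nhds)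
  obtain T1 where T1: "open T1" "f p \<in> T1" "\<And>x. x \<in> T1 \<Longrightarrow> f (g x) = x"
    using assms(4) by (auto simp: eventually_nhds)
  define T where "T = T0 \<inter> T1"
  define U where "U = (S0 \<inter> S1) \<inter> f -` T"
  define V where "V = T \<inter> g -` U"
  have cf: "continuous_on (S0 \<inter> S1) f" and cg: "continuous_on T g"
    using smooth_on_continuous[OF S0(3)] smooth_on_continuous[OF T0(3)]
    by (auto simp: T_def intro: continuous_on_subset)
  have oU: "open U" unfolding U_def
    by (rule continuous_open_preimage[OF cf]) (use S0 S1 T0 T1 in \<open>auto simp: T_def\<close>)
  have oV: "open V" unfolding V_def
    by (rule continuous_open_preimage[OF cg]) (use oU T0 T1 in \<open>auto simp: T_def\<close>)
  have fU: "f ` U = V"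
  proof
    show "f ` U \<subseteq> V" by (auto simp: U_def V_def S1)
    show "V \<subseteq> f ` U"
    proof
      fix y assume "y \<in> V"
      then have "g y \<in> U" "f (g y) = y" by (auto simp: V_def T_def T1)
      then show "y \<in> f ` U" by force
    qed
  qed
  have inj: "inj_on f U" by (rule inj_on_inverseI[of _ g]) (auto simp: U_def S1)
  have inv: "inv_into U f y = g y" if "y \<in> V" for y
    using that inj by (intro inv_into_f_eq) (auto simp: V_def T_def T1)
  have sf: "smooth_on U f" by (rule smooth_on_subset[OF S0(3)]) (auto simp: U_def)
  have "smooth_on V g" by (rule smooth_on_subset[OF T0(3)]) (auto simp: V_def T_def)
  then have sg: "smooth_on V (inv_into U f)" using smooth_on_cong[OF oV, of g "inv_into U f"] inv by simp
  have "p \<in> U" using S0 S1 T0 T1 by (auto simp: U_def T_def)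
  moreover have "diffeo_on U f"
    unfolding diffeo_on_def fU using oU oV inj sf sg by simp
  ultimately show ?thesis by blast
qed

lemma diffeo_on_inverse_germ:
  assumes "diffeo_on U f" "p \<in> U"
  shows "smooth_near p f" "smooth_near (f p) (inv_into U f)"
    "\<forall>\<^sub>F x in nhds p. inv_into U f (f x) = x" "\<forall>\<^sub>F y in nhds (f p). f (inv_into U f y) = y"
    "inv_into U f (f p) = p"
proof -
  have "p \<in> U" "f p \<in> f ` U" using assms by auto
  moreover have "open U" "open (f ` U)" "inj_on f U" using assms by (auto simp: diffeo_on_def)
  ultimately show "\<forall>\<^sub>F x in nhds p. inv_into U f (f x) = x" "\<forall>\<^sub>F y in nhds (f p). f (inv_into U f y) = y"
    "inv_into U f (f p) = p"
    by (auto intro!: eventually_nhds[THEN iffD2] exI[of _ U] exI[of _ "f ` U"] simp: f_inv_into_f)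
qed (use assms in \<open>auto simp: diffeo_on_def smooth_near_def\<close>)

definition inverse_germs :: "'a::real_normed_vector \<Rightarrow> ('a \<Rightarrow> 'b::real_normed_vector) \<Rightarrow> ('b \<Rightarrow> 'a) \<Rightarrow> bool" where
  "inverse_germs p f g \<longleftrightarrow> smooth_near p f \<and> smooth_near (f p) g \<and> g (f p) = p \<and>
     (\<forall>\<^sub>F x in nhds p. g (f x) = x) \<and> (\<forall>\<^sub>F y in nhds (f p). f (g y) = y)"

lemma inverse_germsI:
  assumes "smooth_near p f" "smooth_near (f p) g"
    "\<forall>\<^sub>F x in nhds p. g (f x) = x" "\<forall>\<^sub>F y in nhds (f p). f (g y) = y"
  shows "inverse_germs p f g"
  using assms eventually_nhds_x_imp_x[OF assms(3)] by (simp add: inverse_germs_def)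

lemma inverse_germs_sym: "inverse_germs p f g \<Longrightarrow> inverse_germs (f p) g f"
  by (auto simp: inverse_germs_def)

lemma inverse_germs_compose:
  fixes f :: "'a::euclidean_space \<Rightarrow> 'b::euclidean_space" and h :: "'b \<Rightarrow> 'c::euclidean_space"
  assumes "inverse_germs p f g" "inverse_germs (f p) h k"
  shows "inverse_germs p (\<lambda>x. h (f x)) (\<lambda>z. g (k z))"
proof (rule inverse_germsI)
  have kh: "k (h (f p)) = f p" using assms by (auto simp: inverse_germs_def)
  have "smooth_near p f" "smooth_near (f p) h" "smooth_near (h (f p)) k" "smooth_near (k (h (f p))) g"
    using assms kh by (simp_all add: inverse_germs_def)
  then show "smooth_near p (\<lambda>x. h (f x))" "smooth_near (h (f p)) (\<lambda>z. g (k z))"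
    by (blast intro: smooth_near_compose)+
  have cf: "isCont f p" and ck: "isCont k (h (f p))"
    using assms smooth_near_isCont by (auto simp: inverse_germs_def)
  have "\<forall>\<^sub>F x in nhds p. k (h (f x)) = f x" "\<forall>\<^sub>F x in nhds p. g (f x) = x"
    using eventually_nhds_compose[OF _ cf, of "\<lambda>y. k (h y) = y"] assms by (auto simp: inverse_germs_def)
  then show "\<forall>\<^sub>F x in nhds p. g (k (h (f x))) = x" by eventually_elim simp
  have "\<forall>\<^sub>F y in nhds (h (f p)). f (g (k y)) = k y" "\<forall>\<^sub>F y in nhds (h (f p)). h (k y) = y"
    using eventually_nhds_compose[OF _ ck, of "\<lambda>y. f (g y) = y"] assms kh by (auto simp: inverse_germs_def)
  then show "\<forall>\<^sub>F y in nhds (h (f p)). h (f (g (k y))) = y" by eventually_elim simp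
qed

text \<open>The definition of equivalence asks for diffeomorphisms between open sets; by this criterion mutually inverse germs
  suffice, so that no domains have to be tracked below.\<close>

lemma A_equivalent_iff:
  "A_equivalent F p G q \<longleftrightarrow> (\<exists>\<phi> \<phi>' \<psi> \<psi>'. inverse_germs p \<phi> \<phi>' \<and> \<phi> p = q \<and>
     inverse_germs (F p) \<psi> \<psi>' \<and> (\<forall>\<^sub>F x in nhds p. \<psi> (F x) = G (\<phi> x)))"
  (is "_ \<longleftrightarrow> ?R")
proof
  assume "A_equivalent F p G q"
  then obtain U W \<phi> \<psi> where *: "diffeo_on U \<phi>" "p \<in> U" "\<phi> p = q" "diffeo_on W \<psi>" "F p \<in> W"
    "\<forall>\<^sub>F x in nhds p. \<psi> (F x) = G (\<phi> x)"
    by (auto simp: A_equivalent_def)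
  have "inverse_germs p \<phi> (inv_into U \<phi>)" "inverse_germs (F p) \<psi> (inv_into W \<psi>)"
    using diffeo_on_inverse_germ[OF *(1,2)] diffeo_on_inverse_germ[OF *(4,5)] by (auto simp: inverse_germs_def)
  with * show ?R by blast
next
  assume ?R
  then obtain \<phi> \<phi>' \<psi> \<psi>' where *: "inverse_germs p \<phi> \<phi>'" "\<phi> p = q"
     "inverse_germs (F p) \<psi> \<psi>'" "\<forall>\<^sub>F x in nhds p. \<psi> (F x) = G (\<phi> x)" by blast
  obtain U where U: "p \<in> U" "diffeo_on U \<phi>"
    using diffeo_on_from_inverse_germ[of p \<phi> \<phi>'] *(1) unfolding inverse_germs_def by blast
  obtain W where W: "F p \<in> W" "diffeo_on W \<psi>"
    using diffeo_on_from_inverse_germ[of "F p" \<psi> \<psi>'] *(3) unfolding inverse_germs_def by blast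
  show "A_equivalent F p G q"
    unfolding A_equivalent_def using U W *(2,4) eventually_nhds_x_imp_x[OF *(4)] by blast
qed

lemma A_equivalent_trans:
  fixes F :: "'a::euclidean_space \<Rightarrow> 'b::euclidean_space"
  assumes "A_equivalent F p G q" "A_equivalent G q H r"
  shows "A_equivalent F p H r"
proof -
  obtain \<phi> \<phi>' \<psi> \<psi>' where 1: "inverse_germs p \<phi> \<phi>'" "\<phi> p = q"
     "inverse_germs (F p) \<psi> \<psi>'" "\<forall>\<^sub>F x in nhds p. \<psi> (F x) = G (\<phi> x)"
    using assms(1) by (auto simp: A_equivalent_iff)
  obtain \<alpha> \<alpha>' \<beta> \<beta>' where 2: "inverse_germs q \<alpha> \<alpha>'" "\<alpha> q = r"
     "inverse_germs (G q) \<beta> \<beta>'" "\<forall>\<^sub>F x in nhds q. \<beta> (G x) = H (\<alpha> x)"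
    using assms(2) by (auto simp: A_equivalent_iff)
  have c: "isCont \<phi> p" using 1 smooth_near_isCont by (auto simp: inverse_germs_def)
  have e: "\<psi> (F p) = G q" using eventually_nhds_x_imp_x[OF 1(4)] 1(2) by simp
  have "inverse_germs p (\<lambda>x. \<alpha> (\<phi> x)) (\<lambda>x. \<phi>' (\<alpha>' x))"
    by (rule inverse_germs_compose[OF 1(1)]) (use 1(2) 2(1) in simp)
  moreover have "inverse_germs (F p) (\<lambda>x. \<beta> (\<psi> x)) (\<lambda>x. \<psi>' (\<beta>' x))"
    by (rule inverse_germs_compose[OF 1(3)]) (use e 2(3) in simp)
  moreover have "\<forall>\<^sub>F x in nhds p. \<beta> (\<psi> (F x)) = H (\<alpha> (\<phi> x))"
  proof -
    have "\<forall>\<^sub>F x in nhds p. \<beta> (G (\<phi> x)) = H (\<alpha> (\<phi> x))"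
      by (rule eventually_nhds_compose[OF _ c]) (use 2(4) 1(2) in simp)
    with 1(4) show ?thesis by eventually_elim simp
  qed
  ultimately show ?thesis unfolding A_equivalent_iff using 1(2) 2(2) by blast
qed

text \<open>Continuity of \<open>F\<close> keeps \<open>F x\<close> inside the neighbourhood on which the target diffeomorphism can be undone.\<close>

lemma A_equivalent_sym:
  fixes F :: "'a::euclidean_space \<Rightarrow> 'b::euclidean_space"
  assumes "A_equivalent F p G q" "isCont F p"
  shows "A_equivalent G q F p"
proof -
  obtain \<phi> \<phi>' \<psi> \<psi>' where 1: "inverse_germs p \<phi> \<phi>'" "\<phi> p = q"
     "inverse_germs (F p) \<psi> \<psi>'" "\<forall>\<^sub>F x in nhds p. \<psi> (F x) = G (\<phi> x)"
    using assms(1) by (auto simp: A_equivalent_iff)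
  have G: "\<psi> (F p) = G q" using eventually_nhds_x_imp_x[OF 1(4)] 1(2) by simp
  have i: "inverse_germs q \<phi>' \<phi>" "inverse_germs (G q) \<psi>' \<psi>" "\<phi>' q = p"
    using inverse_germs_sym[OF 1(1)] inverse_germs_sym[OF 1(3)] 1(1,2) G by (auto simp: inverse_germs_def)
  have c: "isCont \<phi>' q" using i smooth_near_isCont by (auto simp: inverse_germs_def)
  have "\<forall>\<^sub>F z in nhds (F p). \<psi>' (\<psi> z) = z" using 1(3) by (simp add: inverse_germs_def)
  then have "\<forall>\<^sub>F x in nhds p. \<psi>' (\<psi> (F x)) = F x"
    by (rule eventually_nhds_compose[OF _ assms(2)])
  with 1(4) have "\<forall>\<^sub>F x in nhds p. \<psi>' (G (\<phi> x)) = F x"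
    by eventually_elim simp
  then have "\<forall>\<^sub>F y in nhds q. \<psi>' (G (\<phi> (\<phi>' y))) = F (\<phi>' y)"
    using eventually_nhds_compose[OF _ c, of "\<lambda>x. \<psi>' (G (\<phi> x)) = F x"] i(3) by simp
  moreover have "\<forall>\<^sub>F y in nhds q. \<phi> (\<phi>' y) = y" using 1 by (auto simp: inverse_germs_def)
  ultimately have "\<forall>\<^sub>F y in nhds q. \<psi>' (G y) = F (\<phi>' y)"
    by eventually_elim simp
  then show ?thesis unfolding A_equivalent_iff using i by blast
qed

text \<open>The inverse function theorem provides a differentiable local inverse \<open>(x, b (x, y))\<close>
  of \<open>(x, y) \<mapsto> (x, a (x, y))\<close>; since the partial derivatives of \<open>b\<close> are \<open>-a\<^sub>u/a\<^sub>v\<close> and \<open>1/a\<^sub>v\<close> at \<open>(x, b)\<close>, each order of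
  differentiability of \<open>b\<close> implies the next one.\<close>

lemma inverse_germs_snd:
  fixes a :: "real \<times> real \<Rightarrow> real"
  assumes "smooth_near p a" "pdv a p \<noteq> 0"
  obtains b where "inverse_germs p (\<lambda>q. (fst q, a q)) (\<lambda>q. (fst q, b q))" "smooth_near (fst p, a p) b"
proof -
  obtain U where U: "open U" "p \<in> U" "smooth_on U a" using assms(1) by (rule smooth_nearE)
  have sn: "smooth_near q a" if "q \<in> U" for q using U that by (auto simp: smooth_near_def)
  define T where "T q = (fst q, a q)" for q
  define C where "C = (\<lambda>v::real\<times>real. (fst v, 0::real))"
  define Cu where "Cu = (\<lambda>v::real\<times>real. (0::real, fst v))"
  define Cv where "Cv = (\<lambda>v::real\<times>real. (0::real, snd v))"
  have bl: "bounded_linear C" "bounded_linear Cu" "bounded_linear Cv"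
    unfolding C_def Cu_def Cv_def
    by (intro bounded_linear_Pair bounded_linear_fst bounded_linear_snd bounded_linear_zero)+
  define D where "D q = Blinfun C + pdu a q *\<^sub>R Blinfun Cu + pdv a q *\<^sub>R Blinfun Cv" for q
  have D: "blinfun_apply (D q) v = (fst v, fst v * pdu a q + snd v * pdv a q)" for q v
    using bl by (simp add: D_def blinfun.add_left blinfun.scaleR_left bounded_linear_Blinfun_apply C_def Cu_def Cv_def mult.commute)
  have der: "(T has_derivative blinfun_apply (D q)) (at q)" if "q \<in> U" for q
  proof -
    have "(T has_derivative (\<lambda>v. (fst v, fst v *\<^sub>R pdu a q + snd v *\<^sub>R pdv a q))) (at q)"
      unfolding T_def by (intro has_derivative_Pair has_derivative_fst has_derivative_ident has_derivative_pd sn that)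
    moreover have "blinfun_apply (D q) = (\<lambda>v. (fst v, fst v *\<^sub>R pdu a q + snd v *\<^sub>R pdv a q))"
      by (simp add: D fun_eq_iff)
    ultimately show ?thesis by simp
  qed
  have su: "smooth_on U (pdu a)" and sv: "smooth_on U (pdv a)"
    unfolding pdu_def pdv_def using smooth_on_derivative[OF U(3)] by auto
  have contD: "continuous_on U D"
    unfolding D_def using smooth_on_continuous[OF su] smooth_on_continuous[OF sv]
    by (intro continuous_intros)
  define R where "R = (\<lambda>v::real\<times>real. (fst v, (snd v - fst v * pdu a p) / pdv a p))"
  have blR: "bounded_linear R"
    unfolding R_def
    by (intro bounded_linear_Pair bounded_linear_fst bounded_linear_sub bounded_linear_snd
      bounded_linear_divide[THEN bounded_linear_compose] bounded_linear_mult_left[THEN bounded_linear_compose])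
  have R: "blinfun_apply (Blinfun R) v = (fst v, (snd v - fst v * pdu a p) / pdv a p)" for v
    by (simp only: bounded_linear_Blinfun_apply[OF blR]) (simp add: R_def)
  have RD: "Blinfun R o\<^sub>L D p = id_blinfun"
    by (rule blinfun_eqI) (use assms(2) in \<open>simp add: D R\<close>)
  obtain U' V g g' where V: "open U'" "U' \<subseteq> U" "p \<in> U'" "open V" "T p \<in> V" "homeomorphism U' V T g"
    "\<And>y. y \<in> V \<Longrightarrow> (g has_derivative (g' y)) (at y)"
    "\<And>y. y \<in> V \<Longrightarrow> g' y = inv (blinfun_apply (D (g y)))"
    "\<And>y. y \<in> V \<Longrightarrow> bij (blinfun_apply (D (g y)))"
    using inverse_function_theorem[OF U(1) der contD U(2) RD] by blast
  have gU: "g y \<in> U'" "T (g y) = y" if "y \<in> V" for y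
    using V(6) that by (auto simp: homeomorphism_def)
  have gT: "g (T x) = x" "T x \<in> V" if "x \<in> U'" for x
    using V(6) that by (auto simp: homeomorphism_def)
  define b where "b q = snd (g q)" for q
  have geq: "g y = (fst y, b y)" if "y \<in> V" for y
    using gU(2)[OF that] by (auto simp: T_def b_def prod_eq_iff)
  have nz: "pdv a (g y) \<noteq> 0" if "y \<in> V" for y
  proof
    assume "pdv a (g y) = 0"
    then have "blinfun_apply (D (g y)) (0, 1) = blinfun_apply (D (g y)) (0, 0)" by (simp add: D)
    then show False using V(9)[OF that] by (metis bij_def inj_def prod.inject zero_neq_one)
  qed
  have g': "g' y v = (fst v, (snd v - fst v * pdu a (g y)) * inverse (pdv a (g y)))" if "y \<in> V" for y v
  proof -
    have "blinfun_apply (D (g y)) (fst v, (snd v - fst v * pdu a (g y)) * inverse (pdv a (g y))) = v"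
      using nz[OF that] by (simp add: D prod_eq_iff field_simps)
    then show ?thesis using V(8,9)[OF that] by (metis bij_inv_eq_iff)
  qed
  have derb: "(b has_derivative (\<lambda>v. (snd v + fst v * (-1) * pdu a (g y)) * inverse (pdv a (g y)))) (at y)" if "y \<in> V" for y
  proof -
    have "(b has_derivative (\<lambda>v. snd (g' y v))) (at y)"
      unfolding b_def by (intro has_derivative_snd V(7) that)
    moreover have "(\<lambda>v. snd (g' y v)) = (\<lambda>v. (snd v + fst v * (-1) * pdu a (g y)) * inverse (pdv a (g y)))"
      using g'[OF that] by (auto simp: fun_eq_iff)
    ultimately show ?thesis by simp
  qed
  have Ck: "Ck_on k V b" for k
  proof (induction k)
    case 0
    have "continuous_on V g" using V(6) by (simp add: homeomorphism_def)
    then show ?case by (auto simp: b_def intro: continuous_intros)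
  next
    case (Suc k)
    have "Ck_on k V (\<lambda>y. fst y *\<^sub>R (1::real, 0::real) + b y *\<^sub>R (0, 1))"
      by (intro Ck_on_add Ck_on_bilinear[OF bounded_bilinear_scaleR] Ck_on_const V(4) Suc
          Ck_on_linear[OF bounded_linear_fst])
    then have Ckg: "Ck_on k V g"
      using Ck_on_cong[OF V(4), of "\<lambda>y. fst y *\<^sub>R (1, 0) + b y *\<^sub>R (0, 1)" g k] geq by simp
    have comp: "Ck_on k V (\<lambda>y. h (g y))" if "smooth_on U h" for h :: "real \<times> real \<Rightarrow> real"
      by (rule Ck_on_compose[OF V(4) U(1) _ that[unfolded smooth_on_def, rule_format] Ckg])
        (use gU(1) V(2) in blast)
    have inv: "Ck_on k V (\<lambda>y. inverse (pdv a (g y)))"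
      by (rule Ck_on_compose[where T = "{x. x \<noteq> 0}", OF V(4)])
        (use nz comp[OF sv] smooth_on_inverse[unfolded smooth_on_def] in \<open>auto simp: open_Collect_neq\<close>)
    have Db: "Ck_on k V (\<lambda>y. (snd v + fst v * (-1) * pdu a (g y)) * inverse (pdv a (g y)))" for v
      by (rule Ck_on_bilinear[OF bounded_bilinear_mult V(4) _ inv], rule Ck_on_add[OF V(4) Ck_on_const[OF V(4)]],
          rule Ck_on_bilinear[OF bounded_bilinear_mult V(4) Ck_on_const[OF V(4)] comp[OF su]])
    show ?case
      by (rule Ck_on_Suc_intro[OF V(4) derb Db])
  qed
  then have sb: "smooth_near (T p) b" using V(4,5) by (auto simp: smooth_near_def smooth_on_def)
  have "inverse_germs p T (\<lambda>q. (fst q, b q))"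
  proof (rule inverse_germsI)
    show "smooth_near p T" unfolding T_def by (intro smooth_near_Pair smooth_near_fst assms(1))
    show "smooth_near (T p) (\<lambda>q. (fst q, b q))" by (intro smooth_near_Pair smooth_near_fst sb)
    show "\<forall>\<^sub>F x in nhds p. (fst (T x), b (T x)) = x"
      unfolding eventually_nhds using V(1,3) gT geq by metis
    show "\<forall>\<^sub>F y in nhds (T p). T (fst y, b y) = y"
      unfolding eventually_nhds using V(4,5) gU geq by metis
  qed
  then show thesis using that sb unfolding T_def by blast
qed

section \<open>Division by a coordinate\<close>

lemma eventually_nhds_box:
  "(\<forall>\<^sub>F q in nhds (0::real, 0::real). P q) \<longleftrightarrow> (\<exists>r>0. \<forall>x y. \<bar>x\<bar> < r \<longrightarrow> \<bar>y\<bar> < r \<longrightarrow> P (x, y))"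
proof
  assume "\<forall>\<^sub>F q in nhds (0::real, 0::real). P q"
  then obtain S where S: "open S" "(0, 0) \<in> S" "\<And>q. q \<in> S \<Longrightarrow> P q" by (auto simp: eventually_nhds)
  obtain A B where "open A" "open B" "(0::real, 0::real) \<in> A \<times> B" "A \<times> B \<subseteq> S"
    by (rule open_prod_elim[OF S(1,2)])
  then have AB: "open A" "open B" "0 \<in> A" "0 \<in> B" "A \<times> B \<subseteq> S" by auto
  obtain r s where rs: "r > 0" "ball 0 r \<subseteq> A" "s > 0" "ball 0 s \<subseteq> B"
    using AB open_contains_ball by meson
  have "P (x, y)" if "\<bar>x\<bar> < min r s" "\<bar>y\<bar> < min r s" for x y
  proof -
    have "x \<in> A" "y \<in> B" using that rs by (auto simp: subset_iff)
    then show ?thesis using AB(5) S(3) by blast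
  qed
  then show "\<exists>r>0. \<forall>x y. \<bar>x\<bar> < r \<longrightarrow> \<bar>y\<bar> < r \<longrightarrow> P (x, y)"
    using rs by (intro exI[of _ "min r s"]) auto
next
  assume "\<exists>r>0. \<forall>x y. \<bar>x\<bar> < r \<longrightarrow> \<bar>y\<bar> < r \<longrightarrow> P (x, y)"
  then obtain r where r: "r > 0" "\<And>x y. \<bar>x\<bar> < r \<Longrightarrow> \<bar>y\<bar> < r \<Longrightarrow> P (x, y)" by blast
  show "\<forall>\<^sub>F q in nhds (0::real, 0::real). P q"
    unfolding eventually_nhds
    by (rule exI[of _ "{-r<..<r} \<times> {-r<..<r}"]) (use r in \<open>auto intro!: open_Times\<close>)
qed

lemma smooth_near_box:
  assumes "smooth_near (0::real, 0::real) F"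
  obtains r where "r > 0" "smooth_on ({-r<..<r} \<times> {-r<..<r}) F"
proof -
  obtain S where S: "open S" "(0, 0) \<in> S" "smooth_on S F" using assms by (rule smooth_nearE)
  have "\<forall>\<^sub>F q in nhds (0::real, 0::real). q \<in> S" using S by (auto simp: eventually_nhds)
  then obtain r where r: "r > 0" "\<And>x y. \<bar>x\<bar> < r \<Longrightarrow> \<bar>y\<bar> < r \<Longrightarrow> (x, y) \<in> S"
    unfolding eventually_nhds_box by blast
  have "{-r<..<r} \<times> {-r<..<r} \<subseteq> S" using r(2) by auto
  then show thesis using that r(1) smooth_on_subset[OF S(3)] by blast
qed

text \<open>Differentiating under the integral in \<open>x\<close> or \<open>y\<close> gives an integral of the same form, with \<open>j\<close> raised by one in the
  second case.\<close>

lemma smooth_on_integral_dilation: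
  fixes H :: "real \<times> real \<Rightarrow> real"
  assumes Q: "Q = {-r<..<r} \<times> {-r<..<r}" and "smooth_on Q H"
  shows "smooth_on Q (\<lambda>q. integral (cbox 0 1) (\<lambda>t. t ^ j * H (fst q, t * snd q)))"
proof -
  define P where "P F \<longleftrightarrow> (\<exists>H j. smooth_on Q H \<and>
    F = (\<lambda>q. integral (cbox 0 1) (\<lambda>t. t ^ j * H (fst q, t * snd q))))" for F :: "real \<times> real \<Rightarrow> real"
  have oQ: "open Q" by (auto simp: Q intro: open_Times)
  have scale: "(x, t * y) \<in> Q" if "(x, y) \<in> Q" "t \<in> cbox 0 1" for x y t :: real
  proof -
    have "\<bar>t * y\<bar> \<le> 1 * \<bar>y\<bar>" unfolding abs_mult using that by (intro mult_right_mono) auto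
    then show ?thesis using that by (auto simp: Q)
  qed
  have cont: "continuous_on (Q \<times> cbox 0 1) (\<lambda>(q, t). t ^ j * H (fst q, t * snd q))"
    if "smooth_on Q H" for H :: "real \<times> real \<Rightarrow> real" and j
  proof -
    have "continuous_on (Q \<times> cbox (0::real) 1) (\<lambda>z. H (fst (fst z), snd z * snd (fst z)))"
      by (rule continuous_on_compose2[OF smooth_on_continuous[OF that]])
        (use scale in \<open>auto intro!: continuous_intros\<close>)
    then show ?thesis by (auto simp: case_prod_unfold intro!: continuous_intros)
  qed
  have integrable: "(\<lambda>t. t ^ j * H (x, t * y)) integrable_on cbox 0 1"
    if "smooth_on Q H" "(x, y) \<in> Q" for H :: "real \<times> real \<Rightarrow> real" and j x y
  proof (rule integrable_continuous)
    have "continuous_on (cbox 0 1) (\<lambda>t. (\<lambda>(q, t). t ^ j * H (fst q, t * snd q)) ((x, y), t))"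
      by (rule continuous_on_compose2[OF cont[OF that(1), of j], of _ "\<lambda>t. ((x, y), t)"])
        (use that in \<open>auto intro!: continuous_intros\<close>)
    then show "continuous_on (cbox 0 1) (\<lambda>t. t ^ j * H (x, t * y))" by simp
  qed
  show ?thesis
  proof (rule smooth_on_partials_coinduct_real[where P = P, OF oQ])
    show "P (\<lambda>q. integral (cbox 0 1) (\<lambda>t. t ^ j * H (fst q, t * snd q)))"
      unfolding P_def using assms(2) by blast
  next
    fix F assume "P F"
    then show "continuous_on Q F"
      unfolding P_def using integral_continuous_on_param[OF cont] by blast
  next
    fix F assume "P F"
    then obtain H j where H: "smooth_on Q H" and
      F: "F = (\<lambda>q. integral (cbox 0 1) (\<lambda>t. t ^ j * H (fst q, t * snd q)))"
      unfolding P_def by blast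
    have Hu: "smooth_on Q (pdu H)" and Hv: "smooth_on Q (pdv H)"
      unfolding pdu_def pdv_def using smooth_on_derivative[OF H] by auto
    have sn: "smooth_near q H" if "q \<in> Q" for q using H oQ that by (auto simp: smooth_near_def)
    define F1 where "F1 = (\<lambda>q. integral (cbox 0 1) (\<lambda>t. t ^ j * pdu H (fst q, t * snd q)))"
    define F2 where "F2 = (\<lambda>q. integral (cbox 0 1) (\<lambda>t. t ^ Suc j * pdv H (fst q, t * snd q)))"
    have "P F1" "P F2" unfolding P_def F1_def F2_def using Hu Hv by blast+
    moreover have "((\<lambda>x. F (x, y)) has_field_derivative F1 (x, y)) (at x)" if xy: "(x, y) \<in> Q" for x y
    proof -
      have "((\<lambda>x. integral (cbox 0 1) (\<lambda>t. t ^ j * H (x, t * y))) has_field_derivative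
          integral (cbox 0 1) (\<lambda>t. t ^ j * pdu H (x, t * y))) (at x within {-r<..<r})"
      proof (rule leibniz_rule_field_derivative)
        fix x t assume "x \<in> {-r<..<r}" "t \<in> cbox (0::real) 1"
        then have "smooth_near (x, t * y) H" using xy scale sn by (auto simp: Q)
        then have "((\<lambda>x. t ^ j * H (x, t * y)) has_field_derivative t ^ j * pdu H (x, t * y)) (at x)"
          by (intro DERIV_cmult DERIV_pdu)
        then show "((\<lambda>x. t ^ j * H (x, t * y)) has_field_derivative t ^ j * pdu H (x, t * y)) (at x within {-r<..<r})"
          by (rule has_field_derivative_at_within)
      next
        have "continuous_on ({-r<..<r} \<times> cbox 0 1) (\<lambda>z. (\<lambda>(q, t). t ^ j * pdu H (fst q, t * snd q)) ((fst z, y), snd z))"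
          by (rule continuous_on_compose2[OF cont[OF Hu, of j], of _ "\<lambda>z. ((fst z, y), snd z)"])
            (use xy in \<open>auto simp: Q intro!: continuous_intros\<close>)
        then show "continuous_on ({-r<..<r} \<times> cbox 0 1) (\<lambda>(x, t). t ^ j * pdu H (x, t * y))"
          by (simp add: case_prod_unfold)
      qed (use xy integrable[OF H] in \<open>auto simp: Q\<close>)
      moreover have "at x within {-r<..<r} = at x" using xy by (intro at_within_open) (auto simp: Q)
      ultimately show ?thesis by (simp add: F F1_def)
    qed
    moreover have "((\<lambda>y. F (x, y)) has_field_derivative F2 (x, y)) (at y)" if xy: "(x, y) \<in> Q" for x y
    proof -
      have "((\<lambda>y. integral (cbox 0 1) (\<lambda>t. t ^ j * H (x, t * y))) has_field_derivative
          integral (cbox 0 1) (\<lambda>t. t ^ Suc j * pdv H (x, t * y))) (at y within {-r<..<r})"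
      proof (rule leibniz_rule_field_derivative)
        fix y t assume "y \<in> {-r<..<r}" "t \<in> cbox (0::real) 1"
        then have "smooth_near (x, t * y) H" using xy scale[of x y t] sn by (auto simp: Q)
        then have "((\<lambda>y. H (x, t * y)) has_field_derivative pdv H (x, t * y) * t) (at y)"
          by (intro DERIV_chain2[OF DERIV_pdv]) (auto intro!: derivative_eq_intros)
        then have "((\<lambda>y. t ^ j * H (x, t * y)) has_field_derivative t ^ j * (pdv H (x, t * y) * t)) (at y)"
          by (intro DERIV_cmult)
        then show "((\<lambda>y. t ^ j * H (x, t * y)) has_field_derivative t ^ Suc j * pdv H (x, t * y)) (at y within {-r<..<r})"
          by (simp add: has_field_derivative_at_within mult_ac)
      next
        have "continuous_on ({-r<..<r} \<times> cbox 0 1) (\<lambda>z. (\<lambda>(q, t). t ^ Suc j * pdv H (fst q, t * snd q)) ((x, fst z), snd z))"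
          by (rule continuous_on_compose2[OF cont[OF Hv, of "Suc j"], of _ "\<lambda>z. ((x, fst z), snd z)"])
            (use xy in \<open>auto simp: Q intro!: continuous_intros\<close>)
        then show "continuous_on ({-r<..<r} \<times> cbox 0 1) (\<lambda>(y, t). t ^ Suc j * pdv H (x, t * y))"
          by (simp add: case_prod_unfold)
      qed (use xy integrable[OF H] in \<open>auto simp: Q\<close>)
      moreover have "at y within {-r<..<r} = at y" using xy by (intro at_within_open) (auto simp: Q)
      ultimately show ?thesis by (simp add: F F2_def)
    qed
    ultimately show "\<exists>F1 F2. P F1 \<and> P F2 \<and> (\<forall>x y. (x, y) \<in> Q \<longrightarrow>
        ((\<lambda>x. F (x, y)) has_field_derivative F1 (x, y)) (at x) \<and>
        ((\<lambda>y. F (x, y)) has_field_derivative F2 (x, y)) (at y))"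
      by blast
  qed
qed

text \<open>Hadamard's lemma: \<open>F (x, y) = y \<integral>\<^sub>0\<^sup>1 F\<^sub>v (x, t y) dt\<close> when \<open>F (x, 0) = 0\<close>.\<close>

lemma divide_by_snd_on_box:
  fixes F :: "real \<times> real \<Rightarrow> real"
  assumes Q: "Q = {-r<..<r} \<times> {-r<..<r}" and "smooth_on Q F" and "\<And>x. \<bar>x\<bar> < r \<Longrightarrow> F (x, 0) = 0"
  obtains G where "smooth_on Q G" "\<And>x y. (x, y) \<in> Q \<Longrightarrow> F (x, y) = y * G (x, y)"
proof -
  have oQ: "open Q" by (auto simp: Q intro: open_Times)
  have sv: "smooth_on Q (pdv F)" unfolding pdv_def by (rule smooth_on_derivative[OF assms(2)])
  define G where "G = (\<lambda>q. integral (cbox 0 1) (\<lambda>t. t ^ 0 * pdv F (fst q, t * snd q)))"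
  have "smooth_on Q G" unfolding G_def by (rule smooth_on_integral_dilation[OF Q sv])
  moreover have "F (x, y) = y * G (x, y)" if xy: "(x, y) \<in> Q" for x y
  proof -
    have "((\<lambda>t. y * pdv F (x, t * y)) has_integral F (x, 1 * y) - F (x, 0 * y)) {0..1}"
    proof (rule fundamental_theorem_of_calculus)
      fix t :: real assume t: "t \<in> {0..1}"
      have "\<bar>t * y\<bar> \<le> 1 * \<bar>y\<bar>" unfolding abs_mult using t by (intro mult_right_mono) auto
      then have "(x, t * y) \<in> Q" using xy by (auto simp: Q)
      then have "smooth_near (x, t * y) F" using oQ assms(2) by (auto simp: smooth_near_def)
      then have "((\<lambda>t. F (x, t * y)) has_field_derivative pdv F (x, t * y) * y) (at t)"
        by (intro DERIV_chain2[OF DERIV_pdv]) (auto intro!: derivative_eq_intros)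
      then have "((\<lambda>t. F (x, t * y)) has_vector_derivative pdv F (x, t * y) * y) (at t)"
        by (simp add: has_real_derivative_iff_has_vector_derivative)
      then show "((\<lambda>t. F (x, t * y)) has_vector_derivative y * pdv F (x, t * y)) (at t within {0..1})"
        by (simp add: has_vector_derivative_at_within mult.commute)
    qed simp
    then have "integral {0..1} (\<lambda>t. y * pdv F (x, t * y)) = F (x, y) - F (x, 0)"
      by (intro integral_unique) simp
    moreover have "F (x, 0) = 0" using xy by (intro assms(3)) (auto simp: Q)
    ultimately show ?thesis by (simp add: G_def)
  qed
  ultimately show thesis using that by blast
qed

lemma divide_by_snd:
  fixes F :: "real \<times> real \<Rightarrow> real"
  assumes "smooth_near (0, 0) F" "\<forall>\<^sub>F x in nhds 0. F (x, 0) = 0"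
  obtains G where "smooth_near (0, 0) G" "\<forall>\<^sub>F q in nhds (0, 0). F q = snd q * G q"
proof -
  obtain r1 where r1: "r1 > 0" "smooth_on ({-r1<..<r1} \<times> {-r1<..<r1}) F"
    using assms(1) by (rule smooth_near_box)
  obtain r2 where r2: "r2 > 0" "\<And>x. \<bar>x\<bar> < r2 \<Longrightarrow> F (x, 0) = 0"
    using assms(2) by (auto simp: eventually_nhds_metric dist_real_def)
  define r where "r = min r1 r2"
  define Q where "Q = {-r<..<r} \<times> {-r<..<r}"
  have "smooth_on Q F" by (rule smooth_on_subset[OF r1(2)]) (auto simp: Q_def r_def)
  then obtain G where G: "smooth_on Q G" "\<And>x y. (x, y) \<in> Q \<Longrightarrow> F (x, y) = y * G (x, y)"
    using divide_by_snd_on_box[OF Q_def] r2(2) unfolding r_def by (metis min_less_iff_conj)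
  have Q: "open Q" "(0, 0) \<in> Q" using r1 r2 by (auto simp: Q_def r_def intro: open_Times)
  have "\<forall>\<^sub>F q in nhds (0, 0). F q = snd q * G q"
    unfolding eventually_nhds using Q G(2) by (intro exI[of _ Q]) auto
  with smooth_nearI[OF G(1) Q] show thesis by (rule that)
qed

section \<open>The moment sequence of Seeley\<close>

text \<open>Wanted are numbers \<open>a\<^sub>k\<close>, decaying faster than every power of \<open>2\<^sup>-\<^sup>k\<close>, with \<open>\<Sum>\<^sub>k a\<^sub>k (2\<^sup>k)\<^sup>n = (-1)\<^sup>n\<close> for all \<open>n\<close>. The
  weights of Lagrange interpolation at \<open>-1\<close> with nodes \<open>1, 2, \<dots>, 2\<^sup>N\<^sup>-\<^sup>1\<close> satisfy this for \<open>n < N\<close>, and they converge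
  as \<open>N\<close> grows. The weight of the node \<open>2\<^sup>k\<close> is split into the factors from smaller nodes, whose product is of order
  \<open>2\<close> to the power \<open>-k\<^sup>2/2\<close>, and those from larger nodes, whose product increases with \<open>N\<close> and is bounded.\<close>

definition seeley_head :: "nat \<Rightarrow> real" where
  "seeley_head k = (\<Prod>j<k. (- 1 - 2 ^ j) / (2 ^ k - 2 ^ j))"

definition seeley_factor :: "nat \<Rightarrow> nat \<Rightarrow> real" where
  "seeley_factor k j = (- 1 - 2 ^ j) / (2 ^ k - 2 ^ j)"

definition seeley_coeff :: "nat \<Rightarrow> nat \<Rightarrow> real" where
  "seeley_coeff N k = (if k < N then seeley_head k * (\<Prod>j\<in>{Suc k..<N}. seeley_factor k j) else 0)"

text \<open>The difference between \<open>\<xi>\<^sup>n\<close> and its interpolation polynomial has degree less than \<open>N\<close> and vanishes at \<open>N\<close> nodes.\<close>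

lemma seeley_coeff_moment:
  assumes "n < N"
  shows "(\<Sum>k<N. seeley_coeff N k * (2 ^ k) ^ n) = (-1) ^ n"
proof -
  define D where "D k = (\<Prod>j\<in>{..<N} - {k}. (2::real) ^ k - 2 ^ j)" for k
  define L where "L k = (\<Prod>j\<in>{..<N} - {k}. [:- ((2::real) ^ j), 1:])" for k
  define p where "p = (\<Sum>k<N. smult ((2 ^ k) ^ n / D k) (L k)) - monom 1 n"
  have D: "D k \<noteq> 0" for k unfolding D_def by auto
  have Lk: "poly (L k) x = (\<Prod>j\<in>{..<N} - {k}. x - 2 ^ j)" for k x
    by (simp add: L_def poly_prod)
  have degL: "degree (L k) \<le> N - 1" if "k < N" for k
  proof -
    have "degree (L k) \<le> (\<Sum>j\<in>{..<N} - {k}. degree [:- ((2::real) ^ j), 1:])"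
      unfolding L_def using degree_prod_sum_le[of "{..<N} - {k}" "\<lambda>j. [:- ((2::real) ^ j), 1:]"] by (simp add: o_def)
    also have "\<dots> \<le> N - 1" using that by simp
    finally show ?thesis .
  qed
  have deg: "degree p \<le> N - 1"
    unfolding p_def using assms degL
    by (intro degree_diff_le degree_sum_le) (auto intro: order_trans[OF degree_smult_le] order_trans[OF degree_monom_le])
  have root: "poly p (2 ^ m) = 0" if "m < N" for m
  proof -
    have "poly (L k) (2 ^ m) = (if k = m then D m else 0)" if "k < N" for k
    proof (cases "k = m")
      case False
      then have "m \<in> {..<N} - {k}" using \<open>m < N\<close> by auto
      then show ?thesis unfolding Lk using False by (auto intro!: prod_zero)
    qed (simp add: Lk D_def)
    then have "(\<Sum>k<N. (2 ^ k) ^ n / D k * poly (L k) (2 ^ m)) = (\<Sum>k<N. if k = m then (2 ^ m) ^ n else 0)"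
      using D by (intro sum.cong) auto
    then show ?thesis using \<open>m < N\<close> by (simp add: p_def poly_sum poly_monom)
  qed
  have "p = 0"
  proof (rule ccontr)
    assume "p \<noteq> 0"
    have "(\<lambda>m. 2 ^ m) ` {..<N} \<subseteq> {x. poly p x = 0}" using root by auto
    then have "card ((\<lambda>m. (2::real) ^ m) ` {..<N}) \<le> card {x. poly p x = 0}"
      using poly_roots_finite[OF \<open>p \<noteq> 0\<close>] by (rule card_mono[rotated])
    moreover have "card ((\<lambda>m. (2::real) ^ m) ` {..<N}) = N"
      by (subst card_image) (auto simp: inj_on_def)
    ultimately show False using card_poly_roots_bound[OF \<open>p \<noteq> 0\<close>] deg assms by linarith
  qed
  have "seeley_coeff N k = poly (L k) (-1) / D k" if "k < N" for k
  proof -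
    have split: "{..<N} - {k} = {..<k} \<union> {Suc k..<N}" using that by auto
    have "poly (L k) (-1) / D k = (\<Prod>j\<in>{..<k} \<union> {Suc k..<N}. (- 1 - 2 ^ j) / (2 ^ k - 2 ^ j))"
      by (simp add: Lk D_def split prod_dividef)
    also have "\<dots> = seeley_coeff N k"
      using that by (subst prod.union_disjoint) (auto simp: seeley_coeff_def seeley_head_def seeley_factor_def)
    finally show ?thesis by simp
  qed
  then have "(\<Sum>k<N. seeley_coeff N k * (2 ^ k) ^ n) = poly (p + monom 1 n) (-1)"
    by (auto simp: p_def poly_sum intro!: sum.cong)
  then show ?thesis using \<open>p = 0\<close> by (simp add: poly_monom)
qed

lemma seeley_factor_bounds:
  assumes "k < j"
  shows "1 \<le> seeley_factor k j" "seeley_factor k j \<le> exp (4 * 2 ^ k / 2 ^ j)"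
proof -
  have e: "seeley_factor k j = (1 + 2 ^ j) / (2 ^ j - 2 ^ k)"
    unfolding seeley_factor_def using minus_divide_divide[of "1 + 2 ^ j" "2 ^ j - 2 ^ k"] by simp
  have "(2::real) ^ Suc k \<le> 2 ^ j" using assms by (intro power_increasing) auto
  then have b: "2 * (2::real) ^ k \<le> 2 ^ j" by simp
  have k1: "(1::real) \<le> 2 ^ k" by simp
  have pos: "0 < (2::real) ^ j - 2 ^ k" using b k1 by linarith
  show "1 \<le> seeley_factor k j" unfolding e le_divide_eq_1_pos[OF pos] using k1 by linarith
  have "seeley_factor k j = 1 + (1 + 2 ^ k) / (2 ^ j - 2 ^ k)" unfolding e using pos by (simp add: divide_simps)
  also have "\<dots> \<le> 1 + (2 * 2 ^ k) / (2 ^ j / 2)" using b k1 by (intro add_left_mono frac_le) auto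
  also have "\<dots> = 1 + 4 * 2 ^ k / 2 ^ j" by simp
  also have "\<dots> \<le> exp (4 * 2 ^ k / 2 ^ j)" by (rule exp_ge_add_one_self)
  finally show "seeley_factor k j \<le> exp (4 * 2 ^ k / 2 ^ j)" .
qed

text \<open>The exponents \<open>4 \<cdot> 2\<^sup>k/2\<^sup>j\<close> of the bounds of the factors form a geometric series, which the term \<open>-4/2\<^sup>m\<close> telescopes.\<close>

lemma seeley_tail_bound:
  "(\<Prod>j\<in>{Suc k..<Suc k + m}. seeley_factor k j) \<le> exp (4 - 4 / 2 ^ m)"
proof (induction m)
  case (Suc m)
  have "(\<Prod>j\<in>{Suc k..<Suc k + Suc m}. seeley_factor k j)
      = (\<Prod>j\<in>{Suc k..<Suc k + m}. seeley_factor k j) * seeley_factor k (Suc k + m)"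
    by (simp add: prod.atLeastLessThan_Suc)
  also have "\<dots> \<le> exp (4 - 4 / 2 ^ m) * exp (4 * 2 ^ k / 2 ^ (Suc k + m))"
    using seeley_factor_bounds[of k "Suc k + m"] by (intro mult_mono Suc) auto
  also have "\<dots> = exp (4 - 4 / 2 ^ Suc m)"
    unfolding exp_add[symmetric] by (simp add: power_add field_simps)
  finally show ?case .
qed simp

lemma seeley_head_bound: "\<bar>seeley_head k\<bar> \<le> (\<Prod>j<k. 4 * 2 ^ j / 2 ^ k)"
  unfolding seeley_head_def abs_prod
proof (rule prod_mono)
  fix j assume j: "j \<in> {..<k}"
  have "(2::real) ^ Suc j \<le> 2 ^ k" using j by (intro power_increasing) auto
  then have b: "2 * (2::real) ^ j \<le> 2 ^ k" by simp
  have j1: "(1::real) \<le> 2 ^ j" by simp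
  have "\<bar>(- 1 - 2 ^ j) / (2 ^ k - 2 ^ j)\<bar> = (1 + 2 ^ j) / ((2::real) ^ k - 2 ^ j)"
  proof -
    have "\<bar>- 1 - 2 ^ j\<bar> = 1 + (2::real) ^ j" "\<bar>2 ^ k - 2 ^ j\<bar> = (2::real) ^ k - 2 ^ j"
      using b j1 by linarith+
    then show ?thesis by (simp only: abs_divide)
  qed
  also have "\<dots> \<le> (2 * 2 ^ j) / (2 ^ k / 2)" using b j1 by (intro frac_le) auto
  finally show "0 \<le> \<bar>(- 1 - (2::real) ^ j) / (2 ^ k - 2 ^ j)\<bar> \<and>
    \<bar>(- 1 - 2 ^ j) / (2 ^ k - 2 ^ j)\<bar> \<le> 4 * 2 ^ j / (2::real) ^ k" by simp
qed

lemma summable_seeley_majorant: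
  "summable (\<lambda>k. (\<Prod>j<k. 4 * 2 ^ j / (2::real) ^ k) * 2 ^ (k * n))"
proof (rule summable_ratio_test[where c = "1/2" and N = "n + 2"])
  define M where "M k = (\<Prod>j<k. 4 * 2 ^ j / (2::real) ^ k)" for k
  have M: "M (Suc k) = M k * 2 / 2 ^ k" for k
  proof -
    have "M (Suc k) = (\<Prod>j<k. 4 * 2 ^ j / 2 ^ k / (2::real)) * 2" by (simp add: M_def)
    also have "(\<Prod>j<k. 4 * 2 ^ j / 2 ^ k / (2::real)) = M k / 2 ^ k"
      unfolding M_def by (subst prod_dividef) simp
    finally show ?thesis by simp
  qed
  have M0: "M k \<ge> 0" for k unfolding M_def by (intro prod_nonneg) auto
  fix k assume k: "n + 2 \<le> k"
  have "(2::real) ^ (n + 2) \<le> 2 ^ k" using k by (intro power_increasing) auto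
  then have "(2::real) * 2 ^ n / 2 ^ k \<le> 1/2" by (simp add: field_simps)
  then have "M k * 2 ^ (k * n) * (2 * 2 ^ n / 2 ^ k) \<le> M k * 2 ^ (k * n) * (1/2)"
    using M0 by (intro mult_left_mono) auto
  moreover have "M (Suc k) * 2 ^ (Suc k * n) = M k * 2 ^ (k * n) * (2 * 2 ^ n / 2 ^ k)"
    unfolding M by (simp add: power_add)
  ultimately show "norm ((\<Prod>j<Suc k. 4 * 2 ^ j / (2::real) ^ Suc k) * 2 ^ (Suc k * n))
      \<le> 1/2 * norm ((\<Prod>j<k. 4 * 2 ^ j / (2::real) ^ k) * 2 ^ (k * n))"
    using M0[of k] M0[of "Suc k"] unfolding M_def[symmetric] by (simp add: abs_mult)
qed simp

lemma seeley_sequence: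
  obtains a :: "nat \<Rightarrow> real" where "\<And>n. summable (\<lambda>k. \<bar>a k\<bar> * 2 ^ (k * n))"
    "\<And>n. (\<Sum>k. a k * 2 ^ (k * n)) = (-1) ^ n"
proof -
  define M where "M k = (\<Prod>j<k. 4 * 2 ^ j / (2::real) ^ k)" for k
  have M0: "M k \<ge> 0" for k unfolding M_def by (intro prod_nonneg) auto
  have tail0: "0 \<le> (\<Prod>j\<in>{Suc k..<N}. seeley_factor k j)" for k N
  proof (rule prod_nonneg)
    fix j assume "j \<in> {Suc k..<N}"
    then show "0 \<le> seeley_factor k j" using seeley_factor_bounds(1)[of k j] by simp
  qed
  have tail: "(\<Prod>j\<in>{Suc k..<N}. seeley_factor k j) \<le> exp 4" for k N
  proof (cases "Suc k \<le> N")
    case True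
    then obtain m where "N = Suc k + m" using le_Suc_ex by blast
    then have "(\<Prod>j\<in>{Suc k..<N}. seeley_factor k j) \<le> exp (4 - 4 / 2 ^ m)"
      using seeley_tail_bound by simp
    also have "\<dots> \<le> exp 4" by simp
    finally show ?thesis .
  qed auto
  have bound: "\<bar>seeley_coeff N k\<bar> \<le> M k * exp 4" for N k
  proof (cases "k < N")
    case True
    have "\<bar>seeley_coeff N k\<bar> = \<bar>seeley_head k\<bar> * (\<Prod>j\<in>{Suc k..<N}. seeley_factor k j)"
      using True tail0[of k N] by (simp add: seeley_coeff_def abs_mult del: prod.op_ivl_Suc)
    also have "\<dots> \<le> M k * exp 4"
      using seeley_head_bound[of k] M0[of k] tail tail0 unfolding M_def by (intro mult_mono) auto
    finally show ?thesis .
  qed (simp add: seeley_coeff_def M0)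
  have "\<exists>l. (\<lambda>N. seeley_coeff N k) \<longlonglongrightarrow> l" for k
  proof -
    define R where "R m = (\<Prod>j\<in>{Suc k..<Suc k + m}. seeley_factor k j)" for m
    have "incseq R"
    proof (rule incseq_SucI)
      fix m
      have "R m * 1 \<le> R m * seeley_factor k (Suc k + m)"
        by (rule mult_left_mono[OF seeley_factor_bounds(1)]) (simp, simp only: R_def tail0)
      then show "R m \<le> R (Suc m)" by (simp add: R_def prod.atLeastLessThan_Suc)
    qed
    moreover have "R m \<le> exp 4" for m unfolding R_def by (rule tail)
    ultimately obtain l where "R \<longlonglongrightarrow> l" using incseq_convergent by blast
    then have "(\<lambda>m. seeley_head k * R m) \<longlonglongrightarrow> seeley_head k * l" by (intro tendsto_intros)
    moreover have "seeley_head k * R m = seeley_coeff (m + Suc k) k" for m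
      by (simp add: R_def seeley_coeff_def add.commute)
    ultimately have "(\<lambda>m. seeley_coeff (m + Suc k) k) \<longlonglongrightarrow> seeley_head k * l" by simp
    from LIMSEQ_offset[OF this] show ?thesis by blast
  qed
  then obtain a where a: "\<And>k. (\<lambda>N. seeley_coeff N k) \<longlonglongrightarrow> a k" by metis
  have ab: "\<bar>a k\<bar> \<le> M k * exp 4" for k
    by (rule tendsto_upperbound[OF tendsto_rabs[OF a]]) (auto simp: bound)
  have sM: "summable (\<lambda>k. M k * exp 4 * 2 ^ (k * n))" for n
    using summable_mult2[OF summable_seeley_majorant[of n, folded M_def], of "exp 4"] by (simp add: mult_ac)
  have "summable (\<lambda>k. \<bar>a k\<bar> * 2 ^ (k * n))" for n
    by (rule summable_comparison_test'[OF sM[of n], of 0]) (auto intro: ab)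
  moreover have "(\<Sum>k. a k * 2 ^ (k * n)) = (-1) ^ n" for n
  proof -
    have "(\<lambda>N. \<Sum>k. seeley_coeff N k * 2 ^ (k * n)) \<longlonglongrightarrow> (\<Sum>k. a k * 2 ^ (k * n))"
    proof (rule tannerys_theorem[THEN conjunct2, THEN conjunct2])
      show "((\<lambda>N. seeley_coeff N k * 2 ^ (k * n)) \<longlonglongrightarrow> a k * 2 ^ (k * n))" for k
        by (intro tendsto_intros a)
      show "summable (\<lambda>k. M k * exp 4 * 2 ^ (k * n))" by (rule sM)
      show "\<forall>\<^sub>F (k, N) in sequentially \<times>\<^sub>F sequentially. norm (seeley_coeff N k * 2 ^ (k * n)) \<le> M k * exp 4 * 2 ^ (k * n)"
        by (rule always_eventually) (auto simp: abs_mult intro!: mult_right_mono bound)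
    qed simp
    moreover have "\<forall>\<^sub>F N in sequentially. (\<Sum>k. seeley_coeff N k * 2 ^ (k * n)) = (-1) ^ n"
      using eventually_gt_at_top[of n]
    proof eventually_elim
      case (elim N)
      have "(\<Sum>k. seeley_coeff N k * 2 ^ (k * n)) = (\<Sum>k<N. seeley_coeff N k * 2 ^ (k * n))"
        by (rule suminf_finite) (auto simp: seeley_coeff_def)
      then show ?case using seeley_coeff_moment[OF elim] by (simp add: power_mult)
    qed
    then have "(\<lambda>N. \<Sum>k. seeley_coeff N k * 2 ^ (k * n)) \<longlonglongrightarrow> (-1) ^ n"
      by (rule tendsto_eventually)
    ultimately show ?thesis by (rule LIMSEQ_unique)
  qed
  ultimately show thesis by (rule that)
qed

section \<open>Even functions are functions of the square\<close>

text \<open>The box is larger than \<open>[-1, 1] \<times> [-1, 1]\<close>, so that all functions considered are bounded on the latter.\<close>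

definition even_on_box :: "(real \<times> real \<Rightarrow> real) \<Rightarrow> bool" where
  "even_on_box F \<longleftrightarrow> smooth_on ({-2<..<2} \<times> {-2<..<2}) F \<and> (\<forall>x y. \<bar>x\<bar> < 2 \<longrightarrow> \<bar>y\<bar> < 2 \<longrightarrow> F (x, - y) = F (x, y))"

lemma even_on_box_smooth_near: "even_on_box F \<Longrightarrow> \<bar>x\<bar> < 2 \<Longrightarrow> \<bar>y\<bar> < 2 \<Longrightarrow> smooth_near (x, y) F"
  unfolding even_on_box_def
  by (rule smooth_nearI[of "{-2<..<2} \<times> {-2<..<2}"]) (auto intro: open_Times)

lemma smooth_on_linear_substitution:
  fixes F :: "real \<times> real \<Rightarrow> real"
  assumes "smooth_on S F" "open S" "open T" "bounded_linear L" "L ` T \<subseteq> S"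
  shows "smooth_on T (\<lambda>q. F (L q))"
  by (rule smooth_on_compose[OF assms(3,2,5,1) smooth_on_linear[OF assms(4,3)]])

lemma even_on_box_pdu:
  assumes "even_on_box F"
  shows "even_on_box (pdu F)"
  unfolding even_on_box_def
proof (intro conjI allI impI)
  show "smooth_on ({-2<..<2} \<times> {-2<..<2}) (pdu F)"
    using assms smooth_on_derivative unfolding even_on_box_def pdu_def by blast
  fix x y :: real assume xy: "\<bar>x\<bar> < 2" "\<bar>y\<bar> < 2"
  have "((\<lambda>x. F (x, - y)) has_field_derivative pdu F (x, - y)) (at x)"
    by (rule DERIV_pdu[OF even_on_box_smooth_near[OF assms]]) (use xy in auto)
  moreover have "((\<lambda>x. F (x, - y)) has_field_derivative pdu F (x, y)) (at x)"
    by (rule has_field_derivative_transform_within_open[OF DERIV_pdu[OF even_on_box_smooth_near[OF assms xy]], of "{-2<..<2}"])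
      (use xy assms in \<open>auto simp: even_on_box_def\<close>)
  ultimately show "pdu F (x, - y) = pdu F (x, y)" by (rule DERIV_unique)
qed

lemma even_on_box_pdv:
  assumes "even_on_box F" "\<bar>x\<bar> < 2" "\<bar>y\<bar> < 2"
  shows "pdv F (x, - y) = - pdv F (x, y)"
proof -
  have "((\<lambda>y. F (x, y)) has_field_derivative pdv F (x, - y)) (at (- y))"
    by (rule DERIV_pdv[OF even_on_box_smooth_near[OF assms(1)]]) (use assms in auto)
  then have "((\<lambda>y. F (x, - y)) has_field_derivative pdv F (x, - y) * (-1)) (at y)"
    by (intro DERIV_chain2[of "\<lambda>y. F (x, y)"]) (auto intro!: derivative_eq_intros)
  moreover have "((\<lambda>y. F (x, - y)) has_field_derivative pdv F (x, y)) (at y)"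
    by (rule has_field_derivative_transform_within_open[OF DERIV_pdv[OF even_on_box_smooth_near[OF assms]], of "{-2<..<2}"])
      (use assms in \<open>auto simp: even_on_box_def\<close>)
  ultimately have "pdv F (x, - y) * (-1) = pdv F (x, y)" by (rule DERIV_unique)
  then show ?thesis by simp
qed

text \<open>Dividing \<open>F (x, y) - F (x, 0)\<close> by \<open>y\<close> and keeping only the odd part of the quotient changes nothing, since the difference
  is even; and the odd part vanishes for \<open>y = 0\<close>, so that a second division is possible.\<close>

lemma even_on_box_divide:
  assumes "even_on_box F"
  obtains G where "even_on_box G" "\<And>x y. \<bar>x\<bar> < 2 \<Longrightarrow> \<bar>y\<bar> < 2 \<Longrightarrow> F (x, y) = F (x, 0) + y\<^sup>2 * G (x, y)"
proof -
  define B where "B = {-2<..<2::real} \<times> {-2<..<2::real}"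
  have oB: "open B" by (auto simp: B_def intro: open_Times)
  have mem: "(x, y) \<in> B \<longleftrightarrow> \<bar>x\<bar> < 2 \<and> \<bar>y\<bar> < 2" for x y by (auto simp: B_def abs_less_iff)
  have F: "smooth_on B F" and ev: "\<And>x y. \<bar>x\<bar> < 2 \<Longrightarrow> \<bar>y\<bar> < 2 \<Longrightarrow> F (x, - y) = F (x, y)"
    using assms by (auto simp: even_on_box_def B_def)
  have bl: "bounded_linear (\<lambda>q::real\<times>real. (fst q, 0::real))" "bounded_linear (\<lambda>q::real\<times>real. (fst q, - snd q))"
    by (intro bounded_linear_Pair bounded_linear_fst bounded_linear_zero bounded_linear_minus bounded_linear_snd)+
  have refl: "smooth_on B (\<lambda>q. K (fst q, - snd q))" if "smooth_on B K" for K :: "real \<times> real \<Rightarrow> real"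
    by (rule smooth_on_linear_substitution[OF that oB oB bl(2)]) (auto simp: B_def)
  have scal: "smooth_on B (\<lambda>q. c * K q)" if "smooth_on B K" for K :: "real \<times> real \<Rightarrow> real" and c
    by (rule smooth_on_bilinear[OF bounded_bilinear_mult oB smooth_on_const[OF oB] that])
  have "smooth_on B (\<lambda>q. F q + (-1) * F (fst q, 0))"
    by (rule smooth_on_add[OF oB F scal[OF smooth_on_linear_substitution[OF F oB oB bl(1)]]]) (auto simp: B_def)
  then obtain K where K: "smooth_on B K" "\<And>x y. (x, y) \<in> B \<Longrightarrow> F (x, y) + (-1) * F (fst (x, y), 0) = y * K (x, y)"
    by (rule divide_by_snd_on_box[OF B_def]) auto
  define Ko where "Ko q = 1/2 * (K q + (-1) * K (fst q, - snd q))" for q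
  have Ko: "smooth_on B Ko"
    unfolding Ko_def by (intro scal smooth_on_add[OF oB] refl K)
  have FKo: "F (x, y) = F (x, 0) + y * Ko (x, y)" if xy: "\<bar>x\<bar> < 2" "\<bar>y\<bar> < 2" for x y
  proof -
    have "F (x, y) - F (x, 0) = y * K (x, y)" "F (x, - y) - F (x, 0) = (- y) * K (x, - y)"
      using K(2)[of x y] K(2)[of x "- y"] xy by (simp_all add: mem)
    then show ?thesis using ev[OF xy] by (simp add: Ko_def field_simps)
  qed
  obtain G where G: "smooth_on B G" "\<And>x y. (x, y) \<in> B \<Longrightarrow> Ko (x, y) = y * G (x, y)"
    by (rule divide_by_snd_on_box[OF B_def Ko]) (auto simp: Ko_def)
  define Ge where "Ge q = 1/2 * (G q + G (fst q, - snd q))" for q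
  have "smooth_on B Ge" unfolding Ge_def by (intro scal smooth_on_add[OF oB] refl G)
  then have "even_on_box Ge" by (auto simp: even_on_box_def Ge_def B_def)
  moreover have "F (x, y) = F (x, 0) + y\<^sup>2 * Ge (x, y)" if xy: "\<bar>x\<bar> < 2" "\<bar>y\<bar> < 2" for x y
  proof -
    have "F (x, y) = F (x, 0) + y * (y * G (x, y))" and "F (x, - y) = F (x, 0) + (- y) * ((- y) * G (x, - y))"
      using G(2)[of x y] G(2)[of x "- y"] xy FKo[of x y] FKo[of x "- y"] by (simp_all add: mem)
    then have "y * (y * G (x, y)) = y * (y * G (x, - y))" using ev[OF xy] by simp
    moreover have "y\<^sup>2 * Ge (x, y) = 1/2 * (y * (y * G (x, y))) + 1/2 * (y * (y * G (x, - y)))"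
      by (simp add: Ge_def power2_eq_square algebra_simps)
    ultimately show ?thesis using \<open>F (x, y) = F (x, 0) + y * (y * G (x, y))\<close> by linarith
  qed
  ultimately show thesis using that by blast
qed

text \<open>Differentiation with respect to \<open>z = y\<^sup>2\<close> acts on even functions \<open>F\<close> as \<open>F\<^sub>v/(2y)\<close>, which is again smooth and even.
  The factor \<open>(1 - y\<^sup>2)\<^sup>2\<close> appears because below \<open>y\<^sup>2 = z/(1 + z)\<close> rather than \<open>y\<^sup>2 = z\<close>.\<close>

lemma even_on_box_derivative:
  assumes "even_on_box F"
  obtains D where "even_on_box D"
    "\<And>x y. \<bar>x\<bar> < 2 \<Longrightarrow> \<bar>y\<bar> < 2 \<Longrightarrow> (1 - y\<^sup>2)\<^sup>2 * pdv F (x, y) = 2 * y * D (x, y)"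
    "\<And>x. \<bar>x\<bar> < 2 \<Longrightarrow> ((\<lambda>y. (F (x, y) - F (x, 0)) / y\<^sup>2) \<longlongrightarrow> D (x, 0)) (at 0)"
proof -
  define B where "B = {-2<..<2::real} \<times> {-2<..<2::real}"
  have oB: "open B" by (auto simp: B_def intro: open_Times)
  obtain G where G: "even_on_box G" "\<And>x y. \<bar>x\<bar> < 2 \<Longrightarrow> \<bar>y\<bar> < 2 \<Longrightarrow> F (x, y) = F (x, 0) + y\<^sup>2 * G (x, y)"
    using even_on_box_divide[OF assms] by blast
  define D where "D = (\<lambda>q. (1 - snd q ^ 2)^2 * (G q + 1/2 * (snd q * pdv G q)))"
  have "smooth_on B D"
  proof -
    note mult = smooth_on_bilinear[OF bounded_bilinear_mult oB]
    have s: "smooth_on B snd" by (rule smooth_on_linear[OF bounded_linear_snd oB])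
    have "smooth_on B (\<lambda>q. 1 + (-1) * (snd q * snd q))"
      by (intro smooth_on_add[OF oB] mult s smooth_on_const[OF oB])
    moreover have "smooth_on B (\<lambda>q. G q + 1/2 * (snd q * pdv G q))"
      using G(1) smooth_on_derivative unfolding even_on_box_def pdv_def B_def[symmetric]
      by (intro smooth_on_add[OF oB] mult s smooth_on_const[OF oB]) auto
    ultimately have "smooth_on B (\<lambda>q. ((1 + (-1) * (snd q * snd q)) * (1 + (-1) * (snd q * snd q))) * (G q + 1/2 * (snd q * pdv G q)))"
      by (intro mult)
    then show ?thesis by (simp add: D_def power2_eq_square)
  qed
  then have "even_on_box D"
    using G(1) even_on_box_pdv[OF G(1)] by (auto simp: even_on_box_def B_def[symmetric] D_def)
  moreover have "(1 - y\<^sup>2)\<^sup>2 * pdv F (x, y) = 2 * y * D (x, y)" if xy: "\<bar>x\<bar> < 2" "\<bar>y\<bar> < 2" for x y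
  proof -
    have "((\<lambda>y. F (x, 0) + y\<^sup>2 * G (x, y)) has_field_derivative 2 * y * G (x, y) + y\<^sup>2 * pdv G (x, y)) (at y)"
      by (auto intro!: derivative_eq_intros DERIV_pdv even_on_box_smooth_near[OF G(1)] xy)
    then have "((\<lambda>y. F (x, y)) has_field_derivative 2 * y * G (x, y) + y\<^sup>2 * pdv G (x, y)) (at y)"
    proof (rule has_field_derivative_transform_within_open[of _ _ _ "{-2<..<2}"])
      fix y assume "y \<in> {-2<..<2::real}"
      then show "F (x, 0) + y\<^sup>2 * G (x, y) = F (x, y)" by (intro G(2)[OF xy(1), symmetric]) auto
    qed (use xy in auto)
    then have "pdv F (x, y) = 2 * y * G (x, y) + y\<^sup>2 * pdv G (x, y)"
      using DERIV_pdv[OF even_on_box_smooth_near[OF assms xy]] by (rule DERIV_unique[rotated])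
    then have "(1 - y\<^sup>2)\<^sup>2 * pdv F (x, y) = (1 - y\<^sup>2)\<^sup>2 * (2 * y * G (x, y) + y\<^sup>2 * pdv G (x, y))" by simp
    also have "2 * y * G (x, y) + y\<^sup>2 * pdv G (x, y) = 2 * y * (G (x, y) + 1/2 * (y * pdv G (x, y)))"
      by (simp add: power2_eq_square algebra_simps)
    finally show ?thesis by (simp add: D_def mult_ac)
  qed
  moreover have "((\<lambda>y. (F (x, y) - F (x, 0)) / y\<^sup>2) \<longlongrightarrow> D (x, 0)) (at 0)" if x: "\<bar>x\<bar> < 2" for x
  proof -
    have "isCont (\<lambda>y. G (x, y)) 0"
      by (rule DERIV_isCont[OF DERIV_pdv[OF even_on_box_smooth_near[OF G(1) x]]]) simp
    then have "((\<lambda>y. G (x, y)) \<longlongrightarrow> G (x, 0)) (at 0)" by (simp add: isCont_def)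
    moreover have "\<forall>\<^sub>F y in at 0. (F (x, y) - F (x, 0)) / y\<^sup>2 = G (x, y)"
      unfolding eventually_at
    proof (rule exI[of _ 2], intro conjI ballI impI)
      fix y :: real assume y: "y \<noteq> 0 \<and> dist y 0 < 2"
      then have "F (x, y) - F (x, 0) = y\<^sup>2 * G (x, y)" using G(2)[OF x, of y] by (simp add: dist_real_def)
      then show "(F (x, y) - F (x, 0)) / y\<^sup>2 = G (x, y)" using y by simp
    qed simp
    ultimately have "((\<lambda>y. (F (x, y) - F (x, 0)) / y\<^sup>2) \<longlongrightarrow> G (x, 0)) (at 0)"
      by (simp add: tendsto_cong)
    then show ?thesis by (simp add: D_def)
  qed
  ultimately show thesis by (rule that)
qed

text \<open>The inverse of \<open>y \<mapsto> y\<^sup>2/(1 - y\<^sup>2)\<close>. It maps \<open>[0, \<infinity>)\<close> into \<open>[0, 1)\<close>, so that a function of \<open>y\<close> on the box becomes a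
  function of \<open>z \<in> [0, \<infinity>)\<close>, which can be dilated by all powers of 2.\<close>

definition squash :: "real \<Rightarrow> real" where
  "squash z = sqrt (z / (1 + z))"

lemma squash_range: "0 \<le> z \<Longrightarrow> 0 \<le> squash z" "0 \<le> z \<Longrightarrow> squash z < 1" "squash 0 = 0" "0 < z \<Longrightarrow> 0 < squash z"
  "0 \<le> z \<Longrightarrow> (squash z)\<^sup>2 = z / (1 + z)"
  by (auto simp: squash_def real_sqrt_lt_1_iff field_simps)

lemma continuous_on_squash: "continuous_on {0..} squash"
  unfolding squash_def by (intro continuous_intros) auto

lemma DERIV_squash:
  assumes "0 < z"
  shows "(squash has_field_derivative (1 - (squash z)\<^sup>2)\<^sup>2 / (2 * squash z)) (at z)"
proof -
  have "((\<lambda>z. z / (1 + z)) has_field_derivative 1 / (1 + z)\<^sup>2) (at z)"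
    using assms by (auto intro!: derivative_eq_intros simp: power2_eq_square)
  then have "((\<lambda>z. sqrt (z / (1 + z))) has_field_derivative
      inverse (sqrt (z / (1 + z))) / 2 * (1 / (1 + z)\<^sup>2)) (at z)"
    by (rule DERIV_chain2[OF DERIV_real_sqrt, rotated]) (use assms in auto)
  moreover have "1 - (squash z)\<^sup>2 = 1 / (1 + z)" using assms by (simp add: squash_range field_simps)
  then have "(1 - (squash z)\<^sup>2)\<^sup>2 / (2 * squash z) = inverse (squash z) / 2 * (1 / (1 + z)\<^sup>2)"
    by (simp only: power_one_over inverse_eq_divide) simp
  ultimately show ?thesis by (simp add: squash_def[abs_def])
qed

definition folded :: "(real \<times> real \<Rightarrow> real) \<Rightarrow> real \<times> real \<Rightarrow> real" where
  "folded F q = F (fst q, squash (snd q))"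

lemma folded_pdu:
  assumes "even_on_box F" "\<bar>x\<bar> < 2" "0 \<le> z"
  shows "((\<lambda>x. folded F (x, z)) has_field_derivative folded (pdu F) (x, z)) (at x)"
  unfolding folded_def fst_conv snd_conv
  by (rule DERIV_pdu[OF even_on_box_smooth_near[OF assms(1,2)]]) (use squash_range(1,2)[of z] assms in auto)

text \<open>At \<open>z = 0\<close> the function \<open>squash\<close> is not differentiable, but \<open>F (x, y) - F (x, 0)\<close> is divisible by \<open>y\<^sup>2\<close>, and \<open>y\<^sup>2\<close> is smooth in \<open>z\<close>.\<close>

lemma folded_derivative:
  assumes "even_on_box F"
  obtains D where "even_on_box D" "\<And>x z. \<bar>x\<bar> < 2 \<Longrightarrow> 0 \<le> z \<Longrightarrow>
    ((\<lambda>z. folded F (x, z)) has_field_derivative folded D (x, z)) (at z within {0..})"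
proof -
  obtain D where D: "even_on_box D"
    "\<And>x y. \<bar>x\<bar> < 2 \<Longrightarrow> \<bar>y\<bar> < 2 \<Longrightarrow> (1 - y\<^sup>2)\<^sup>2 * pdv F (x, y) = 2 * y * D (x, y)"
    "\<And>x. \<bar>x\<bar> < 2 \<Longrightarrow> ((\<lambda>y. (F (x, y) - F (x, 0)) / y\<^sup>2) \<longlongrightarrow> D (x, 0)) (at 0)"
    using even_on_box_derivative[OF assms] by blast
  have "((\<lambda>z. folded F (x, z)) has_field_derivative folded D (x, z)) (at z within {0..})"
    if x: "\<bar>x\<bar> < 2" and z: "0 \<le> z" for x z
  proof (cases "z = 0")
    case False
    then have z0: "0 < z" using z by simp
    note sq = squash_range(1,2)[OF z] squash_range(4)[OF z0]
    have "((\<lambda>z. F (x, squash z)) has_field_derivative pdv F (x, squash z) * ((1 - (squash z)\<^sup>2)\<^sup>2 / (2 * squash z))) (at z)"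
      by (rule DERIV_chain2[OF DERIV_pdv[OF even_on_box_smooth_near[OF assms x]] DERIV_squash[OF z0]]) (use sq in auto)
    moreover have "pdv F (x, squash z) * ((1 - (squash z)\<^sup>2)\<^sup>2 / (2 * squash z)) = D (x, squash z)"
      using D(2)[OF x, of "squash z"] sq by (simp add: field_simps)
    ultimately show ?thesis by (simp add: folded_def has_field_derivative_at_within)
  next
    case True
    have lim: "filterlim squash (at 0) (at 0 within {0..})"
    proof -
      have "(squash \<longlongrightarrow> squash 0) (at 0 within {0..})"
        using continuous_on_squash by (auto simp: continuous_on_def)
      moreover have "\<forall>\<^sub>F z in at 0 within {0..}. squash z \<noteq> 0"
        unfolding eventually_at_filter
      proof (rule always_eventually, intro allI impI)
        fix z :: real assume "z \<noteq> 0" "z \<in> {0..}"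
        then show "squash z \<noteq> 0" using squash_range(4)[of z] by simp
      qed
      ultimately show ?thesis by (simp add: filterlim_at squash_range(3))
    qed
    have "((\<lambda>z. (F (x, squash z) - F (x, 0)) / (squash z)\<^sup>2 * (1 / (1 + z))) \<longlongrightarrow> D (x, 0) * (1 / (1 + 0))) (at 0 within {0..})"
      by (intro tendsto_mult filterlim_compose[OF D(3)[OF x] lim] tendsto_intros) auto
    moreover have "\<forall>\<^sub>F z in at 0 within {0..}. (F (x, squash z) - F (x, 0)) / (squash z)\<^sup>2 * (1 / (1 + z)) = (F (x, squash z) - F (x, squash 0)) / (z - 0)"
      unfolding eventually_at_filter
    proof (rule always_eventually, intro allI impI)
      fix z :: real assume z: "z \<noteq> 0" "z \<in> {0..}"
      have "a / (z / (1 + z)) * (1 / (1 + z)) = a / z" for a using z by (simp add: divide_simps)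
      then show "(F (x, squash z) - F (x, 0)) / (squash z)\<^sup>2 * (1 / (1 + z)) = (F (x, squash z) - F (x, squash 0)) / (z - 0)"
        using z squash_range(3) squash_range(5)[of z] by simp
    qed
    ultimately have "((\<lambda>z. (F (x, squash z) - F (x, squash 0)) / (z - 0)) \<longlongrightarrow> D (x, 0)) (at 0 within {0..})"
      by (subst (asm) tendsto_cong) simp_all
    then show ?thesis using True by (simp add: folded_def has_field_derivative_iff squash_range)
  qed
  with D(1) show thesis using that by blast
qed

lemma folded_bounded:
  assumes "even_on_box F"
  obtains M where "\<And>x z. \<bar>x\<bar> \<le> 1 \<Longrightarrow> 0 \<le> z \<Longrightarrow> \<bar>folded F (x, z)\<bar> \<le> M"
proof -
  have "continuous_on ({-2<..<2} \<times> {-2<..<2}) F"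
    using smooth_on_continuous assms unfolding even_on_box_def by blast
  then have "continuous_on ({-1..1} \<times> {0..1}) F"
    by (rule continuous_on_subset) auto
  then have "compact (F ` ({-1..1} \<times> {0..1}))"
    by (intro compact_continuous_image compact_Times) auto
  then obtain M where M: "\<And>q. q \<in> {-1..1} \<times> {0..1} \<Longrightarrow> norm (F q) \<le> M"
    using compact_imp_bounded bounded_iff by (metis imageI)
  show thesis
  proof (rule that)
    fix x z :: real assume "\<bar>x\<bar> \<le> 1" "0 \<le> z"
    then show "\<bar>folded F (x, z)\<bar> \<le> M"
      using M[of "(x, squash z)"] squash_range(1,2)[of z] by (auto simp: folded_def abs_le_iff)
  qed
qed

lemma folded_continuous:
  assumes "even_on_box F"
  shows "continuous_on ({-1<..<1} \<times> {0..}) (folded F)"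
proof -
  have c: "continuous_on ({-2<..<2} \<times> {-2<..<2}) F"
    using smooth_on_continuous assms unfolding even_on_box_def by blast
  have "continuous_on ({-1<..<1} \<times> {0..}) (\<lambda>q::real\<times>real. (fst q, squash (snd q)))"
    by (intro continuous_intros continuous_on_compose2[OF continuous_on_squash]) auto
  then show ?thesis
    unfolding folded_def
    by (rule continuous_on_compose2[OF c]) (use squash_range(1,2) in \<open>fastforce\<close>)
qed

text \<open>Seeley's reflection: since \<open>\<Sum>\<^sub>k a\<^sub>k (2\<^sup>k)\<^sup>j = (-1)\<^sup>j\<close> for all \<open>j\<close>, the series on the side \<open>z \<le> 0\<close> fits together with
  all derivatives at \<open>z = 0\<close>. The exponent \<open>j\<close> counts the derivatives in \<open>z\<close> that have been taken.\<close>

definition seeley_side :: "(nat \<Rightarrow> real) \<Rightarrow> nat \<Rightarrow> (real \<times> real \<Rightarrow> real) \<Rightarrow> real \<times> real \<Rightarrow> real" where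
  "seeley_side a j F q = (-1) ^ j * (\<Sum>k. a k * 2 ^ (k * j) * folded F (fst q, 2 ^ k * (- snd q)))"

definition seeley_extension :: "(nat \<Rightarrow> real) \<Rightarrow> nat \<Rightarrow> (real \<times> real \<Rightarrow> real) \<Rightarrow> real \<times> real \<Rightarrow> real" where
  "seeley_extension a j F q = (if snd q \<le> 0 then seeley_side a j F q else folded F q)"

lemma DERIV_glue:
  fixes f :: "real \<Rightarrow> real"
  assumes "z \<le> 0 \<Longrightarrow> (f has_field_derivative d) (at z within {..0})"
    and "0 \<le> z \<Longrightarrow> (f has_field_derivative d) (at z within {0..})"
  shows "(f has_field_derivative d) (at z)"
proof -
  consider "z < 0" | "z = 0" | "z > 0" by linarith
  then show ?thesis
  proof cases
    case 1
    then have "at z within {..0} = at z" by (intro at_within_open_subset[of _ "{..<0}"]) auto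
    then show ?thesis using assms(1) 1 by simp
  next
    case 2
    have "(f has_field_derivative d) (at z within {..0} \<union> {0..})"
      using assms 2 unfolding has_field_derivative_iff by (intro Lim_Un) auto
    moreover have "{..0} \<union> {0..} = (UNIV :: real set)" by auto
    ultimately show ?thesis by simp
  next
    case 3
    then have "at z within {0..} = at z" by (intro at_within_open_subset[of _ "{0<..}"]) auto
    then show ?thesis using assms(2) 3 by simp
  qed
qed

lemma
  assumes a: "\<And>n. summable (\<lambda>k. \<bar>a k\<bar> * 2 ^ (k * n))" "\<And>n. (\<Sum>k. a k * 2 ^ (k * n)) = (-1) ^ n"
    and F: "even_on_box F"
  shows seeley_side_uniform: "uniform_limit ({-1<..<1} \<times> {..0})
      (\<lambda>n q. \<Sum>k<n. a k * 2 ^ (k * j) * folded F (fst q, 2 ^ k * (- snd q)))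
      (\<lambda>q. \<Sum>k. a k * 2 ^ (k * j) * folded F (fst q, 2 ^ k * (- snd q))) sequentially" (is ?A)
    and seeley_side_summable: "\<bar>x\<bar> < 1 \<Longrightarrow> z \<le> 0 \<Longrightarrow>
      summable (\<lambda>k. a k * 2 ^ (k * j) * folded F (x, 2 ^ k * (- z)))"
    and seeley_side_zero: "\<bar>x\<bar> < 1 \<Longrightarrow> seeley_side a j F (x, 0) = folded F (x, 0)"
    and seeley_extension_continuous: "continuous_on ({-1<..<1} \<times> UNIV) (seeley_extension a j F)"
proof -
  obtain M where M: "\<And>x z. \<bar>x\<bar> \<le> 1 \<Longrightarrow> 0 \<le> z \<Longrightarrow> \<bar>folded F (x, z)\<bar> \<le> M"
    using folded_bounded[OF F] by blast
  have sM: "summable (\<lambda>k. \<bar>a k\<bar> * 2 ^ (k * j) * M)" by (rule summable_mult2[OF a(1)])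
  have bound: "norm (a k * 2 ^ (k * j) * folded F (x, 2 ^ k * (- z))) \<le> \<bar>a k\<bar> * 2 ^ (k * j) * M"
    if "\<bar>x\<bar> < 1" "z \<le> 0" for k x z
    using M[of x "2 ^ k * (- z)"] that by (auto simp: abs_mult mult_nonneg_nonpos intro!: mult_left_mono)
  show u: ?A
    by (rule Weierstrass_m_test[OF _ sM]) (use bound in auto)
  show "summable (\<lambda>k. a k * 2 ^ (k * j) * folded F (x, 2 ^ k * (- z)))" if "\<bar>x\<bar> < 1" "z \<le> 0" for x z
    by (rule summable_comparison_test'[OF sM bound[OF that]])
  show zero: "seeley_side a j F (x, 0) = folded F (x, 0)" if "\<bar>x\<bar> < 1" for x
  proof -
    have "summable (\<lambda>k. a k * 2 ^ (k * j))"
      by (rule summable_norm_cancel) (use a(1)[of j] in \<open>simp add: abs_mult\<close>)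
    then have "(\<Sum>k. a k * 2 ^ (k * j) * folded F (x, 0)) = (-1) ^ j * folded F (x, 0)"
      using suminf_mult2[of "\<lambda>k. a k * 2 ^ (k * j)" "folded F (x, 0)"] a(2)[of j] by simp
    then show ?thesis by (simp add: seeley_side_def power_mult_distrib[symmetric] flip: mult.assoc)
  qed
  have "continuous_on ({-1<..<1} \<times> {..0}) (\<lambda>q. \<Sum>k. a k * 2 ^ (k * j) * folded F (fst q, 2 ^ k * (- snd q)))"
  proof (rule uniform_limit_theorem[OF always_eventually u], safe)
    fix n
    have "continuous_on ({-1<..<1} \<times> {..0}) (\<lambda>q. folded F (fst q, 2 ^ k * (- snd q)))" for k
      by (rule continuous_on_compose2[OF folded_continuous[OF F]])
        (auto intro!: continuous_intros simp: mult_nonneg_nonpos)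
    then show "continuous_on ({-1<..<1} \<times> {..0}) (\<lambda>q. \<Sum>k<n. a k * 2 ^ (k * j) * folded F (fst q, 2 ^ k * (- snd q)))"
      by (intro continuous_intros)
  qed simp
  then have "continuous_on ({-1<..<1} \<times> {..0}) (seeley_side a j F)"
    unfolding seeley_side_def by (intro continuous_intros)
  then have "continuous_on {q \<in> {-1<..<1} \<times> UNIV. snd q \<le> 0} (seeley_side a j F)"
    by (rule continuous_on_subset) auto
  moreover have "continuous_on {q \<in> {-1<..<1} \<times> UNIV. 0 \<le> snd q} (folded F)"
    by (rule continuous_on_subset[OF folded_continuous[OF F]]) auto
  ultimately show "continuous_on ({-1<..<1} \<times> UNIV) (seeley_extension a j F)"
    unfolding seeley_extension_def
    by (rule continuous_on_cases_le) (use zero in \<open>auto intro!: continuous_intros\<close>)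
qed

text \<open>Both partial derivatives of a member of the family \<open>seeley_extension a j F\<close> belong to the family: differentiating the
  series termwise in \<open>z\<close> multiplies the coefficients by \<open>-2\<^sup>k\<close>, that is, raises \<open>j\<close>. All members are continuous across \<open>z = 0\<close>
  by the moment equations.\<close>

lemma seeley_extension_smooth:
  assumes a: "\<And>n. summable (\<lambda>k. \<bar>a k\<bar> * 2 ^ (k * n))" "\<And>n. (\<Sum>k. a k * 2 ^ (k * n)) = (-1) ^ n"
    and "even_on_box F"
  shows "smooth_on ({-1<..<1} \<times> UNIV) (seeley_extension a j F)"
proof -
  define P where "P E \<longleftrightarrow> (\<exists>F j. even_on_box F \<and> E = seeley_extension a j F)" for E
  show ?thesis
  proof (rule smooth_on_partials_coinduct_real[where P = P])
    show "open ({-1<..<1::real} \<times> (UNIV :: real set))" by (intro open_Times) auto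
    show "P (seeley_extension a j F)" using assms(3) P_def by blast
    show "continuous_on ({-1<..<1} \<times> UNIV) E" if PE: "P E" for E
    proof -
      obtain F j where "even_on_box F" "E = seeley_extension a j F" using PE unfolding P_def by blast
      then show ?thesis using seeley_extension_continuous[OF a] by simp
    qed
  next
    fix E assume "P E"
    then obtain F j where F: "even_on_box F" and E: "E = seeley_extension a j F"
      unfolding P_def by blast
    obtain D where D: "even_on_box D" "\<And>x z. \<bar>x\<bar> < 2 \<Longrightarrow> 0 \<le> z \<Longrightarrow>
        ((\<lambda>z. folded F (x, z)) has_field_derivative folded D (x, z)) (at z within {0..})"
      using folded_derivative[OF F] by blast
    have on_pos: "seeley_extension a j F (x, z) = folded F (x, z)" if "0 \<le> z" "\<bar>x\<bar> < 1" "even_on_box F" for x z j F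
      using seeley_side_zero[OF a that(3,2)] that(1) by (cases "z = 0") (auto simp: seeley_extension_def)
    have u: "((\<lambda>x. seeley_extension a j F (x, z)) has_field_derivative seeley_extension a j (pdu F) (x, z)) (at x)"
      if x: "\<bar>x\<bar> < 1" for x z
    proof (cases "z \<le> 0")
      case False
      then show ?thesis using folded_pdu[OF F, of x z] x by (simp add: seeley_extension_def)
    next
      case True
      have "\<exists>g. \<forall>x\<in>{-1<..<1}. (\<lambda>k. a k * 2 ^ (k * j) * folded F (x, 2 ^ k * (- z))) sums g x \<and>
         (g has_field_derivative (\<Sum>k. a k * 2 ^ (k * j) * folded (pdu F) (x, 2 ^ k * (- z)))) (at x within {-1<..<1})"
      proof (rule has_field_derivative_series)
        show "((\<lambda>x. a k * 2 ^ (k * j) * folded F (x, 2 ^ k * (- z))) has_field_derivative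
             a k * 2 ^ (k * j) * folded (pdu F) (x, 2 ^ k * (- z))) (at x within {-1<..<1})"
          if "x \<in> {-1<..<1}" for k x
          by (intro DERIV_cmult has_field_derivative_at_within[OF folded_pdu[OF F]])
            (use that True in \<open>auto simp: mult_nonneg_nonpos\<close>)
        have "uniform_limit ({-1<..<1} \<times> {..0})
          (\<lambda>n q. \<Sum>k<n. a k * 2 ^ (k * j) * folded (pdu F) (fst q, 2 ^ k * (- snd q)))
          (\<lambda>q. \<Sum>k. a k * 2 ^ (k * j) * folded (pdu F) (fst q, 2 ^ k * (- snd q))) sequentially"
          by (rule seeley_side_uniform[OF a even_on_box_pdu[OF F]])
        from uniform_limit_compose'[OF this, of "\<lambda>x. (x, z)" "{-1<..<1}", unfolded fst_conv snd_conv]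
        show "uniform_limit {-1<..<1} (\<lambda>n x. \<Sum>k<n. a k * 2 ^ (k * j) * folded (pdu F) (x, 2 ^ k * (- z)))
          (\<lambda>x. \<Sum>k. a k * 2 ^ (k * j) * folded (pdu F) (x, 2 ^ k * (- z))) sequentially"
          using True by (simp add: abs_less_iff)
        show "(0::real) \<in> {-1<..<1}" by simp
        show "summable (\<lambda>k. a k * 2 ^ (k * j) * folded F (0, 2 ^ k * (- z)))"
          by (rule seeley_side_summable[OF a F]) (use True in auto)
      qed simp
      then obtain g where g: "\<And>x. x \<in> {-1<..<1} \<Longrightarrow> (\<lambda>k. a k * 2 ^ (k * j) * folded F (x, 2 ^ k * (- z))) sums g x"
         "\<And>x. x \<in> {-1<..<1} \<Longrightarrow> (g has_field_derivative (\<Sum>k. a k * 2 ^ (k * j) * folded (pdu F) (x, 2 ^ k * (- z)))) (at x within {-1<..<1})"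
        by blast
      have "at x within {-1<..<1} = at x" using x by (intro at_within_open) (auto simp: abs_less_iff)
      then have "((\<lambda>x. (-1) ^ j * g x) has_field_derivative (-1) ^ j * (\<Sum>k. a k * 2 ^ (k * j) * folded (pdu F) (x, 2 ^ k * (- z)))) (at x)"
        using g(2)[of x] x by (intro DERIV_cmult) (simp add: abs_less_iff)
      then have "((\<lambda>x. seeley_extension a j F (x, z)) has_field_derivative (-1) ^ j * (\<Sum>k. a k * 2 ^ (k * j) * folded (pdu F) (x, 2 ^ k * (- z)))) (at x)"
        by (rule has_field_derivative_transform_within_open[of _ _ _ "{-1<..<1}"])
          (use x True sums_unique[OF g(1)] in \<open>auto simp: seeley_extension_def seeley_side_def\<close>)
      then show ?thesis using True by (simp add: seeley_extension_def seeley_side_def)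
    qed
    have v: "((\<lambda>z. seeley_extension a j F (x, z)) has_field_derivative seeley_extension a (Suc j) D (x, z)) (at z)"
      if x: "\<bar>x\<bar> < 1" for x z
    proof (rule DERIV_glue)
      assume z: "0 \<le> z"
      have "((\<lambda>z. folded F (x, z)) has_field_derivative folded D (x, z)) (at z within {0..})"
        by (rule D(2)) (use x z in auto)
      then have "((\<lambda>z. seeley_extension a j F (x, z)) has_field_derivative folded D (x, z)) (at z within {0..})"
        by (rule has_field_derivative_transform_within[OF _ zero_less_one]) (use z x on_pos[OF _ x F] in auto)
      then show "((\<lambda>z. seeley_extension a j F (x, z)) has_field_derivative seeley_extension a (Suc j) D (x, z)) (at z within {0..})"
        using on_pos[OF z x D(1)] by simp
    next
      assume z: "z \<le> 0"
      have "\<exists>g. \<forall>z\<in>{..0}. (\<lambda>k. a k * 2 ^ (k * j) * folded F (x, 2 ^ k * (- z))) sums g z \<and>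
         (g has_field_derivative - (\<Sum>k. a k * 2 ^ (k * Suc j) * folded D (x, 2 ^ k * (- z)))) (at z within {..0})"
      proof (rule has_field_derivative_series)
        show "((\<lambda>z. a k * 2 ^ (k * j) * folded F (x, 2 ^ k * (- z))) has_field_derivative
             - (a k * 2 ^ (k * Suc j) * folded D (x, 2 ^ k * (- z)))) (at z within {..0})"
          if z: "z \<in> {..0}" for k z
        proof -
          have "((\<lambda>z. folded F (x, z)) has_field_derivative folded D (x, 2 ^ k * (- z))) (at (2 ^ k * (- z)) within {0..})"
            by (rule D(2)) (use x z in \<open>auto simp: mult_nonneg_nonpos\<close>)
          then have "((\<lambda>z. folded F (x, z)) has_field_derivative folded D (x, 2 ^ k * (- z))) (at (2 ^ k * (- z)) within (\<lambda>z. 2 ^ k * (- z)) ` {..0})"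
            by (rule has_field_derivative_subset) (auto simp: mult_nonneg_nonpos)
          then have "((\<lambda>z. folded F (x, z)) \<circ> (\<lambda>z. 2 ^ k * (- z)) has_field_derivative folded D (x, 2 ^ k * (- z)) * (2 ^ k * (-1))) (at z within {..0})"
            by (rule DERIV_image_chain) (auto intro!: derivative_eq_intros)
          then have "((\<lambda>z. a k * 2 ^ (k * j) * folded F (x, 2 ^ k * (- z))) has_field_derivative
              a k * 2 ^ (k * j) * (folded D (x, 2 ^ k * (- z)) * (2 ^ k * (-1)))) (at z within {..0})"
            by (intro DERIV_cmult) (simp add: o_def)
          then show ?thesis by (simp add: power_add mult_ac)
        qed
        have "uniform_limit ({-1<..<1} \<times> {..0})
          (\<lambda>n q. \<Sum>k<n. a k * 2 ^ (k * Suc j) * folded D (fst q, 2 ^ k * (- snd q)))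
          (\<lambda>q. \<Sum>k. a k * 2 ^ (k * Suc j) * folded D (fst q, 2 ^ k * (- snd q))) sequentially"
          by (rule seeley_side_uniform[OF a D(1)])
        from uniform_limit_compose'[OF this, of "\<lambda>z. (x, z)" "{..0}", unfolded fst_conv snd_conv]
        have "uniform_limit {..0} (\<lambda>n z. \<Sum>k<n. a k * 2 ^ (k * Suc j) * folded D (x, 2 ^ k * (- z)))
          (\<lambda>z. \<Sum>k. a k * 2 ^ (k * Suc j) * folded D (x, 2 ^ k * (- z))) sequentially"
          using x by (simp add: abs_less_iff)
        then show "uniform_limit {..0} (\<lambda>n z. \<Sum>k<n. - (a k * 2 ^ (k * Suc j) * folded D (x, 2 ^ k * (- z))))
          (\<lambda>z. - (\<Sum>k. a k * 2 ^ (k * Suc j) * folded D (x, 2 ^ k * (- z)))) sequentially"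
          unfolding sum_negf by (rule uniform_limit_uminus)
        show "(0::real) \<in> {..0}" by simp
        show "summable (\<lambda>k. a k * 2 ^ (k * j) * folded F (x, 2 ^ k * (- 0)))"
          by (rule seeley_side_summable[OF a F x]) auto
      qed simp
      then obtain g where g: "\<And>z. z \<in> {..0} \<Longrightarrow> (\<lambda>k. a k * 2 ^ (k * j) * folded F (x, 2 ^ k * (- z))) sums g z"
         "\<And>z. z \<in> {..0} \<Longrightarrow> (g has_field_derivative - (\<Sum>k. a k * 2 ^ (k * Suc j) * folded D (x, 2 ^ k * (- z)))) (at z within {..0})"
        by blast
      have "((\<lambda>z. (-1) ^ j * g z) has_field_derivative (-1) ^ j * - (\<Sum>k. a k * 2 ^ (k * Suc j) * folded D (x, 2 ^ k * (- z)))) (at z within {..0})"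
        by (rule DERIV_cmult[OF g(2)]) (use z in auto)
      then have "((\<lambda>z. seeley_extension a j F (x, z)) has_field_derivative (-1) ^ j * - (\<Sum>k. a k * 2 ^ (k * Suc j) * folded D (x, 2 ^ k * (- z)))) (at z within {..0})"
        by (rule has_field_derivative_transform_within[OF _ zero_less_one])
          (use z sums_unique[OF g(1)] in \<open>auto simp: seeley_extension_def seeley_side_def\<close>)
      then show "((\<lambda>z. seeley_extension a j F (x, z)) has_field_derivative seeley_extension a (Suc j) D (x, z)) (at z within {..0})"
        using z by (simp add: seeley_extension_def seeley_side_def)
    qed
    show "\<exists>F1 F2. P F1 \<and> P F2 \<and> (\<forall>x y. (x, y) \<in> {-1<..<1} \<times> UNIV \<longrightarrow>
        ((\<lambda>x. E (x, y)) has_field_derivative F1 (x, y)) (at x) \<and>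
        ((\<lambda>y. E (x, y)) has_field_derivative F2 (x, y)) (at y))"
    proof (intro exI conjI allI impI)
      show "P (seeley_extension a j (pdu F))" "P (seeley_extension a (Suc j) D)"
        unfolding P_def using even_on_box_pdu[OF F] D(1) by blast+
      fix x y :: real assume "(x, y) \<in> {-1<..<1} \<times> UNIV"
      then have "\<bar>x\<bar> < 1" by auto
      then show "((\<lambda>x. E (x, y)) has_field_derivative seeley_extension a j (pdu F) (x, y)) (at x)"
        "((\<lambda>y. E (x, y)) has_field_derivative seeley_extension a (Suc j) D (x, y)) (at y)"
        unfolding E by (rule u, rule v)
    qed
  qed
qed

text \<open>Whitney's theorem on even functions, with a parameter. On the half plane \<open>z \<ge> 0\<close> the function \<open>E\<close> is determined,
  and on \<open>z < 0\<close> it is the extension constructed above.\<close>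

theorem even_function_of_square:
  fixes F :: "real \<times> real \<Rightarrow> real"
  assumes "smooth_near (0, 0) F" "\<forall>\<^sub>F q in nhds (0, 0). F (fst q, - snd q) = F q"
  obtains E where "smooth_near (0, 0) E" "\<forall>\<^sub>F q in nhds (0, 0). F q = E (fst q, (snd q)\<^sup>2)"
proof -
  obtain r1 where r1: "r1 > 0" "smooth_on ({-r1<..<r1} \<times> {-r1<..<r1}) F"
    using assms(1) by (rule smooth_near_box)
  obtain r2 where r2: "r2 > 0" "\<And>x y. \<bar>x\<bar> < r2 \<Longrightarrow> \<bar>y\<bar> < r2 \<Longrightarrow> F (x, - y) = F (x, y)"
    using assms(2) unfolding eventually_nhds_box by auto
  \<comment> \<open>rescaling by \<open>d\<close> makes the domain contain the box of half-width 2\<close>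
  define d where "d = min r1 r2 / 2"
  have d: "d > 0" using r1 r2 by (simp add: d_def)
  define F' where "F' q = F (d *\<^sub>R q)" for q
  have scale: "\<bar>d * x\<bar> < r1 \<and> \<bar>d * x\<bar> < r2" if "\<bar>x\<bar> < 2" for x
  proof -
    have "d * \<bar>x\<bar> < d * 2" using that d by simp
    then show ?thesis using d by (auto simp: abs_mult d_def)
  qed
  have "even_on_box F'"
    unfolding even_on_box_def
  proof (intro conjI allI impI)
    show "smooth_on ({-2<..<2} \<times> {-2<..<2}) F'"
      unfolding F'_def
    proof (rule smooth_on_linear_substitution[OF r1(2) _ _ bounded_linear_scaleR_right])
      show "(*\<^sub>R) d ` ({-2<..<2} \<times> {-2<..<2}) \<subseteq> {-r1<..<r1} \<times> {-r1<..<r1}"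
      proof
        fix p assume "p \<in> (*\<^sub>R) d ` ({-2<..<2::real} \<times> {-2<..<2::real})"
        then obtain q where q: "p = d *\<^sub>R q" "q \<in> {-2<..<2} \<times> {-2<..<2}" by auto
        obtain x y where "q = (x, y)" by force
        with q have "p = (d * x, d * y)" "\<bar>x\<bar> < 2" "\<bar>y\<bar> < 2" by auto
        then show "p \<in> {-r1<..<r1} \<times> {-r1<..<r1}"
          using scale[of x] scale[of y] by (simp add: abs_less_iff)
      qed
    qed (auto intro: open_Times)
    show "F' (x, - y) = F' (x, y)" if "\<bar>x\<bar> < 2" "\<bar>y\<bar> < 2" for x y
      using r2(2)[of "d * x" "d * y"] scale that by (simp add: F'_def)
  qed
  obtain a :: "nat \<Rightarrow> real" where a: "\<And>n. summable (\<lambda>k. \<bar>a k\<bar> * 2 ^ (k * n))" "\<And>n. (\<Sum>k. a k * 2 ^ (k * n)) = (-1) ^ n"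
    by (rule seeley_sequence, rule that)
  define S where "S = seeley_extension a 0 F'"
  have S: "smooth_near (0, 0) S"
    unfolding S_def by (rule smooth_nearI[OF seeley_extension_smooth[OF a \<open>even_on_box F'\<close>]]) (auto intro: open_Times)
  \<comment> \<open>\<open>t/(1 - t)\<close> undoes the substitution \<open>t = z/(1 + z)\<close>\<close>
  define E where "E q = S (fst q / d, (snd q / d\<^sup>2) / (1 - snd q / d\<^sup>2))" for q
  have "smooth_near (0, 0) E"
    unfolding E_def
  proof (rule smooth_near_compose2)
    show "smooth_near (fst (0, 0) / d, snd (0, 0) / d\<^sup>2 / (1 - snd (0, 0) / d\<^sup>2)) S" using S by simp
  qed (intro smooth_near_divide smooth_near_diff smooth_near_const smooth_near_fst smooth_near_snd; use d in simp)+
  moreover have "\<forall>\<^sub>F q in nhds (0, 0). F q = E (fst q, (snd q)\<^sup>2)"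
    unfolding eventually_nhds_box
  proof (intro exI[of _ d] conjI allI impI)
    fix x y assume xy: "\<bar>x\<bar> < d" "\<bar>y\<bar> < d"
    define t where "t = y\<^sup>2 / d\<^sup>2"
    have t: "0 \<le> t" "t < 1" using xy d abs_square_less_1[of "y / d"] by (auto simp: t_def power_divide)
    have sq: "squash (t / (1 - t)) = \<bar>y\<bar> / d"
    proof -
      have "t / (1 - t) / (1 + t / (1 - t)) = t" using t by (simp add: field_simps)
      then have "squash (t / (1 - t)) = sqrt t" by (simp add: squash_def)
      then show ?thesis using d by (simp add: t_def real_sqrt_divide)
    qed
    have "\<bar>x / d\<bar> < 1" using xy d by simp
    have nn: "0 \<le> t / (1 - t)" using t by simp
    have "S (x / d, t / (1 - t)) = folded F' (x / d, t / (1 - t))"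
      using seeley_side_zero[OF a \<open>even_on_box F'\<close> \<open>\<bar>x / d\<bar> < 1\<close>, of 0] nn
      by (cases "t / (1 - t) = 0") (auto simp: S_def seeley_extension_def)
    also have "\<dots> = F (x, \<bar>y\<bar>)" using d by (simp add: folded_def sq F'_def)
    also have "\<dots> = F (x, y)" using r2(2)[of x y] xy d by (auto simp: abs_if d_def)
    finally show "F (x, y) = E (fst (x, y), (snd (x, y))\<^sup>2)" by (simp add: E_def t_def)
  qed (use d in simp)
  ultimately show thesis by (rule that)
qed

lemma eventually_nhds_along:
  "isCont f p \<Longrightarrow> \<forall>\<^sub>F y in nhds (f p). P y \<Longrightarrow> \<forall>\<^sub>F x in nhds p. P (f x)"
  by (rule eventually_nhds_compose)

lemma eventually_nhds_slice:
  fixes a c :: real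
  assumes "\<forall>\<^sub>F q in nhds (a, c). P q"
  shows "\<forall>\<^sub>F x in nhds a. P (x, c)" "\<forall>\<^sub>F y in nhds c. P (a, y)"
  by (rule eventually_nhds_along[where f = "\<lambda>x. (x, c)" and p = a, OF _ assms], simp,
      rule eventually_nhds_along[where f = "\<lambda>y. (a, y)" and p = c, OF _ assms], simp)

lemma eventually_nhds_nonzero:
  fixes f :: "'a::t2_space \<Rightarrow> real"
  assumes "isCont f p"
  shows "f p > 0 \<Longrightarrow> \<forall>\<^sub>F x in nhds p. f x > 0" "f p \<noteq> 0 \<Longrightarrow> \<forall>\<^sub>F x in nhds p. f x \<noteq> 0"
proof -
  show "\<forall>\<^sub>F x in nhds p. f x > 0" if "f p > 0"
    by (rule eventually_nhds_along[OF assms]) (use that in \<open>auto simp: eventually_nhds intro!: exI[of _ "{0<..}"]\<close>)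
  show "\<forall>\<^sub>F x in nhds p. f x \<noteq> 0" if "f p \<noteq> 0"
    by (rule eventually_nhds_along[OF assms]) (use that in \<open>auto simp: eventually_nhds intro!: exI[of _ "- {0}"]\<close>)
qed

section \<open>The Morse lemma with a parameter\<close>

lemma pdv_inverse_snd:
  fixes a b :: "real \<times> real \<Rightarrow> real"
  assumes "inverse_germs (x, s) (\<lambda>q. (fst q, a q)) (\<lambda>q. (fst q, b q))" "smooth_near (x, s) a"
    and "smooth_near (x, a (x, s)) b"
  shows "pdv a (x, s) * pdv b (x, a (x, s)) = 1"
proof -
  define y where "y = a (x, s)"
  have b: "b (x, y) = s" using assms(1) by (simp add: inverse_germs_def y_def)
  have "((\<lambda>y. a (x, b (x, y))) has_field_derivative pdv a (x, s) * pdv b (x, y)) (at y)"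
    by (rule DERIV_chain2[of "\<lambda>s. a (x, s)"])
      (use DERIV_pdv[OF assms(2)] DERIV_pdv[OF assms(3)] b in \<open>simp_all add: y_def\<close>)
  moreover have "\<forall>\<^sub>F q in nhds (x, y). a (fst q, b q) = snd q"
    using assms(1) by (auto simp: inverse_germs_def y_def prod_eq_iff)
  then have "\<forall>\<^sub>F t in nhds y. a (fst (x, t), b (x, t)) = snd (x, t)"
    by (rule eventually_nhds_slice(2))
  then have "((\<lambda>y. a (x, b (x, y))) has_field_derivative 1) (at y)"
    by (subst DERIV_cong_ev[OF refl _ refl, of _ "\<lambda>y. y"]) auto
  ultimately show ?thesis unfolding y_def by (rule DERIV_unique)
qed

lemma smooth_near_slice: "smooth_near 0 (\<lambda>x::real. (x, c::real))"
  by (intro smooth_near_Pair smooth_near_id smooth_near_const)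

text \<open>The critical point \<open>s (x)\<close> of \<open>A (x, \<cdot>)\<close> depends smoothly on \<open>x\<close>, and dividing twice by \<open>t\<close> gives
  \<open>A (x, s (x) + t) = A (x, s (x)) + t\<^sup>2 G (x, t)\<close>. The new coordinate is \<open>t \<surd>\<bar>G\<bar>\<close>.\<close>

lemma morse_with_parameter:
  fixes A :: "real \<times> real \<Rightarrow> real"
  assumes A: "smooth_near (0, 0) A" and crit: "pdv A (0, 0) = 0" and nd: "pdv (pdv A) (0, 0) \<noteq> 0"
  obtains \<sigma> r where "smooth_near (0, 0) \<sigma>" "smooth_near 0 r" "\<sigma> (0, 0) = 0" "pdv \<sigma> (0, 0) > 0" "r 0 = A (0, 0)"
    "\<forall>\<^sub>F q in nhds (0, 0). A (fst q, \<sigma> q) = r (fst q) + sgn (pdv (pdv A) (0, 0)) * (snd q)\<^sup>2"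
proof -
  obtain b where b: "inverse_germs (0, 0) (\<lambda>q. (fst q, pdv A q)) (\<lambda>q. (fst q, b q))"
    and b_smooth: "smooth_near (0, 0) b"
    using inverse_germs_snd[OF smooth_near_pdv[OF A] nd] crit by (metis fst_conv)
  define s where "s x = b (x, 0)" for x
  have s0: "s 0 = 0" using b by (simp add: inverse_germs_def s_def crit)
  have s: "smooth_near 0 s"
    unfolding s_def by (rule smooth_near_compose[OF _ smooth_near_slice]) (use b_smooth in simp)
  have s_crit: "\<forall>\<^sub>F x in nhds 0. pdv A (x, s x) = 0"
  proof -
    have "\<forall>\<^sub>F q in nhds (0, 0). pdv A (fst q, b q) = snd q"
      using b by (auto simp: inverse_germs_def crit prod_eq_iff)
    then have "\<forall>\<^sub>F x in nhds 0. pdv A (fst (x, 0::real), b (x, 0)) = snd (x, 0::real)"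
      by (rule eventually_nhds_slice(1))
    then show ?thesis by (simp add: s_def)
  qed
  have sf: "smooth_near (0, 0) (\<lambda>q::real\<times>real. s (fst q))"
    by (rule smooth_near_compose[OF _ smooth_near_fst]) (use s in simp)
  define B where "B q = A (fst q, s (fst q) + snd q) - A (fst q, s (fst q))" for q
  have B: "smooth_near (0, 0) B"
    unfolding B_def
    by (intro smooth_near_diff smooth_near_compose2[where F = A] smooth_near_fst smooth_near_add sf smooth_near_snd)
      (use A s0 in simp_all)
  obtain G1 where G1: "smooth_near (0, 0) G1" "\<forall>\<^sub>F q in nhds (0, 0). B q = snd q * G1 q"
    using divide_by_snd[OF B] by (auto simp: B_def)
  have "\<forall>\<^sub>F x in nhds 0. G1 (x, 0) = 0"
  proof -
    have 1: "\<forall>\<^sub>F x in nhds 0. \<forall>\<^sub>F q in nhds (x, 0). B q = snd q * G1 q"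
      by (rule eventually_nhds_slice(1)) (use G1(2) in \<open>simp add: eventually_eventually\<close>)
    have 2: "\<forall>\<^sub>F x in nhds 0. smooth_near (x, 0) G1"
      by (rule eventually_nhds_slice(1)) (rule smooth_near_eventually[OF G1(1)])
    have 3: "\<forall>\<^sub>F x in nhds 0. smooth_near (x, s x) A"
    proof -
      have "isCont (\<lambda>x. (x, s x)) 0" using smooth_near_isCont[OF s] by (intro continuous_intros)
      then show ?thesis
        using eventually_nhds_along[where f = "\<lambda>x. (x, s x)" and p = 0 and P = "\<lambda>q. smooth_near q A"] smooth_near_eventually[OF A] s0 by simp
    qed
    from 1 2 3 s_crit show ?thesis
    proof eventually_elim
      case (elim x)
      have "((\<lambda>t. A (x, s x + t)) has_field_derivative pdv A (x, s x) * 1) (at 0)"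
        by (rule DERIV_chain2[of "\<lambda>y. A (x, y)"]) (auto intro!: derivative_eq_intros DERIV_pdv elim)
      then have d1: "((\<lambda>t. B (x, t)) has_field_derivative 0) (at 0)"
        using elim by (auto simp: B_def intro!: derivative_eq_intros)
      have "((\<lambda>t. t * G1 (x, t)) has_field_derivative G1 (x, 0)) (at 0)"
        using DERIV_pdv[OF elim(2)] by (auto intro!: derivative_eq_intros)
      moreover have "\<forall>\<^sub>F t in nhds 0. B (x, t) = t * G1 (x, t)"
        using eventually_nhds_slice(2)[OF elim(1)] by simp
      ultimately have "((\<lambda>t. B (x, t)) has_field_derivative G1 (x, 0)) (at 0)"
        by (subst DERIV_cong_ev[OF refl _ refl, of _ "\<lambda>t. t * G1 (x, t)"])
      with d1 show ?case by (metis DERIV_unique)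
    qed
  qed
  then obtain G where G: "smooth_near (0, 0) G" "\<forall>\<^sub>F q in nhds (0, 0). G1 q = snd q * G q"
    using divide_by_snd[OF G1(1)] by blast
  have BG: "\<forall>\<^sub>F q in nhds (0, 0). B q = (snd q)\<^sup>2 * G q"
    using G1(2) G(2) by eventually_elim (simp add: power2_eq_square)
  have G0: "2 * G (0, 0) = pdv (pdv A) (0, 0)"
  proof -
    have 1: "\<forall>\<^sub>F t in nhds 0. \<forall>\<^sub>F q in nhds (0::real, t). B q = (snd q)\<^sup>2 * G q"
      by (rule eventually_nhds_slice(2)) (use BG in \<open>simp add: eventually_eventually\<close>)
    have 2: "\<forall>\<^sub>F t in nhds 0. smooth_near (0::real, t) G" "\<forall>\<^sub>F t in nhds 0. smooth_near (0::real, t) A"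
      by (rule eventually_nhds_slice(2), rule smooth_near_eventually, rule G(1) A)+
    have "\<forall>\<^sub>F t in nhds 0. pdv A (0, t) = 2 * t * G (0, t) + t\<^sup>2 * pdv G (0, t)"
      using 1 2
    proof eventually_elim
      case (elim t)
      have "\<forall>\<^sub>F t in nhds t. A (0, t) = A (0, 0) + t\<^sup>2 * G (0, t)"
      proof -
        have "\<forall>\<^sub>F t' in nhds t. B (0, t') = (snd (0::real, t'))\<^sup>2 * G (0, t')"
          by (rule eventually_nhds_slice(2)[OF elim(1)])
        then show ?thesis by eventually_elim (simp add: B_def s0)
      qed
      moreover have "((\<lambda>t. A (0, 0) + t\<^sup>2 * G (0, t)) has_field_derivative 2 * t * G (0, t) + t\<^sup>2 * pdv G (0, t)) (at t)"
        using DERIV_pdv[OF elim(2)] by (auto intro!: derivative_eq_intros)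
      ultimately have "((\<lambda>t. A (0, t)) has_field_derivative 2 * t * G (0, t) + t\<^sup>2 * pdv G (0, t)) (at t)"
        by (subst DERIV_cong_ev[OF refl _ refl, of _ "\<lambda>t. A (0, 0) + t\<^sup>2 * G (0, t)"])
      then show ?case using DERIV_pdv[OF elim(3)] by (metis DERIV_unique)
    qed
    moreover have "((\<lambda>t. 2 * t * G (0, t) + t\<^sup>2 * pdv G (0, t)) has_field_derivative 2 * G (0, 0)) (at 0)"
      using DERIV_pdv[OF G(1)] DERIV_pdv[OF smooth_near_pdv[OF G(1)]] by (auto intro!: derivative_eq_intros)
    ultimately have "((\<lambda>t. pdv A (0, t)) has_field_derivative 2 * G (0, 0)) (at 0)"
      by (subst DERIV_cong_ev[OF refl _ refl, of _ "\<lambda>t. 2 * t * G (0, t) + t\<^sup>2 * pdv G (0, t)"])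
    then show ?thesis using DERIV_pdv[OF smooth_near_pdv[OF A]] by (metis DERIV_unique)
  qed
  define \<epsilon> where "\<epsilon> = sgn (pdv (pdv A) (0, 0))"
  have eps: "\<epsilon> * \<epsilon> = 1" using nd by (simp add: \<epsilon>_def sgn_if)
  have eG: "\<epsilon> * G (0, 0) > 0" unfolding \<epsilon>_def G0[symmetric] using nd G0 by (auto simp: sgn_if)
  define H where "H q = sqrt (\<epsilon> * G q)" for q
  have H: "smooth_near (0, 0) H"
    unfolding H_def using eG by (intro smooth_near_sqrt smooth_near_mult smooth_near_const G(1))
  define Y where "Y q = snd q * H q" for q
  have Y: "smooth_near (0, 0) Y" unfolding Y_def by (intro smooth_near_mult smooth_near_snd H)
  have "((\<lambda>t. t * H (0, t)) has_field_derivative H (0, 0)) (at 0)"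
    using DERIV_pdv[OF H] by (auto intro!: derivative_eq_intros)
  then have pY: "pdv Y (0, 0) = H (0, 0)" using DERIV_pdv[OF Y] unfolding Y_def snd_conv by (metis DERIV_unique)
  have H0: "H (0, 0) > 0" using eG by (simp add: H_def)
  then have Y1: "pdv Y (0, 0) \<noteq> 0" using pY by simp
  have Y0: "Y (0, 0) = 0" by (simp add: Y_def)
  obtain b2 where b2: "inverse_germs (0, 0) (\<lambda>q. (fst q, Y q)) (\<lambda>q. (fst q, b2 q))"
    and b2_smooth: "smooth_near (0, 0) b2"
    using inverse_germs_snd[OF Y Y1] Y0 by (metis fst_conv)
  have b20: "b2 (0, 0) = 0" using b2 by (simp add: inverse_germs_def Y0)
  define \<sigma> where "\<sigma> q = s (fst q) + b2 q" for q
  define r where "r x = A (x, s x)" for x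
  have \<sigma>: "smooth_near (0, 0) \<sigma>" unfolding \<sigma>_def by (intro smooth_near_add sf b2_smooth)
  show thesis
  proof (rule that[OF \<sigma>])
    show "smooth_near 0 r" unfolding r_def
      by (rule smooth_near_compose2[OF _ smooth_near_id s]) (use A s0 in simp)
    show "\<sigma> (0, 0) = 0" "r 0 = A (0, 0)" by (simp_all add: \<sigma>_def r_def s0 b20)
    have "((\<lambda>t. s 0 + b2 (0, t)) has_field_derivative pdv b2 (0, 0)) (at 0)"
      using DERIV_pdv[OF b2_smooth] by (auto intro!: derivative_eq_intros)
    then have "pdv \<sigma> (0, 0) = pdv b2 (0, 0)" using DERIV_pdv[OF \<sigma>] unfolding \<sigma>_def fst_conv by (metis DERIV_unique)
    moreover have "pdv Y (0, 0) * pdv b2 (0, 0) = 1"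
      using pdv_inverse_snd[OF b2 Y] b2_smooth by (simp add: Y0)
    ultimately show "pdv \<sigma> (0, 0) > 0" using H0 pY by (metis zero_less_mult_pos zero_less_one)
    have c: "isCont (\<lambda>q. (fst q, b2 q)) (0, 0)"
      using smooth_near_isCont[OF b2_smooth] by (intro continuous_intros)
    have "\<forall>\<^sub>F q in nhds (0, 0). Y (fst q, b2 q) = snd q"
      using b2 by (auto simp: inverse_germs_def Y0 prod_eq_iff)
    moreover have "\<forall>\<^sub>F q in nhds (0, 0). B (fst q, b2 q) = (b2 q)\<^sup>2 * G (fst q, b2 q)"
      using eventually_nhds_compose[OF _ c, of "\<lambda>q. B q = (snd q)\<^sup>2 * G q"] BG b20 by simp
    moreover have "\<forall>\<^sub>F q in nhds (0, 0). \<epsilon> * G (fst q, b2 q) > 0"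
    proof -
      have "isCont (\<lambda>q. \<epsilon> * G q) (0, 0)" using smooth_near_isCont[OF G(1)] by (intro continuous_intros)
      then have "\<forall>\<^sub>F q in nhds (0, 0). \<epsilon> * G q > 0" using eG by (rule eventually_nhds_nonzero(1))
      then show ?thesis using eventually_nhds_compose[OF _ c, of "\<lambda>q. \<epsilon> * G q > 0"] b20 by simp
    qed
    ultimately show "\<forall>\<^sub>F q in nhds (0, 0). A (fst q, \<sigma> q) = r (fst q) + sgn (pdv (pdv A) (0, 0)) * (snd q)\<^sup>2"
      unfolding \<epsilon>_def[symmetric]
    proof eventually_elim
      case (elim q)
      have "(snd q)\<^sup>2 = (b2 q)\<^sup>2 * (\<epsilon> * G (fst q, b2 q))"
        using elim(1,3) unfolding Y_def H_def snd_conv by (metis power_mult_distrib real_sqrt_pow2 less_imp_le)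
      then have "\<epsilon> * (snd q)\<^sup>2 = B (fst q, b2 q)"
        using elim(2) eps by (metis (no_types, lifting) mult.assoc mult.commute mult.left_neutral)
      then show ?case by (simp add: B_def \<sigma>_def r_def)
    qed
  qed
qed

section \<open>Maps into three-space\<close>

lemma vector3_nth [simp]: "(vector [a, b, c] :: real^3) $ 1 = a" "(vector [a, b, c] :: real^3) $ 2 = b" "(vector [a, b, c] :: real^3) $ 3 = c"
  by (simp_all add: vector_3)

lemma vector3_eq_iff: "(P :: real^3) = Q \<longleftrightarrow> P $ 1 = Q $ 1 \<and> P $ 2 = Q $ 2 \<and> P $ 3 = Q $ 3"
  by (simp add: vec_eq_iff forall_3)

lemma smooth_near_vector3:
  assumes "smooth_near p a" "smooth_near p b" "smooth_near p c"
  shows "smooth_near p (\<lambda>x. vector [a x, b x, c x] :: real^3)"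
proof -
  have "(\<lambda>x. vector [a x, b x, c x] :: real^3) =
      (\<lambda>x. a x *\<^sub>R vector [1, 0, 0] + b x *\<^sub>R vector [0, 1, 0] + c x *\<^sub>R vector [0, 0, 1])"
    by (rule ext) (simp add: vector3_eq_iff)
  moreover have "smooth_near p (\<lambda>x. a x *\<^sub>R (vector [1, 0, 0] :: real^3) + b x *\<^sub>R vector [0, 1, 0] + c x *\<^sub>R vector [0, 0, 1])"
    by (intro smooth_near_add smooth_near_scaleR assms smooth_near_const)
  ultimately show ?thesis by simp
qed

lemma smooth_near_nth: "smooth_near p (\<lambda>P::real^3. P $ i)"
  by (rule smooth_near_linear[OF bounded_linear_vec_nth])

lemma A_equivalentI:
  assumes "inverse_germs p \<phi> \<phi>'" "inverse_germs (F p) \<psi> \<psi>'" "\<phi> p = q" "\<forall>\<^sub>F x in nhds p. \<psi> (F x) = G (\<phi> x)"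
  shows "A_equivalent F p G q"
  unfolding A_equivalent_iff using assms by blast

lemma inverse_germs_id: "inverse_germs p (\<lambda>x. x) (\<lambda>x. x)"
  by (rule inverse_germsI) auto

text \<open>The form in which all singularities are compared, written \<open>(x, y\<^sup>2, y W (z, x))\<close> with \<open>z = y\<^sup>2\<close>. The parameter \<open>z\<close> comes
  first because the Morse lemma above is applied to \<open>W\<close> with \<open>x\<close> as the variable.\<close>

definition folded_form :: "(real \<times> real \<Rightarrow> real) \<Rightarrow> real \<times> real \<Rightarrow> real^3" where
  "folded_form W q = vector [fst q, (snd q)\<^sup>2, snd q * W ((snd q)\<^sup>2, fst q)]"

text \<open>Whitney's theorem applied to the even part of \<open>C\<close>, and to the odd part divided by \<open>y\<close>. The resulting \<open>E\<close> and \<open>W\<close> are defined for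
  negative \<open>z\<close> as well, as is necessary for using them in diffeomorphisms of the target.\<close>

lemma odd_even_decomposition:
  fixes C :: "real \<times> real \<Rightarrow> real"
  assumes C: "smooth_near (0, 0) C"
  obtains E W where "smooth_near (0, 0) E" "smooth_near (0, 0) W"
    "\<forall>\<^sub>F q in nhds (0, 0). C q = E (fst q, (snd q)\<^sup>2) + snd q * W ((snd q)\<^sup>2, fst q)"
    "\<forall>\<^sub>F q in nhds (0, 0). C q - C (fst q, - snd q) = 2 * snd q * W ((snd q)\<^sup>2, fst q)"
proof -
  have refl: "smooth_near (0, 0) (\<lambda>q. K (fst q, - snd q))" if "smooth_near (0, 0) K" for K :: "real \<times> real \<Rightarrow> real"
    by (intro smooth_near_compose2[where F = K] smooth_near_fst smooth_near_minus smooth_near_snd) (use that in simp)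
  have reflc: "isCont (\<lambda>q::real\<times>real. (fst q, - snd q)) (0, 0)" by (intro continuous_intros)
  obtain E where E: "smooth_near (0, 0) E"
    "\<forall>\<^sub>F q in nhds (0, 0). (C q + C (fst q, - snd q)) / 2 = E (fst q, (snd q)\<^sup>2)"
    by (rule even_function_of_square[of "\<lambda>q. (C q + C (fst q, - snd q)) / 2"])
      (auto intro!: smooth_near_divide smooth_near_add smooth_near_const C refl)
  obtain K where K: "smooth_near (0, 0) K"
    "\<forall>\<^sub>F q in nhds (0, 0). (C q - C (fst q, - snd q)) / 2 = snd q * K q"
    by (rule divide_by_snd[of "\<lambda>q. (C q - C (fst q, - snd q)) / 2"])
      (auto intro!: smooth_near_divide smooth_near_diff smooth_near_const C refl)
  obtain Q where Q: "smooth_near (0, 0) Q"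
    "\<forall>\<^sub>F q in nhds (0, 0). (K q + K (fst q, - snd q)) / 2 = Q (fst q, (snd q)\<^sup>2)"
    by (rule even_function_of_square[of "\<lambda>q. (K q + K (fst q, - snd q)) / 2"])
      (auto intro!: smooth_near_divide smooth_near_add smooth_near_const K refl)
  define W where "W q = Q (snd q, fst q)" for q
  have W: "smooth_near (0, 0) W"
    unfolding W_def by (intro smooth_near_compose2[where F = Q] smooth_near_fst smooth_near_snd) (use Q in simp)
  have K': "\<forall>\<^sub>F q in nhds (0, 0). (C (fst q, - snd q) - C q) / 2 = - snd q * K (fst q, - snd q)"
    using eventually_nhds_compose[OF _ reflc, of "\<lambda>q. (C q - C (fst q, - snd q)) / 2 = snd q * K q"] K(2) by simp
  have odd: "\<forall>\<^sub>F q in nhds (0, 0). C q - C (fst q, - snd q) = 2 * snd q * W ((snd q)\<^sup>2, fst q)"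
    using K(2) K' Q(2)
  proof eventually_elim
    case (elim q)
    have "2 * snd q * W ((snd q)\<^sup>2, fst q) = snd q * K q + snd q * K (fst q, - snd q)"
      unfolding W_def fst_conv snd_conv elim(3)[symmetric] by (simp add: algebra_simps)
    then show ?case using elim(1,2) by (simp add: field_simps)
  qed
  moreover have "\<forall>\<^sub>F q in nhds (0, 0). C q = E (fst q, (snd q)\<^sup>2) + snd q * W ((snd q)\<^sup>2, fst q)"
    using E(2) odd
  proof eventually_elim
    case (elim q)
    then show ?case by (simp add: field_simps)
  qed
  ultimately show thesis using that E(1) W by blast
qed

text \<open>With the Morse coordinate the second component becomes \<open>r (x) \<plusminus> y\<^sup>2\<close>. In the target, \<open>r (x)\<close> and the even part of the third
  component are functions of the first two components and can be subtracted; the odd part remains.\<close>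

lemma fold_normal_form:
  fixes A B :: "real \<times> real \<Rightarrow> real"
  assumes A: "smooth_near (0, 0) A" and B: "smooth_near (0, 0) B"
    and crit: "pdv A (0, 0) = 0" and nd: "pdv (pdv A) (0, 0) \<noteq> 0"
  obtains \<sigma> W where "smooth_near (0, 0) \<sigma>" "\<sigma> (0, 0) = 0" "pdv \<sigma> (0, 0) > 0"
    "\<forall>\<^sub>F x in nhds 0. pdv A (x, \<sigma> (x, 0)) = 0"
    "smooth_near (0, 0) W"
    "\<forall>\<^sub>F q in nhds (0, 0). B (fst q, \<sigma> q) - B (fst q, \<sigma> (fst q, - snd q)) = 2 * snd q * W ((snd q)\<^sup>2, fst q)"
    "A_equivalent (folded_form W) (0, 0) (\<lambda>q. vector [fst q, A q, B q]) (0, 0)"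
proof -
  obtain \<sigma> r where s: "smooth_near (0, 0) \<sigma>" "smooth_near 0 r" "\<sigma> (0, 0) = 0" "pdv \<sigma> (0, 0) > 0" "r 0 = A (0, 0)"
    "\<forall>\<^sub>F q in nhds (0, 0). A (fst q, \<sigma> q) = r (fst q) + sgn (pdv (pdv A) (0, 0)) * (snd q)\<^sup>2"
    using morse_with_parameter[OF A crit nd] by blast
  define \<epsilon> where "\<epsilon> = sgn (pdv (pdv A) (0, 0))"
  have eps: "\<epsilon> * \<epsilon> = 1" using nd by (simp add: \<epsilon>_def sgn_if)
  then have eps2: "\<epsilon> * (\<epsilon> * x) = x" for x by (simp add: mult.assoc[symmetric])
  have "smooth_near (0, 0) (\<lambda>q. B (fst q, \<sigma> q))"
    by (intro smooth_near_compose2[where F = B] smooth_near_fst s) (use B s in simp)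
  then obtain E W where EW: "smooth_near (0, 0) E" "smooth_near (0, 0) W"
    "\<forall>\<^sub>F q in nhds (0, 0). B (fst q, \<sigma> q) = E (fst q, (snd q)\<^sup>2) + snd q * W ((snd q)\<^sup>2, fst q)"
    "\<forall>\<^sub>F q in nhds (0, 0). B (fst q, \<sigma> q) - B (fst q, \<sigma> (fst q, - snd q)) = 2 * snd q * W ((snd q)\<^sup>2, fst q)"
    using odd_even_decomposition[of "\<lambda>q. B (fst q, \<sigma> q)"] by auto
  obtain b where b: "inverse_germs (0, 0) (\<lambda>q. (fst q, \<sigma> q)) (\<lambda>q. (fst q, b q))"
    using inverse_germs_snd[OF s(1)] s(4) by (metis less_irrefl)
  define \<Psi> where "\<Psi> P = (vector [P $ 1, r (P $ 1) + \<epsilon> * P $ 2, P $ 3 + E (P $ 1, P $ 2)] :: real^3)" for P :: "real^3"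
  define \<Phi> where "\<Phi> P = (vector [P $ 1, \<epsilon> * (P $ 2 - r (P $ 1)), P $ 3 - E (P $ 1, \<epsilon> * (P $ 2 - r (P $ 1)))] :: real^3)" for P :: "real^3"
  have f0: "folded_form W (0, 0) = vector [0, 0, 0]" by (simp add: folded_form_def)
  have rP: "smooth_near P (\<lambda>P. r (P $ 1))" if "P $ 1 = 0" for P :: "real^3"
    by (rule smooth_near_compose[OF _ smooth_near_nth]) (use that s(2) in simp)
  have P0: "\<Psi> (folded_form W (0, 0)) $ 1 = 0" "\<Psi> (folded_form W (0, 0)) $ 2 = r 0"
    by (simp_all add: \<Psi>_def f0)
  have "inverse_germs (folded_form W (0, 0)) \<Psi> \<Phi>"
  proof (rule inverse_germsI)
    show "smooth_near (folded_form W (0, 0)) \<Psi>"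
      unfolding \<Psi>_def f0
      by (intro smooth_near_vector3 smooth_near_add smooth_near_mult smooth_near_const smooth_near_nth
          rP smooth_near_compose2[where F = E]) (use EW(1) in simp_all)
    show "smooth_near (\<Psi> (folded_form W (0, 0))) \<Phi>"
      unfolding \<Phi>_def
      by (intro smooth_near_vector3 smooth_near_diff smooth_near_mult smooth_near_const smooth_near_nth
          rP smooth_near_compose2[where F = E]) (use EW(1) P0 in simp_all)
  qed (simp_all add: \<Psi>_def \<Phi>_def vector3_eq_iff eps2)
  then have "A_equivalent (folded_form W) (0, 0) (\<lambda>q. vector [fst q, A q, B q]) (0, 0)"
  proof (rule A_equivalentI[OF b])
    show "(fst (0, 0), \<sigma> (0, 0)) = (0, 0)" using s by simp
    show "\<forall>\<^sub>F x in nhds (0, 0). \<Psi> (folded_form W x) =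
        vector [fst (fst x, \<sigma> x), A (fst x, \<sigma> x), B (fst x, \<sigma> x)]"
      using s(6) EW(3) by eventually_elim (simp add: \<Psi>_def folded_form_def vector3_eq_iff \<epsilon>_def)
  qed
  moreover have "\<forall>\<^sub>F x in nhds 0. pdv A (x, \<sigma> (x, 0)) = 0"
  proof -
    have slice: "\<forall>\<^sub>F x in nhds 0. P (x, 0)" if "\<forall>\<^sub>F q in nhds (0, 0). P q" for P :: "real \<times> real \<Rightarrow> bool"
      by (rule eventually_nhds_slice(1)[OF that])
    have ps: "\<forall>\<^sub>F q in nhds (0, 0). pdv \<sigma> q > 0"
      by (rule eventually_nhds_nonzero(1)[OF smooth_near_isCont[OF smooth_near_pdv[OF s(1)]] s(4)])
    have sA: "\<forall>\<^sub>F q in nhds (0, 0). smooth_near (fst q, \<sigma> q) A"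
      using eventually_nhds_along[where f = "\<lambda>q. (fst q, \<sigma> q)" and p = "(0,0)" and P = "\<lambda>q. smooth_near q A"] smooth_near_eventually[OF A] s(3)
        smooth_near_isCont[OF s(1)] by (simp add: continuous_intros)
    have ee: "\<forall>\<^sub>F q in nhds (0, 0). \<forall>\<^sub>F q' in nhds q. A (fst q', \<sigma> q') = r (fst q') + \<epsilon> * (snd q')\<^sup>2"
      using s(6) by (simp add: eventually_eventually \<epsilon>_def)
    from slice[OF ps] slice[OF sA] slice[OF ee] slice[OF smooth_near_eventually[OF s(1)]] show ?thesis
    proof eventually_elim
      case (elim x)
      have "((\<lambda>y. A (x, \<sigma> (x, y))) has_field_derivative pdv A (x, \<sigma> (x, 0)) * pdv \<sigma> (x, 0)) (at 0)"
        by (rule DERIV_chain2[of "\<lambda>y. A (x, y)"]) (use elim DERIV_pdv in auto)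
      moreover have "\<forall>\<^sub>F y in nhds 0. A (x, \<sigma> (x, y)) = r x + \<epsilon> * y\<^sup>2"
        using eventually_nhds_slice(2)[OF elim(3)] by simp
      then have "((\<lambda>y. A (x, \<sigma> (x, y))) has_field_derivative 0) (at 0)"
        by (subst DERIV_cong_ev[OF refl _ refl, of _ "\<lambda>y. r x + \<epsilon> * y\<^sup>2"]) (auto intro!: derivative_eq_intros)
      ultimately have "pdv A (x, \<sigma> (x, 0)) * pdv \<sigma> (x, 0) = 0" by (rule DERIV_unique)
      then show ?case using elim(1) by simp
    qed
  qed
  ultimately show thesis using that s EW by blast
qed

text \<open>Changing the first coordinate in the source by \<open>\<theta> (y\<^sup>2, \<cdot>)\<close> can be undone in the target, whose second coordinate is \<open>y\<^sup>2\<close>;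
  a nonvanishing factor \<open>c (y\<^sup>2)\<close> of the third component can be removed there as well.\<close>

lemma folded_form_change:
  fixes \<theta> W V :: "real \<times> real \<Rightarrow> real" and c :: "real \<Rightarrow> real"
  assumes \<theta>: "smooth_near (0, 0) \<theta>" "\<theta> (0, 0) = 0" "pdv \<theta> (0, 0) \<noteq> 0" and c: "smooth_near 0 c" "c 0 \<noteq> 0"
    and eq: "\<forall>\<^sub>F q in nhds (0, 0). W (fst q, \<theta> q) = c (fst q) * V q"
  shows "A_equivalent (folded_form V) (0, 0) (folded_form W) (0, 0)"
proof -
  obtain b where b: "inverse_germs (0, 0) (\<lambda>q. (fst q, \<theta> q)) (\<lambda>q. (fst q, b q))"
    and bs: "smooth_near (0, 0) b"
    using inverse_germs_snd[OF \<theta>(1,3)] \<theta>(2) by (metis fst_conv)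
  have b0: "b (0, 0) = 0" using b by (simp add: inverse_germs_def \<theta>)
  have bt: "\<forall>\<^sub>F q in nhds (0, 0). b (fst q, \<theta> q) = snd q" and tb: "\<forall>\<^sub>F q in nhds (0, 0). \<theta> (fst q, b q) = snd q"
    using b by (auto simp: inverse_germs_def \<theta> prod_eq_iff)
  have comp: "smooth_near (0, 0) (\<lambda>q. H ((snd q)\<^sup>2, fst q))" if "smooth_near (0, 0) H" for H :: "real \<times> real \<Rightarrow> real"
    by (intro smooth_near_compose2[where F = H] smooth_near_fst smooth_near_power smooth_near_snd) (use that in simp)
  have cq: "isCont (\<lambda>q::real\<times>real. ((snd q)\<^sup>2, fst q)) (0, 0)" by (intro continuous_intros)
  have evq: "\<forall>\<^sub>F q in nhds (0, 0). P ((snd q)\<^sup>2, fst q)" if "\<forall>\<^sub>F q in nhds (0, 0). P q" for P :: "real \<times> real \<Rightarrow> bool"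
    using eventually_nhds_compose[OF _ cq, of P] that by simp
  have f0: "folded_form V (0, 0) = vector [0, 0, 0]" by (simp add: folded_form_def)
  have cP: "isCont (\<lambda>P::real^3. (P $ 2, P $ 1)) (vector [0, 0, 0])"
    by (intro continuous_intros)
  have evP: "\<forall>\<^sub>F P in nhds (vector [0, 0, 0] :: real^3). R (P $ 2, P $ 1)" if "\<forall>\<^sub>F q in nhds (0, 0). R q" for R :: "real \<times> real \<Rightarrow> bool"
    using eventually_nhds_compose[OF _ cP, of R] that by simp
  have sP: "smooth_near (vector [0, 0, 0] :: real^3) (\<lambda>P. H (P $ 2, P $ 1))" if "smooth_near (0, 0) H" for H :: "real \<times> real \<Rightarrow> real"
    by (intro smooth_near_compose2[where F = H] smooth_near_nth) (use that in simp)
  have c': "smooth_near (vector [0, 0, 0] :: real^3) (\<lambda>P. c (P $ 2))"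
    by (rule smooth_near_compose[OF _ smooth_near_nth]) (use c in simp)
  have c_ev: "\<forall>\<^sub>F P in nhds (vector [0, 0, 0] :: real^3). c (P $ 2) \<noteq> 0"
    by (rule eventually_nhds_nonzero(2)[OF smooth_near_isCont[OF c']]) (use c in simp)
  define \<phi> where "\<phi> q = (\<theta> ((snd q)\<^sup>2, fst q), snd q)" for q :: "real \<times> real"
  define \<phi>' where "\<phi>' q = (b ((snd q)\<^sup>2, fst q), snd q)" for q :: "real \<times> real"
  have ph: "inverse_germs (0, 0) \<phi> \<phi>'"
  proof (rule inverse_germsI)
    show "smooth_near (0, 0) \<phi>" "smooth_near (\<phi> (0, 0)) \<phi>'"
      unfolding \<phi>_def \<phi>'_def using comp[OF \<theta>(1)] comp[OF bs] \<theta>(2) by (auto intro!: smooth_near_Pair smooth_near_snd)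
    show "\<forall>\<^sub>F x in nhds (0, 0). \<phi>' (\<phi> x) = x"
      using evq[OF bt] by eventually_elim (simp add: \<phi>_def \<phi>'_def prod_eq_iff)
    have "\<phi> (0, 0) = (0, 0)" using \<theta> by (simp add: \<phi>_def)
    then show "\<forall>\<^sub>F y in nhds (\<phi> (0, 0)). \<phi> (\<phi>' y) = y"
      using evq[OF tb] by (auto elim!: eventually_mono simp: \<phi>_def \<phi>'_def prod_eq_iff)
  qed
  define \<Psi> where "\<Psi> P = (vector [\<theta> (P $ 2, P $ 1), P $ 2, c (P $ 2) * P $ 3] :: real^3)" for P :: "real^3"
  define \<Psi>' where "\<Psi>' P = (vector [b (P $ 2, P $ 1), P $ 2, P $ 3 / c (P $ 2)] :: real^3)" for P :: "real^3"
  have "\<Psi> (vector [0, 0, 0]) = vector [0, 0, 0]" using \<theta> by (simp add: \<Psi>_def)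
  then have ps: "inverse_germs (folded_form V (0, 0)) \<Psi> \<Psi>'"
    unfolding f0
  proof (intro inverse_germsI)
    assume P0: "\<Psi> (vector [0, 0, 0]) = vector [0, 0, 0]"
    show "smooth_near (vector [0, 0, 0]) \<Psi>"
      unfolding \<Psi>_def by (intro smooth_near_vector3 smooth_near_mult sP[OF \<theta>(1)] c' smooth_near_nth)
    show "smooth_near (\<Psi> (vector [0, 0, 0])) \<Psi>'"
      unfolding P0 unfolding \<Psi>'_def using c(2)
      by (intro smooth_near_vector3 smooth_near_divide sP[OF bs] c' smooth_near_nth) simp
    show "\<forall>\<^sub>F x in nhds (vector [0, 0, 0]). \<Psi>' (\<Psi> x) = x"
      using evP[OF bt] c_ev by eventually_elim (simp add: \<Psi>_def \<Psi>'_def vector3_eq_iff)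
    show "\<forall>\<^sub>F x in nhds (\<Psi> (vector [0, 0, 0])). \<Psi> (\<Psi>' x) = x"
      unfolding P0 using evP[OF tb] c_ev by eventually_elim (simp add: \<Psi>_def \<Psi>'_def vector3_eq_iff)
  qed
  show ?thesis
  proof (rule A_equivalentI[where F = "folded_form V", OF ph ps])
    show "\<phi> (0, 0) = (0, 0)" using \<theta> by (simp add: \<phi>_def)
    show "\<forall>\<^sub>F x in nhds (0, 0). \<Psi> (folded_form V x) = folded_form W (\<phi> x)"
      using evq[OF eq] by eventually_elim (simp add: \<Psi>_def \<phi>_def folded_form_def vector3_eq_iff)
  qed
qed

section \<open>Recognising the cross cap and the singularities of type S1\<close>

text \<open>The maps \<open>folded_form (S1_function 1)\<close> and \<open>folded_form (S1_function (-1))\<close> are the normal forms \<open>S\<^sub>1\<^sup>+\<close> and \<open>S\<^sub>1\<^sup>-\<close>; the cross cap is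
  \<open>folded_form snd\<close> up to the order of the components.\<close>

definition S1_function :: "real \<Rightarrow> real \<times> real \<Rightarrow> real" where
  "S1_function \<delta> q = (snd q)\<^sup>2 + \<delta> * fst q"

lemma smooth_near_S1_function: "smooth_near p (S1_function \<delta>)"
  unfolding S1_function_def[abs_def]
  by (intro smooth_near_add smooth_near_power smooth_near_mult smooth_near_const smooth_near_fst smooth_near_snd)

lemma has_S1_plus_iff: "has_S1_plus F p \<longleftrightarrow> A_equivalent F p (folded_form (S1_function 1)) (0, 0)"
proof -
  have "(\<lambda>(u, v). vector [u, v\<^sup>2, v * (u\<^sup>2 + v\<^sup>2)]) = folded_form (S1_function 1)"
    by (auto simp: folded_form_def S1_function_def)
  then show ?thesis by (simp add: has_S1_plus_def)
qed

lemma has_S1_minus_iff: "has_S1_minus F p \<longleftrightarrow> A_equivalent F p (folded_form (S1_function (-1))) (0, 0)"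
proof -
  have "(\<lambda>(u, v). vector [u, v\<^sup>2, v * (u\<^sup>2 - v\<^sup>2)]) = folded_form (S1_function (-1))"
    by (auto simp: folded_form_def S1_function_def)
  then show ?thesis by (simp add: has_S1_minus_def)
qed

lemma smooth_near_folded_form:
  assumes "smooth_near (0, 0) W"
  shows "smooth_near (0, 0) (folded_form W)"
proof -
  have "smooth_near (0, 0) (\<lambda>q. W ((snd q)\<^sup>2, fst q))"
    by (intro smooth_near_compose2[where F = W] smooth_near_fst smooth_near_power smooth_near_snd) (use assms in simp)
  then show ?thesis
    unfolding folded_form_def[abs_def]
    by (intro smooth_near_vector3 smooth_near_fst smooth_near_power smooth_near_snd smooth_near_mult)
qed

lemma swap_components_germ:
  "inverse_germs P (\<lambda>P::real^3. vector [P $ 1, P $ 3, P $ 2]) (\<lambda>P::real^3. vector [P $ 1, P $ 3, P $ 2] :: real^3)"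
  by (rule inverse_germsI) (auto intro!: smooth_near_vector3 smooth_near_nth simp: vector3_eq_iff)

lemma A_equivalent_swap_components:
  "A_equivalent (\<lambda>q. vector [a q, b q, c q] :: real^3) p (\<lambda>q. vector [a q, c q, b q]) p"
  by (rule A_equivalentI[where F = "\<lambda>q. vector [a q, b q, c q]", OF inverse_germs_id swap_components_germ]) auto

lemma has_cross_cap_iff: "has_cross_cap F p \<longleftrightarrow> A_equivalent F p (folded_form snd) (0, 0)"
proof -
  have 1: "(\<lambda>(u, v). vector [u, u * v, v\<^sup>2]) = (\<lambda>q. vector [fst q, fst q * snd q, (snd q)\<^sup>2] :: real^3)"
    by auto
  have 2: "folded_form snd = (\<lambda>q. vector [fst q, (snd q)\<^sup>2, fst q * snd q] :: real^3)"
    by (rule ext) (simp add: folded_form_def mult.commute)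
  show ?thesis
    unfolding has_cross_cap_def 1 2
    by (rule iffI; erule A_equivalent_trans; rule A_equivalent_swap_components)
qed

text \<open>If \<open>W\<close> has a nonzero derivative in \<open>x\<close>, then \<open>W\<close> itself serves as the new coordinate.\<close>

lemma folded_form_cross_cap:
  assumes W: "smooth_near (0, 0) W" "W (0, 0) = 0" "pdv W (0, 0) \<noteq> 0"
  shows "A_equivalent (folded_form W) (0, 0) (folded_form snd) (0, 0)"
proof -
  obtain b where b: "inverse_germs (0, 0) (\<lambda>q. (fst q, W q)) (\<lambda>q. (fst q, b q))"
    and bs: "smooth_near (0, 0) b"
    using inverse_germs_snd[OF W(1,3)] W(2) by (metis fst_conv)
  have "pdv W (0, 0) * pdv b (0, 0) = 1" using pdv_inverse_snd[OF b W(1)] bs W(2) by simp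
  then have b1: "pdv b (0, 0) \<noteq> 0" by auto
  have b0: "b (0, 0) = 0" using b by (simp add: inverse_germs_def W)
  have "\<forall>\<^sub>F q in nhds (0, 0). W (fst q, b q) = 1 * snd q"
    using b by (auto simp: inverse_germs_def W prod_eq_iff)
  then have "A_equivalent (folded_form snd) (0, 0) (folded_form W) (0, 0)"
    by (intro folded_form_change[OF bs b0 b1, of "\<lambda>_. 1"]) auto
  then show ?thesis
    by (rule A_equivalent_sym[OF _ smooth_near_isCont[OF smooth_near_folded_form[OF smooth_near_snd]]])
qed

text \<open>The Morse lemma turns \<open>W (z, x)\<close> into \<open>r (z) \<plusminus> \<mu>\<^sup>2\<close> with \<open>r (z) = z \<rho> (z)\<close>, and \<open>\<mu> = \<surd>\<bar>\<rho> (z)\<bar> x\<close> makes \<open>\<rho>\<close> a common factor.\<close>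

lemma folded_form_S1:
  assumes W: "smooth_near (0, 0) W" "W (0, 0) = 0" "pdv W (0, 0) = 0"
    and xx: "pdv (pdv W) (0, 0) \<noteq> 0" and z: "pdu W (0, 0) \<noteq> 0"
  shows "A_equivalent (folded_form W) (0, 0)
    (folded_form (S1_function (sgn (pdv (pdv W) (0, 0)) * sgn (pdu W (0, 0))))) (0, 0)"
proof -
  obtain \<sigma> r where s: "smooth_near (0, 0) \<sigma>" "smooth_near 0 r" "\<sigma> (0, 0) = 0" "pdv \<sigma> (0, 0) > 0" "r 0 = W (0, 0)"
    "\<forall>\<^sub>F q in nhds (0, 0). W (fst q, \<sigma> q) = r (fst q) + sgn (pdv (pdv W) (0, 0)) * (snd q)\<^sup>2"
    using morse_with_parameter[OF W(1,3) xx] by blast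
  define \<epsilon> where "\<epsilon> = sgn (pdv (pdv W) (0, 0))"
  define \<tau> where "\<tau> = sgn (pdu W (0, 0))"
  have eps: "\<epsilon> * \<epsilon> = 1" "\<tau> * \<tau> = 1" using xx z by (auto simp: \<epsilon>_def \<tau>_def sgn_if)
  have rs: "smooth_near (0, 0) (\<lambda>q::real\<times>real. r (snd q))"
    by (rule smooth_near_compose[OF _ smooth_near_snd]) (use s in simp)
  have r0: "\<forall>\<^sub>F x in nhds 0. r (snd (x::real, 0)) = 0" using s(5) W(2) by simp
  obtain G where G: "smooth_near (0, 0) G" "\<forall>\<^sub>F q in nhds (0::real, 0). r (snd q) = snd q * G q"
    by (rule divide_by_snd[OF rs r0])
  define \<rho> where "\<rho> z = G (0, z)" for z
  have rho: "smooth_near 0 \<rho>"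
    unfolding \<rho>_def by (intro smooth_near_compose2[where F = G] smooth_near_const smooth_near_id) (use G in simp)
  have "\<forall>\<^sub>F z in nhds 0. r (snd (0::real, z)) = snd (0::real, z) * G (0, z)"
    by (rule eventually_nhds_slice(2)[OF G(2)])
  then have r: "\<forall>\<^sub>F z in nhds 0. r z = z * \<rho> z" by (simp add: \<rho>_def)
  have rho0: "\<rho> 0 = pdu W (0, 0)"
  proof -
    have "((\<lambda>z. \<sigma> (z, 0)) has_field_derivative pdu \<sigma> (0, 0)) (at 0)" by (rule DERIV_pdu[OF s(1)])
    then have "((\<lambda>z. W (z, \<sigma> (z, 0))) has_field_derivative 1 * pdu W (0, \<sigma> (0, 0)) + pdu \<sigma> (0, 0) * pdv W (0, \<sigma> (0, 0))) (at 0)"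
      by (intro DERIV_along_curve) (use s(3) W(1) in auto)
    then have d1: "((\<lambda>z. W (z, \<sigma> (z, 0))) has_field_derivative pdu W (0, 0)) (at 0)"
      using s(3) W(3) by simp
    have "\<forall>\<^sub>F x in nhds 0. W (fst (x, 0::real), \<sigma> (x, 0)) = r (fst (x, 0::real)) + sgn (pdv (pdv W) (0, 0)) * (snd (x, 0::real))\<^sup>2"
      by (rule eventually_nhds_slice(1)[OF s(6)])
    with r have e: "\<forall>\<^sub>F x in nhds 0. W (x, \<sigma> (x, 0)) = x * \<rho> x"
      by eventually_elim simp
    obtain D where D: "(\<rho> has_field_derivative D) (at 0)"
      using smooth_near_has_derivative[OF rho] real_differentiable_def has_field_derivative_def
      by (metis differentiable_def)
    have "((\<lambda>x. x * \<rho> x) has_field_derivative \<rho> 0) (at 0)" by (auto intro!: derivative_eq_intros D)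
    then have "((\<lambda>z. W (z, \<sigma> (z, 0))) has_field_derivative \<rho> 0) (at 0)"
      by (subst DERIV_cong_ev[OF refl e refl])
    then show ?thesis using d1 by (rule DERIV_unique)
  qed
  have tr: "\<tau> * \<rho> 0 > 0" unfolding rho0 \<tau>_def using z by (auto simp: sgn_if)
  have trs: "smooth_near 0 (\<lambda>z. \<tau> * \<rho> z)" by (intro smooth_near_mult smooth_near_const rho)
  have rhof: "smooth_near (0, 0) (\<lambda>q::real\<times>real. \<tau> * \<rho> (fst q))"
    by (rule smooth_near_compose[where f = "\<lambda>z. \<tau> * \<rho> z", OF _ smooth_near_fst]) (use trs in simp)
  define m where "m q = sqrt (\<tau> * \<rho> (fst q)) * snd q" for q :: "real \<times> real"
  have m: "smooth_near (0, 0) m"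
    unfolding m_def by (intro smooth_near_mult smooth_near_sqrt rhof smooth_near_snd) (use tr in simp)
  define \<theta> where "\<theta> q = \<sigma> (fst q, m q)" for q
  have m0: "m (0, 0) = 0" by (simp add: m_def)
  have th: "smooth_near (0, 0) \<theta>"
    unfolding \<theta>_def by (intro smooth_near_compose2[where F = \<sigma>] smooth_near_fst m) (use s m0 in simp)
  have th0: "\<theta> (0, 0) = 0" using s by (simp add: \<theta>_def m0)
  have "pdv \<theta> (0, 0) \<noteq> 0"
  proof -
    have "((\<lambda>y. \<sigma> (0, y)) has_field_derivative pdv \<sigma> (0, 0)) (at (sqrt (\<tau> * \<rho> 0) * 0))"
      using DERIV_pdv[OF s(1)] by simp
    then have "((\<lambda>y. \<sigma> (0, sqrt (\<tau> * \<rho> 0) * y)) has_field_derivative pdv \<sigma> (0, 0) * sqrt (\<tau> * \<rho> 0)) (at 0)"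
      by (rule DERIV_chain2) (auto intro!: derivative_eq_intros)
    then have "((\<lambda>y. \<theta> (0, y)) has_field_derivative pdv \<sigma> (0, 0) * sqrt (\<tau> * \<rho> 0)) (at 0)"
      by (simp only: \<theta>_def m_def fst_conv snd_conv)
    then have "pdv \<theta> (0, 0) = pdv \<sigma> (0, 0) * sqrt (\<tau> * \<rho> 0)"
      by (rule DERIV_unique[OF DERIV_pdv[OF th]])
    then show ?thesis using s(4) tr by (simp add: less_imp_neq[symmetric] zero_less_mult_iff) auto
  qed
  moreover have "smooth_near 0 (\<lambda>z. \<epsilon> * (\<tau> * \<rho> z))" by (intro smooth_near_mult smooth_near_const trs)
  moreover have "\<epsilon> * (\<tau> * \<rho> 0) \<noteq> 0" using eps tr by auto
  moreover have "\<forall>\<^sub>F q in nhds (0, 0). W (fst q, \<theta> q) = \<epsilon> * (\<tau> * \<rho> (fst q)) * S1_function (\<epsilon> * \<tau>) q"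
  proof -
    have cm: "isCont (\<lambda>q. (fst q, m q)) (0, 0)" using smooth_near_isCont[OF m] by (intro continuous_intros)
    have 1: "\<forall>\<^sub>F q in nhds (0, 0). W (fst q, \<sigma> (fst q, m q)) = r (fst q) + \<epsilon> * (m q)\<^sup>2"
      using eventually_nhds_along[OF cm, where P = "\<lambda>q. W (fst q, \<sigma> q) = r (fst q) + \<epsilon> * (snd q)\<^sup>2"] s(6) m0
      by (simp add: \<epsilon>_def)
    have 2: "\<forall>\<^sub>F q in nhds (0::real, 0::real). r (fst q) = fst q * \<rho> (fst q)"
      by (rule eventually_nhds_along[where f = fst]) (use r in simp_all)
    have 3: "\<forall>\<^sub>F q in nhds (0::real, 0::real). \<tau> * \<rho> (fst q) > 0"
      by (rule eventually_nhds_nonzero(1)[OF smooth_near_isCont[OF rhof]]) (use tr in simp)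
    from 1 2 3 show ?thesis
    proof eventually_elim
      case (elim q)
      have "(m q)\<^sup>2 = \<tau> * \<rho> (fst q) * (snd q)\<^sup>2" using elim(3) by (simp add: m_def power_mult_distrib)
      then have "W (fst q, \<theta> q) = fst q * \<rho> (fst q) + \<epsilon> * (\<tau> * \<rho> (fst q) * (snd q)\<^sup>2)"
        using elim(1,2) by (simp add: \<theta>_def)
      also have "fst q * \<rho> (fst q) = (\<epsilon> * \<epsilon>) * (\<tau> * \<tau>) * (fst q * \<rho> (fst q))" using eps by simp
      finally show ?case by (simp add: S1_function_def algebra_simps)
    qed
  qed
  ultimately have "A_equivalent (folded_form (S1_function (\<epsilon> * \<tau>))) (0, 0) (folded_form W) (0, 0)"
    by (intro folded_form_change[OF th th0])
  then show ?thesis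
    unfolding \<epsilon>_def \<tau>_def
    by (rule A_equivalent_sym[OF _ smooth_near_isCont[OF smooth_near_folded_form[OF smooth_near_S1_function]]])
qed

section \<open>Invariants that separate the normal forms\<close>

lemma smooth_near_lipschitz:
  fixes f :: "'a::euclidean_space \<Rightarrow> real"
  assumes "smooth_near p f"
  obtains L where "L \<ge> 0" "\<forall>\<^sub>F z in nhds (p, p). \<bar>f (fst z) - f (snd z)\<bar> \<le> L * norm (fst z - snd z)"
proof -
  obtain S where S: "open S" "p \<in> S" "smooth_on S f" using assms by (rule smooth_nearE)
  define N where "N x = (\<Sum>b\<in>Basis. \<bar>frechet_derivative f (at x) b\<bar>)" for x
  have sd: "smooth_near p (\<lambda>x. frechet_derivative f (at x) b)" for b by (rule smooth_near_derivative[OF assms])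
  have "isCont N p" unfolding N_def using smooth_near_isCont[OF sd] by (intro continuous_intros)
  then have "isCont (\<lambda>x. N p + 1 - N x) p" by (intro continuous_intros)
  then have "\<forall>\<^sub>F x in nhds p. N p + 1 - N x > 0" by (rule eventually_nhds_nonzero(1)) simp
  then obtain T where T: "open T" "p \<in> T" "\<And>x. x \<in> T \<Longrightarrow> N x \<le> N p + 1"
    by (auto simp: eventually_nhds less_imp_le)
  obtain e where e: "e > 0" "ball p e \<subseteq> S \<inter> T"
    using S T openE[of "S \<inter> T" p] by blast
  have lip: "norm (f x - f y) \<le> (N p + 1) * norm (x - y)" if "x \<in> ball p e" "y \<in> ball p e" for x y
  proof (rule differentiable_bound[of "ball p e" f "\<lambda>x. frechet_derivative f (at x)"])
    fix x assume x: "x \<in> ball p e"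
    have D: "(f has_derivative frechet_derivative f (at x)) (at x)"
      using smooth_on_has_derivative[OF S(3)] e x by blast
    then show "(f has_derivative frechet_derivative f (at x)) (at x within ball p e)"
      by (rule has_derivative_at_withinI)
    have lin: "linear (frechet_derivative f (at x))" using D has_derivative_linear by blast
    show "onorm (frechet_derivative f (at x)) \<le> N p + 1"
    proof (rule onorm_le)
      fix h
      have "frechet_derivative f (at x) h = frechet_derivative f (at x) (\<Sum>b\<in>Basis. (h \<bullet> b) *\<^sub>R b)"
        by (simp only: euclidean_representation)
      also have "\<dots> = (\<Sum>b\<in>Basis. (h \<bullet> b) * frechet_derivative f (at x) b)"
        by (simp only: linear_sum[OF lin] linear_cmul[OF lin] real_scaleR_def)
      finally have "norm (frechet_derivative f (at x) h) \<le> (\<Sum>b\<in>Basis. \<bar>h \<bullet> b\<bar> * \<bar>frechet_derivative f (at x) b\<bar>)"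
        by (simp only: real_norm_def) (rule order_trans[OF sum_abs], simp add: abs_mult)
      also have "\<dots> \<le> (\<Sum>b\<in>Basis. norm h * \<bar>frechet_derivative f (at x) b\<bar>)"
        by (intro sum_mono mult_right_mono) (auto simp: Basis_le_norm)
      also have "\<dots> = N x * norm h" by (simp add: N_def sum_distrib_left[symmetric] mult.commute)
      also have "\<dots> \<le> (N p + 1) * norm h" using T(3)[of x] e x by (intro mult_right_mono) auto
      finally show "norm (frechet_derivative f (at x) h) \<le> (N p + 1) * norm h" .
    qed
  qed (use that in auto)
  show thesis
  proof (rule that)
    show "N p + 1 \<ge> 0" unfolding N_def by (intro add_nonneg_nonneg sum_nonneg) auto
    have "open (ball p e \<times> ball p e)" "(p, p) \<in> ball p e \<times> ball p e" using e by (auto intro: open_Times)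
    then show "\<forall>\<^sub>F z in nhds (p, p). \<bar>f (fst z) - f (snd z)\<bar> \<le> (N p + 1) * norm (fst z - snd z)"
      unfolding eventually_nhds using lip by (intro exI[of _ "ball p e \<times> ball p e"]) (auto simp del: mem_ball)
  qed
qed

lemma smooth_near_lipschitz_along:
  fixes f :: "'a::euclidean_space \<Rightarrow> real" and a b :: "'c::t2_space \<Rightarrow> 'a"
  assumes "smooth_near p f" "isCont a t" "isCont b t" "a t = p" "b t = p"
  obtains L where "L \<ge> 0" "\<forall>\<^sub>F x in nhds t. \<bar>f (a x) - f (b x)\<bar> \<le> L * norm (a x - b x)"
proof -
  obtain L where L: "L \<ge> 0" "\<forall>\<^sub>F z in nhds (p, p). \<bar>f (fst z) - f (snd z)\<bar> \<le> L * norm (fst z - snd z)"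
    using smooth_near_lipschitz[OF assms(1)] by blast
  have "isCont (\<lambda>x. (a x, b x)) t" using assms(2,3) by (intro continuous_intros)
  from eventually_nhds_along[OF this, where P = "\<lambda>z. \<bar>f (fst z) - f (snd z)\<bar> \<le> L * norm (fst z - snd z)"] L assms(4,5)
  show thesis by (intro that) auto
qed

text \<open>What an equivalence to a map in folded form says about the coordinate functions \<open>X\<close>, \<open>Y\<close> of the source diffeomorphism.\<close>

lemma equivalent_to_folded_form:
  assumes "A_equivalent F (0, 0) (folded_form V) (0, 0)"
  obtains X Y \<psi>1 \<psi>2 \<psi>3 where "smooth_near (0, 0) X" "smooth_near (0, 0) Y" "X (0, 0) = 0" "Y (0, 0) = 0"
    "\<forall>a b. a * pdu X (0, 0) + b * pdv X (0, 0) = 0 \<longrightarrow> a * pdu Y (0, 0) + b * pdv Y (0, 0) = 0 \<longrightarrow> a = 0 \<and> b = 0"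
    "smooth_near (F (0, 0)) \<psi>1" "smooth_near (F (0, 0)) \<psi>2" "smooth_near (F (0, 0)) \<psi>3"
    "\<forall>\<^sub>F q in nhds (0, 0). X q = \<psi>1 (F q)" "\<forall>\<^sub>F q in nhds (0, 0). (Y q)\<^sup>2 = \<psi>2 (F q)"
    "\<forall>\<^sub>F q in nhds (0, 0). Y q * V ((Y q)\<^sup>2, X q) = \<psi>3 (F q)"
proof -
  obtain \<phi> \<phi>' \<psi> \<psi>' where 1: "inverse_germs (0, 0) \<phi> \<phi>'" "\<phi> (0, 0) = (0, 0)"
     "inverse_germs (F (0, 0)) \<psi> \<psi>'" "\<forall>\<^sub>F x in nhds (0, 0). \<psi> (F x) = folded_form V (\<phi> x)"
    using assms by (auto simp: A_equivalent_iff)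
  have ph: "smooth_near (0, 0) \<phi>" "smooth_near (0, 0) \<phi>'" "\<forall>\<^sub>F x in nhds (0, 0). \<phi>' (\<phi> x) = x"
    using 1 by (auto simp: inverse_germs_def)
  have ps: "smooth_near (F (0, 0)) \<psi>" using 1 by (simp add: inverse_germs_def)
  define X where "X q = fst (\<phi> q)" for q
  define Y where "Y q = snd (\<phi> q)" for q
  have XY: "smooth_near (0, 0) X" "smooth_near (0, 0) Y" unfolding X_def Y_def using ph by auto
  have nth: "smooth_near (F (0, 0)) (\<lambda>P. \<psi> P $ i)" for i
    by (rule smooth_near_linear_compose[OF bounded_linear_vec_nth ps])
  have inj: "a = 0 \<and> b = 0" if ab: "a * pdu X (0, 0) + b * pdv X (0, 0) = 0" "a * pdu Y (0, 0) + b * pdv Y (0, 0) = 0" for a b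
  proof -
    have "((\<lambda>q. (X q, Y q)) has_derivative (\<lambda>v. (fst v *\<^sub>R pdu X (0, 0) + snd v *\<^sub>R pdv X (0, 0), fst v *\<^sub>R pdu Y (0, 0) + snd v *\<^sub>R pdv Y (0, 0)))) (at (0, 0))"
      by (intro has_derivative_Pair has_derivative_pd XY)
    then have D: "(\<phi> has_derivative (\<lambda>v. (fst v *\<^sub>R pdu X (0, 0) + snd v *\<^sub>R pdv X (0, 0), fst v *\<^sub>R pdu Y (0, 0) + snd v *\<^sub>R pdv Y (0, 0)))) (at (0, 0))"
      by (simp add: X_def Y_def)
    have D': "(\<phi>' has_derivative frechet_derivative \<phi>' (at (0, 0))) (at (\<phi> (0, 0)))"
      using smooth_near_has_derivative[OF ph(2)] 1(2) by simp
    have D1: "((\<lambda>x. \<phi>' (\<phi> x)) has_derivative (\<lambda>v. frechet_derivative \<phi>' (at (0, 0)) (fst v *\<^sub>R pdu X (0, 0) + snd v *\<^sub>R pdv X (0, 0), fst v *\<^sub>R pdu Y (0, 0) + snd v *\<^sub>R pdv Y (0, 0)))) (at (0, 0))"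
      by (rule has_derivative_compose[OF D D'])
    have D2: "((\<lambda>x. \<phi>' (\<phi> x)) has_derivative (\<lambda>v. v)) (at (0, 0))"
    proof -
      obtain S where "open S" "(0, 0) \<in> S" "\<And>x. x \<in> S \<Longrightarrow> \<phi>' (\<phi> x) = x" using ph(3) by (auto simp: eventually_nhds)
      then show ?thesis
        using has_derivative_transform_within_open[OF has_derivative_ident, of S "(0, 0)" "\<lambda>x. \<phi>' (\<phi> x)" UNIV] by simp
    qed
    have "(\<lambda>v. frechet_derivative \<phi>' (at (0, 0)) (fst v *\<^sub>R pdu X (0, 0) + snd v *\<^sub>R pdv X (0, 0), fst v *\<^sub>R pdu Y (0, 0) + snd v *\<^sub>R pdv Y (0, 0))) = (\<lambda>v. v)"
      by (rule has_derivative_unique[OF D1 D2])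
    from fun_cong[OF this, of "(a, b)"] have "(a, b) = frechet_derivative \<phi>' (at (0, 0)) (0, 0)"
      using ab by simp
    also have "\<dots> = 0" using D' has_derivative_linear linear_0 zero_prod_def by metis
    finally show ?thesis by (simp add: zero_prod_def)
  qed
  have e: "\<forall>\<^sub>F q in nhds (0, 0). X q = \<psi> (F q) $ 1" "\<forall>\<^sub>F q in nhds (0, 0). (Y q)\<^sup>2 = \<psi> (F q) $ 2"
    "\<forall>\<^sub>F q in nhds (0, 0). Y q * V ((Y q)\<^sup>2, X q) = \<psi> (F q) $ 3"
    using 1(4) by (auto elim!: eventually_mono simp: folded_form_def X_def Y_def)
  have XY0: "X (0, 0) = 0" "Y (0, 0) = 0" using 1(2) by (simp_all add: X_def Y_def)
  show thesis
    by (rule that[OF XY XY0 _ nth nth nth e]) (intro allI impI inj)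
qed

text \<open>A curve tangent to the kernel of the differential is mapped by a map in folded form to a curve with nonzero
  second order part.\<close>

lemma not_equivalent_to_folded_form:
  assumes "isCont F (0, 0)" "((\<lambda>s. norm (F (0, s) - F (0, 0)) / s\<^sup>2) \<longlongrightarrow> 0) (at 0)"
  shows "\<not> A_equivalent F (0, 0) (folded_form V) (0, 0)"
proof
  assume eqv: "A_equivalent F (0, 0) (folded_form V) (0, 0)"
  obtain X Y \<psi>1 \<psi>2 \<psi>3 where *: "smooth_near (0, 0) X" "smooth_near (0, 0) Y" "X (0, 0) = 0" "Y (0, 0) = 0"
    "\<forall>a b. a * pdu X (0, 0) + b * pdv X (0, 0) = 0 \<longrightarrow> a * pdu Y (0, 0) + b * pdv Y (0, 0) = 0 \<longrightarrow> a = 0 \<and> b = 0"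
    "smooth_near (F (0, 0)) \<psi>1" "smooth_near (F (0, 0)) \<psi>2" "smooth_near (F (0, 0)) \<psi>3"
    "\<forall>\<^sub>F q in nhds (0, 0). X q = \<psi>1 (F q)" "\<forall>\<^sub>F q in nhds (0, 0). (Y q)\<^sup>2 = \<psi>2 (F q)"
    "\<forall>\<^sub>F q in nhds (0, 0). Y q * V ((Y q)\<^sup>2, X q) = \<psi>3 (F q)"
    by (rule equivalent_to_folded_form[OF eqv])
  have cF: "isCont (\<lambda>s. F (0, s)) 0"
    by (rule isCont_o2[where f = "\<lambda>s. (0, s)" and g = F]) (use assms(1) in simp_all)
  have lim: "((\<lambda>s. R (0, s) / s\<^sup>2) \<longlongrightarrow> 0) (at 0)"
    if h: "smooth_near (F (0, 0)) \<psi>" "\<forall>\<^sub>F q in nhds (0, 0). R q = \<psi> (F q)" "R (0, 0) = 0" for R :: "real \<times> real \<Rightarrow> real" and \<psi>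
  proof -
    obtain L where L: "L \<ge> 0" "\<forall>\<^sub>F s in nhds 0. \<bar>\<psi> (F (0, s)) - \<psi> (F (0, 0))\<bar> \<le> L * norm (F (0, s) - F (0, 0))"
      using smooth_near_lipschitz_along[OF h(1), where a = "\<lambda>s. F (0, s)" and t = "0::real" and b = "\<lambda>s. F (0, 0)"] cF by auto
    have z: "\<psi> (F (0, 0)) = 0" using eventually_nhds_x_imp_x[OF h(2)] h(3) by simp
    have "\<forall>\<^sub>F s in nhds 0. R (0, s) = \<psi> (F (0, s))" by (rule eventually_nhds_slice(2)[OF h(2)])
    with L(2) have "\<forall>\<^sub>F s in nhds 0. norm (R (0, s) / s\<^sup>2) \<le> L * (norm (F (0, s) - F (0, 0)) / s\<^sup>2)"
      by eventually_elim (simp add: z divide_right_mono)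
    then have "\<forall>\<^sub>F s in at 0. norm (R (0, s) / s\<^sup>2) \<le> L * (norm (F (0, s) - F (0, 0)) / s\<^sup>2)"
      by (simp add: eventually_nhds_conv_at)
    moreover have "((\<lambda>s. L * (norm (F (0, s) - F (0, 0)) / s\<^sup>2)) \<longlongrightarrow> 0) (at 0)"
      using tendsto_mult_right_zero[OF assms(2)] by simp
    ultimately show ?thesis by (rule Lim_null_comparison)
  qed
  have slope: "((\<lambda>s. R (0, s) / s) \<longlongrightarrow> pdv R (0, 0)) (at 0)" if "smooth_near (0, 0) R" "R (0, 0) = 0" for R :: "real \<times> real \<Rightarrow> real"
    using DERIV_pdv[OF that(1)] that(2) by (simp add: has_field_derivative_iff)
  have "((\<lambda>s. s * (X (0, s) / s\<^sup>2)) \<longlongrightarrow> 0 * 0) (at 0)"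
    by (intro tendsto_mult lim[OF *(6,9,3)] tendsto_intros)
  then have "((\<lambda>s. X (0, s) / s) \<longlongrightarrow> 0) (at 0)"
    by (subst LIM_equal[where g = "\<lambda>s. s * (X (0, s) / s\<^sup>2)"]) (simp_all add: power2_eq_square)
  then have X0: "pdv X (0, 0) = 0" by (rule LIM_unique[OF slope[OF *(1,3)]])
  have Y1: "((\<lambda>s. (Y (0, s))\<^sup>2 / s\<^sup>2) \<longlongrightarrow> 0) (at 0)"
    using lim[OF *(7,10)] *(4) by simp
  have "((\<lambda>s. (Y (0, s) / s)\<^sup>2) \<longlongrightarrow> (pdv Y (0, 0))\<^sup>2) (at 0)"
    by (intro tendsto_power slope *)
  then have "((\<lambda>s. (Y (0, s))\<^sup>2 / s\<^sup>2) \<longlongrightarrow> (pdv Y (0, 0))\<^sup>2) (at 0)"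
    by (simp only: power_divide)
  then have "(pdv Y (0, 0))\<^sup>2 = 0" by (rule LIM_unique[OF _ Y1])
  then show False using *(5)[rule_format, of 0 1] X0 by simp
qed

text \<open>At \<open>y = 0\<close> the \<open>y\<close>-derivative of \<open>(x, y\<^sup>2, y W (y\<^sup>2, x))\<close> is \<open>(0, 0, W (0, x))\<close>; hence \<open>W (0, x)\<close> divides the \<open>y\<close>-derivative of every
  function of the components.\<close>

lemma pdv_along_folded_form:
  assumes W: "smooth_near (0, 0) W" and R: "smooth_near (0, 0) R" "\<forall>\<^sub>F q in nhds (0, 0). R q = \<psi> (folded_form W q)"
    and \<psi>: "smooth_near (folded_form W (0, 0)) (\<psi> :: real^3 \<Rightarrow> real)"
  obtains k where "isCont k 0" "\<forall>\<^sub>F x in nhds 0. pdv R (x, 0) = k x * W (0, x)"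
proof -
  define e3 where "e3 = (vector [0, 0, 1] :: real^3)"
  define k where "k x = frechet_derivative \<psi> (at (folded_form W (x, 0))) e3" for x
  have fx: "smooth_near 0 (\<lambda>x. folded_form W (x, 0))"
    by (rule smooth_near_compose[OF _ smooth_near_slice]) (use smooth_near_folded_form[OF W] in simp)
  have "smooth_near 0 k"
    unfolding k_def
    by (rule smooth_near_compose[where f = "\<lambda>P. frechet_derivative \<psi> (at P) e3", OF _ fx]) (use smooth_near_derivative[OF \<psi>] in simp)
  then have "isCont k 0" by (rule smooth_near_isCont)
  moreover have 1: "\<forall>\<^sub>F x in nhds 0. smooth_near (folded_form W (x, 0)) \<psi>"
    by (rule eventually_nhds_along[OF smooth_near_isCont[OF fx]]) (use smooth_near_eventually[OF \<psi>] in simp)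
  have 2: "\<forall>\<^sub>F x in nhds 0. smooth_near (x, 0) R"
    by (rule eventually_nhds_slice(1)[OF smooth_near_eventually[OF R(1)]])
  have 3: "\<forall>\<^sub>F x in nhds 0. \<forall>\<^sub>F q in nhds (x, 0). R q = \<psi> (folded_form W q)"
    by (rule eventually_nhds_slice(1)) (use R(2) in \<open>simp add: eventually_eventually\<close>)
  have 4: "\<forall>\<^sub>F x in nhds 0. smooth_near (0, x) W"
    by (rule eventually_nhds_slice(2)[OF smooth_near_eventually[OF W]])
  from 1 2 3 4 have "\<forall>\<^sub>F x in nhds 0. pdv R (x, 0) = k x * W (0, x)"
  proof eventually_elim
    case (elim x)
    have "((\<lambda>y. W (y\<^sup>2, x)) has_field_derivative (2 * 0) * pdu W (0\<^sup>2, x) + 0 * pdv W (0\<^sup>2, x)) (at 0)"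
      by (rule DERIV_along_curve) (use elim(4) in \<open>auto intro!: derivative_eq_intros\<close>)
    then have dW: "((\<lambda>y. y * W (y\<^sup>2, x)) has_field_derivative W (0, x)) (at 0)"
      by (auto intro!: derivative_eq_intros)
    define g where "g y = y * W (y\<^sup>2, x)" for y
    have dg: "(g has_derivative (*) (W (0, x))) (at 0)"
      using dW unfolding g_def[abs_def] has_field_derivative_def .
    have comb: "folded_form W (x, y) = x *\<^sub>R vector [1, 0, 0] + y\<^sup>2 *\<^sub>R vector [0, 1, 0] + g y *\<^sub>R e3" for y
      by (simp add: folded_form_def e3_def vector3_eq_iff g_def)
    have dF: "((\<lambda>y. folded_form W (x, y)) has_derivative (\<lambda>h. h *\<^sub>R (W (0, x) *\<^sub>R e3))) (at 0)"
      unfolding comb by (auto intro!: derivative_eq_intros dg)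
    have D: "(\<psi> has_derivative frechet_derivative \<psi> (at (folded_form W (x, 0)))) (at (folded_form W (x, 0)))"
      by (rule smooth_near_has_derivative[OF elim(1)])
    have "((\<lambda>y. \<psi> (folded_form W (x, y))) has_derivative (\<lambda>h. frechet_derivative \<psi> (at (folded_form W (x, 0))) (h *\<^sub>R (W (0, x) *\<^sub>R e3)))) (at 0)"
      by (rule has_derivative_compose[OF dF D])
    moreover have "(\<lambda>h. frechet_derivative \<psi> (at (folded_form W (x, 0))) (h *\<^sub>R (W (0, x) *\<^sub>R e3))) = (*) (k x * W (0, x))"
      using linear_cmul[OF has_derivative_linear[OF D]] by (simp add: k_def fun_eq_iff)
    ultimately have "((\<lambda>y. \<psi> (folded_form W (x, y))) has_field_derivative k x * W (0, x)) (at 0)"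
      by (simp add: has_field_derivative_def)
    moreover have "\<forall>\<^sub>F y in nhds 0. R (x, y) = \<psi> (folded_form W (x, y))"
      by (rule eventually_nhds_slice(2)[OF elim(3)])
    ultimately have "((\<lambda>y. R (x, y)) has_field_derivative k x * W (0, x)) (at 0)"
      by (subst DERIV_cong_ev[OF refl _ refl])
    then show ?case using DERIV_pdv[OF elim(2)] by (metis DERIV_unique)
  qed
  ultimately show thesis using that by blast
qed

lemma slope_at_origin:
  fixes R :: "real \<times> real \<Rightarrow> real"
  assumes "smooth_near (0, 0) R" "R (0, 0) = 0"
  shows "((\<lambda>x. R (x, 0) / x) \<longlongrightarrow> pdu R (0, 0)) (at 0)" "((\<lambda>y. R (0, y) / y) \<longlongrightarrow> pdv R (0, 0)) (at 0)"
  using DERIV_pdu[OF assms(1)] DERIV_pdv[OF assms(1)] assms(2) by (simp_all add: has_field_derivative_iff)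

lemma lim_at_origin:
  fixes R :: "real \<times> real \<Rightarrow> real"
  assumes "smooth_near (0, 0) R"
  shows "((\<lambda>x. R (x, 0)) \<longlongrightarrow> R (0, 0)) (at 0)" "((\<lambda>y. R (0, y)) \<longlongrightarrow> R (0, 0)) (at 0)"
  using DERIV_isCont[OF DERIV_pdu[OF assms]] DERIV_isCont[OF DERIV_pdv[OF assms]] by (simp_all add: isCont_def)

text \<open>First order consequences, along the \<open>x\<close>-axis, of an equivalence between two maps in folded form, when
  \<open>W (0, x) = o(x)\<close>. The powers of \<open>x\<close> to which \<open>W (0, x)\<close> vanishes carry over to \<open>y\<close>-derivatives of
  functions of the components.\<close>

lemma folded_forms_equivalent:
  assumes W: "smooth_near (0, 0) W" and V: "smooth_near (0, 0) V"
    and eqv: "A_equivalent (folded_form W) (0, 0) (folded_form V) (0, 0)"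
    and o: "((\<lambda>x. W (0, x) / x) \<longlongrightarrow> 0) (at 0)"
  obtains X Y T where "smooth_near (0, 0) X" "smooth_near (0, 0) Y" "X (0, 0) = 0" "Y (0, 0) = 0"
    "pdv X (0, 0) = 0" "pdu Y (0, 0) = 0" "pdu X (0, 0) \<noteq> 0" "pdv Y (0, 0) \<noteq> 0"
    "smooth_near (0, 0) T" "\<forall>q. T q = Y q * V ((Y q)\<^sup>2, X q)"
    "\<forall>n. ((\<lambda>x. W (0, x) / x ^ n) \<longlongrightarrow> 0) (at 0) \<longrightarrow> ((\<lambda>x. pdv T (x, 0) / x ^ n) \<longlongrightarrow> 0) (at 0)"
proof -
  obtain X Y \<psi>1 \<psi>2 \<psi>3 where *: "smooth_near (0, 0) X" "smooth_near (0, 0) Y" "X (0, 0) = 0" "Y (0, 0) = 0"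
    "\<forall>a b. a * pdu X (0, 0) + b * pdv X (0, 0) = 0 \<longrightarrow> a * pdu Y (0, 0) + b * pdv Y (0, 0) = 0 \<longrightarrow> a = 0 \<and> b = 0"
    "smooth_near (folded_form W (0, 0)) \<psi>1" "smooth_near (folded_form W (0, 0)) \<psi>2" "smooth_near (folded_form W (0, 0)) \<psi>3"
    "\<forall>\<^sub>F q in nhds (0, 0). X q = \<psi>1 (folded_form W q)" "\<forall>\<^sub>F q in nhds (0, 0). (Y q)\<^sup>2 = \<psi>2 (folded_form W q)"
    "\<forall>\<^sub>F q in nhds (0, 0). Y q * V ((Y q)\<^sup>2, X q) = \<psi>3 (folded_form W q)"
    by (rule equivalent_to_folded_form[OF eqv])
  have vanish: "((\<lambda>x. pdv R (x, 0) / x ^ n) \<longlongrightarrow> 0) (at 0)"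
    if R: "smooth_near (0, 0) R" "\<forall>\<^sub>F q in nhds (0, 0). R q = \<psi> (folded_form W q)" "smooth_near (folded_form W (0, 0)) \<psi>"
      and n: "((\<lambda>x. W (0, x) / x ^ n) \<longlongrightarrow> 0) (at 0)" for R :: "real \<times> real \<Rightarrow> real" and \<psi> n
  proof -
    obtain k where k: "isCont k 0" "\<forall>\<^sub>F x in nhds 0. pdv R (x, 0) = k x * W (0, x)"
      by (rule pdv_along_folded_form[OF W R])
    have "((\<lambda>x. k x * (W (0, x) / x ^ n)) \<longlongrightarrow> k 0 * 0) (at 0)"
      by (intro tendsto_mult n) (use k(1) in \<open>simp add: isCont_def\<close>)
    moreover have ev: "\<forall>\<^sub>F x in at 0. k x * (W (0, x) / x ^ n) = pdv R (x, 0) / x ^ n"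
      using k(2) unfolding eventually_nhds_conv_at by (auto elim!: eventually_mono)
    ultimately show ?thesis by (simp add: tendsto_cong[OF ev, symmetric])
  qed
  have o1: "((\<lambda>x. W (0, x) / x ^ 1) \<longlongrightarrow> 0) (at 0)" using o by simp
  have "((\<lambda>x. x * (W (0, x) / x)) \<longlongrightarrow> 0 * 0) (at 0)" by (intro tendsto_mult o tendsto_ident_at)
  then have o0: "((\<lambda>x. W (0, x) / x ^ 0) \<longlongrightarrow> 0) (at 0)"
    by (subst LIM_equal[where g = "\<lambda>x. x * (W (0, x) / x)"]) simp_all
  have "((\<lambda>x. pdv X (x, 0)) \<longlongrightarrow> 0) (at 0)" using vanish[OF *(1,9,6) o0] by simp
  then have Xv: "pdv X (0, 0) = 0"
    by (rule LIM_unique[OF lim_at_origin(1)[OF smooth_near_pdv[OF *(1)]]])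
  then have Yv: "pdv Y (0, 0) \<noteq> 0" using *(5)[rule_format, of 0 1] by auto
  have Y2: "smooth_near (0, 0) (\<lambda>q. (Y q)\<^sup>2)" by (rule smooth_near_power[OF *(2)])
  have Y2v: "\<forall>\<^sub>F x in nhds 0. pdv (\<lambda>q. (Y q)\<^sup>2) (x, 0) = 2 * Y (x, 0) * pdv Y (x, 0)"
    using eventually_nhds_slice(1)[OF smooth_near_eventually[OF *(2)]]
  proof eventually_elim
    case (elim x)
    have "((\<lambda>y. (Y (x, y))\<^sup>2) has_field_derivative 2 * Y (x, 0) * pdv Y (x, 0)) (at 0)"
      using DERIV_pdv[OF elim] by (auto intro!: derivative_eq_intros)
    then show ?case using DERIV_pdv[OF smooth_near_power[OF elim, of 2]] by (metis DERIV_unique)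
  qed
  have "((\<lambda>x. 2 * (Y (x, 0) / x) * pdv Y (x, 0)) \<longlongrightarrow> 2 * pdu Y (0, 0) * pdv Y (0, 0)) (at 0)"
    by (intro tendsto_mult tendsto_const slope_at_origin lim_at_origin smooth_near_pdv *)
  moreover have ev: "\<forall>\<^sub>F x in at 0. 2 * (Y (x, 0) / x) * pdv Y (x, 0) = pdv (\<lambda>q. (Y q)\<^sup>2) (x, 0) / x ^ 1"
    using Y2v unfolding eventually_nhds_conv_at by (auto elim!: eventually_mono)
  ultimately have "((\<lambda>x. pdv (\<lambda>q. (Y q)\<^sup>2) (x, 0) / x ^ 1) \<longlongrightarrow> 2 * pdu Y (0, 0) * pdv Y (0, 0)) (at 0)"
    by (simp only: tendsto_cong[OF ev])
  then have "2 * pdu Y (0, 0) * pdv Y (0, 0) = 0"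
    by (rule LIM_unique[OF _ vanish[OF Y2 *(10,7) o1]])
  then have Yu: "pdu Y (0, 0) = 0" using Yv by simp
  then have Xu: "pdu X (0, 0) \<noteq> 0" using *(5)[rule_format, of 1 0] by auto
  define T where "T q = Y q * V ((Y q)\<^sup>2, X q)" for q
  have VX: "smooth_near (0, 0) (\<lambda>q. V ((Y q)\<^sup>2, X q))"
    by (rule smooth_near_compose2[where F = V, OF _ Y2 *(1)]) (use V *(3,4) in simp)
  have T: "smooth_near (0, 0) T" unfolding T_def by (rule smooth_near_mult[OF *(2) VX])
  have "\<forall>\<^sub>F q in nhds (0, 0). T q = \<psi>3 (folded_form W q)" using *(11) by (simp add: T_def)
  then have Tn: "\<forall>n. ((\<lambda>x. W (0, x) / x ^ n) \<longlongrightarrow> 0) (at 0) \<longrightarrow> ((\<lambda>x. pdv T (x, 0) / x ^ n) \<longlongrightarrow> 0) (at 0)"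
    by (intro allI impI vanish[OF T _ *(8)])
  have T_eq: "\<forall>q. T q = Y q * V ((Y q)\<^sup>2, X q)" by (simp add: T_def)
  show thesis by (rule that[OF *(1-4) Xv Yu Xu Yv T T_eq Tn])
qed

text \<open>For the cross cap the \<open>y\<close>-derivative of the third component along the \<open>x\<close>-axis is \<open>x\<close>, up to a nonzero factor and terms of
  higher order, which \<open>W (0, x) = o(x)\<close> excludes.\<close>

lemma not_cross_cap_folded_form:
  assumes W: "smooth_near (0, 0) W" and o: "((\<lambda>x. W (0, x) / x) \<longlongrightarrow> 0) (at 0)"
  shows "\<not> A_equivalent (folded_form W) (0, 0) (folded_form snd) (0, 0)"
proof
  assume eqv: "A_equivalent (folded_form W) (0, 0) (folded_form snd) (0, 0)"
  obtain X Y T where *: "smooth_near (0, 0) X" "smooth_near (0, 0) Y" "X (0, 0) = 0" "Y (0, 0) = 0"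
    "pdv X (0, 0) = 0" "pdu Y (0, 0) = 0" "pdu X (0, 0) \<noteq> 0" "pdv Y (0, 0) \<noteq> 0"
    "smooth_near (0, 0) T" "\<forall>q. T q = Y q * snd ((Y q)\<^sup>2, X q)"
    "\<forall>n. ((\<lambda>x. W (0, x) / x ^ n) \<longlongrightarrow> 0) (at 0) \<longrightarrow> ((\<lambda>x. pdv T (x, 0) / x ^ n) \<longlongrightarrow> 0) (at 0)"
    by (rule folded_forms_equivalent[OF W smooth_near_snd eqv o])
  have "\<forall>\<^sub>F x in nhds 0. pdv T (x, 0) = pdv Y (x, 0) * X (x, 0) + Y (x, 0) * pdv X (x, 0)"
    using eventually_nhds_slice(1)[OF smooth_near_eventually[OF *(1)]] eventually_nhds_slice(1)[OF smooth_near_eventually[OF *(2)]]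
      eventually_nhds_slice(1)[OF smooth_near_eventually[OF *(9)]]
  proof eventually_elim
    case (elim x)
    have "((\<lambda>y. Y (x, y) * X (x, y)) has_field_derivative pdv Y (x, 0) * X (x, 0) + Y (x, 0) * pdv X (x, 0)) (at 0)"
      using DERIV_pdv[OF elim(1)] DERIV_pdv[OF elim(2)] by (auto intro!: derivative_eq_intros)
    then have "((\<lambda>y. T (x, y)) has_field_derivative pdv Y (x, 0) * X (x, 0) + Y (x, 0) * pdv X (x, 0)) (at 0)"
      by (simp add: *(10)[rule_format])
    then show ?case by (rule DERIV_unique[OF DERIV_pdv[OF elim(3)]])
  qed
  then have e: "\<forall>\<^sub>F x in at 0. pdv Y (x, 0) * (X (x, 0) / x) + (Y (x, 0) / x) * pdv X (x, 0) = pdv T (x, 0) / x ^ 1"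
    unfolding eventually_nhds_conv_at by (auto elim!: eventually_mono simp: add_divide_distrib)
  have "((\<lambda>x. pdv Y (x, 0) * (X (x, 0) / x) + (Y (x, 0) / x) * pdv X (x, 0)) \<longlongrightarrow>
      pdv Y (0, 0) * pdu X (0, 0) + pdu Y (0, 0) * pdv X (0, 0)) (at 0)"
    by (intro tendsto_add tendsto_mult slope_at_origin lim_at_origin smooth_near_pdv *)
  then have "((\<lambda>x. pdv T (x, 0) / x ^ 1) \<longlongrightarrow> pdv Y (0, 0) * pdu X (0, 0)) (at 0)"
    by (subst (asm) tendsto_cong[OF e]) (simp add: *)
  moreover have "((\<lambda>x. pdv T (x, 0) / x ^ 1) \<longlongrightarrow> 0) (at 0)" by (rule *(11)[rule_format]) (use o in simp)
  ultimately have "pdv Y (0, 0) * pdu X (0, 0) = 0" by (rule LIM_unique)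
  then show False using * by simp
qed

text \<open>For \<open>S\<^sub>1\<^sup>\<plusminus>\<close> that derivative is \<open>x\<^sup>2\<close>, up to a nonzero factor and terms of higher order.\<close>

lemma not_S1_folded_form:
  assumes W: "smooth_near (0, 0) W" and o: "((\<lambda>x. W (0, x) / x\<^sup>2) \<longlongrightarrow> 0) (at 0)"
  shows "\<not> A_equivalent (folded_form W) (0, 0) (folded_form (S1_function \<delta>)) (0, 0)"
proof
  assume eqv: "A_equivalent (folded_form W) (0, 0) (folded_form (S1_function \<delta>)) (0, 0)"
  have "((\<lambda>x. x * (W (0, x) / x\<^sup>2)) \<longlongrightarrow> 0 * 0) (at 0)" by (intro tendsto_mult o tendsto_ident_at)
  then have o1: "((\<lambda>x. W (0, x) / x) \<longlongrightarrow> 0) (at 0)"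
    by (subst LIM_equal[where g = "\<lambda>x. x * (W (0, x) / x\<^sup>2)"]) (simp_all add: power2_eq_square)
  obtain X Y T where *: "smooth_near (0, 0) X" "smooth_near (0, 0) Y" "X (0, 0) = 0" "Y (0, 0) = 0"
    "pdv X (0, 0) = 0" "pdu Y (0, 0) = 0" "pdu X (0, 0) \<noteq> 0" "pdv Y (0, 0) \<noteq> 0"
    "smooth_near (0, 0) T" "\<forall>q. T q = Y q * S1_function \<delta> ((Y q)\<^sup>2, X q)"
    "\<forall>n. ((\<lambda>x. W (0, x) / x ^ n) \<longlongrightarrow> 0) (at 0) \<longrightarrow> ((\<lambda>x. pdv T (x, 0) / x ^ n) \<longlongrightarrow> 0) (at 0)"
    by (rule folded_forms_equivalent[OF W smooth_near_S1_function eqv o1])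
  have "\<forall>\<^sub>F x in nhds 0. pdv T (x, 0) = pdv Y (x, 0) * ((X (x, 0))\<^sup>2 + \<delta> * (Y (x, 0))\<^sup>2) +
      Y (x, 0) * (2 * X (x, 0) * pdv X (x, 0) + \<delta> * (2 * Y (x, 0) * pdv Y (x, 0)))"
    using eventually_nhds_slice(1)[OF smooth_near_eventually[OF *(1)]] eventually_nhds_slice(1)[OF smooth_near_eventually[OF *(2)]]
      eventually_nhds_slice(1)[OF smooth_near_eventually[OF *(9)]]
  proof eventually_elim
    case (elim x)
    have "((\<lambda>y. Y (x, y) * ((X (x, y))\<^sup>2 + \<delta> * (Y (x, y))\<^sup>2)) has_field_derivative
        pdv Y (x, 0) * ((X (x, 0))\<^sup>2 + \<delta> * (Y (x, 0))\<^sup>2) +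
        Y (x, 0) * (2 * X (x, 0) * pdv X (x, 0) + \<delta> * (2 * Y (x, 0) * pdv Y (x, 0)))) (at 0)"
      using DERIV_pdv[OF elim(1)] DERIV_pdv[OF elim(2)] by (auto intro!: derivative_eq_intros)
    then have "((\<lambda>y. T (x, y)) has_field_derivative
        pdv Y (x, 0) * ((X (x, 0))\<^sup>2 + \<delta> * (Y (x, 0))\<^sup>2) +
        Y (x, 0) * (2 * X (x, 0) * pdv X (x, 0) + \<delta> * (2 * Y (x, 0) * pdv Y (x, 0)))) (at 0)"
      by (simp add: *(10)[rule_format] S1_function_def)
    then show ?case by (rule DERIV_unique[OF DERIV_pdv[OF elim(3)]])
  qed
  then have "\<forall>\<^sub>F x in at 0. pdv T (x, 0) = pdv Y (x, 0) * ((X (x, 0))\<^sup>2 + \<delta> * (Y (x, 0))\<^sup>2) +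
      Y (x, 0) * (2 * X (x, 0) * pdv X (x, 0) + \<delta> * (2 * Y (x, 0) * pdv Y (x, 0)))"
    by (simp add: eventually_nhds_conv_at)
  moreover have "\<forall>\<^sub>F x in at 0. x \<noteq> (0::real)" by (rule eventually_neq_at_within)
  ultimately have e: "\<forall>\<^sub>F x in at 0. pdv Y (x, 0) * ((X (x, 0) / x)\<^sup>2 + \<delta> * (Y (x, 0) / x)\<^sup>2) +
      (Y (x, 0) / x) * (2 * (X (x, 0) / x) * pdv X (x, 0) + \<delta> * (2 * (Y (x, 0) / x) * pdv Y (x, 0))) = pdv T (x, 0) / x ^ 2"
  proof eventually_elim
    case (elim x)
    have "a * ((b / x)\<^sup>2 + \<delta> * (c / x)\<^sup>2) + (c / x) * (2 * (b / x) * d + \<delta> * (2 * (c / x) * a)) =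
        (a * (b\<^sup>2 + \<delta> * c\<^sup>2) + c * (2 * b * d + \<delta> * (2 * c * a))) / x ^ 2" for a b c d
      using elim(2) by (simp add: field_simps power2_eq_square)
    then show ?case unfolding elim(1) .
  qed
  have "((\<lambda>x. pdv Y (x, 0) * ((X (x, 0) / x)\<^sup>2 + \<delta> * (Y (x, 0) / x)\<^sup>2) +
      (Y (x, 0) / x) * (2 * (X (x, 0) / x) * pdv X (x, 0) + \<delta> * (2 * (Y (x, 0) / x) * pdv Y (x, 0)))) \<longlongrightarrow>
      pdv Y (0, 0) * ((pdu X (0, 0))\<^sup>2 + \<delta> * (pdu Y (0, 0))\<^sup>2) +
      pdu Y (0, 0) * (2 * pdu X (0, 0) * pdv X (0, 0) + \<delta> * (2 * pdu Y (0, 0) * pdv Y (0, 0)))) (at 0)"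
    by (intro tendsto_add tendsto_mult tendsto_power tendsto_const slope_at_origin lim_at_origin smooth_near_pdv *)
  then have "((\<lambda>x. pdv T (x, 0) / x ^ 2) \<longlongrightarrow> pdv Y (0, 0) * (pdu X (0, 0))\<^sup>2) (at 0)"
    by (subst (asm) tendsto_cong[OF e]) (simp add: *)
  moreover have "((\<lambda>x. pdv T (x, 0) / x ^ 2) \<longlongrightarrow> 0) (at 0)" by (rule *(11)[rule_format]) (rule o)
  ultimately have "pdv Y (0, 0) * (pdu X (0, 0))\<^sup>2 = 0" by (rule LIM_unique)
  then show False using * by simp
qed

text \<open>Along the \<open>y\<close>-axis the third component of \<open>S\<^sub>1\<^sup>\<plusminus>\<close> has a nonzero odd part of order three, whereas the odd part of
  every function of \<open>(0, y\<^sup>2, y W (y\<^sup>2, 0))\<close> is of order \<open>y W (y\<^sup>2, 0)\<close>.\<close>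

lemma not_S1_folded_form':
  assumes W: "smooth_near (0, 0) W" and W0: "W (0, 0) = 0" "pdu W (0, 0) = 0" and \<delta>: "\<delta> \<noteq> 0"
    and o: "((\<lambda>x. W (0, x) / x) \<longlongrightarrow> 0) (at 0)"
  shows "\<not> A_equivalent (folded_form W) (0, 0) (folded_form (S1_function \<delta>)) (0, 0)"
proof
  assume eqv: "A_equivalent (folded_form W) (0, 0) (folded_form (S1_function \<delta>)) (0, 0)"
  obtain X Y \<psi>1 \<psi>2 \<psi>3 where *: "smooth_near (0, 0) X" "smooth_near (0, 0) Y" "X (0, 0) = 0" "Y (0, 0) = 0"
    "\<forall>a b. a * pdu X (0, 0) + b * pdv X (0, 0) = 0 \<longrightarrow> a * pdu Y (0, 0) + b * pdv Y (0, 0) = 0 \<longrightarrow> a = 0 \<and> b = 0"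
    "smooth_near (folded_form W (0, 0)) \<psi>1" "smooth_near (folded_form W (0, 0)) \<psi>2" "smooth_near (folded_form W (0, 0)) \<psi>3"
    "\<forall>\<^sub>F q in nhds (0, 0). X q = \<psi>1 (folded_form W q)" "\<forall>\<^sub>F q in nhds (0, 0). (Y q)\<^sup>2 = \<psi>2 (folded_form W q)"
    "\<forall>\<^sub>F q in nhds (0, 0). Y q * S1_function \<delta> ((Y q)\<^sup>2, X q) = \<psi>3 (folded_form W q)"
    by (rule equivalent_to_folded_form[OF eqv])
  have Xv: "pdv X (0, 0) = 0"
  proof -
    obtain k where k: "isCont k 0" "\<forall>\<^sub>F x in nhds 0. pdv X (x, 0) = k x * W (0, x)"
      by (rule pdv_along_folded_form[OF W *(1,9,6)])
    show ?thesis using eventually_nhds_x_imp_x[OF k(2)] W0 by simp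
  qed
  then have Yv: "pdv Y (0, 0) \<noteq> 0" using *(5)[rule_format, of 0 1] by auto
  define T where "T y = Y (0, y) * ((X (0, y))\<^sup>2 + \<delta> * (Y (0, y))\<^sup>2)" for y
  have "((\<lambda>y. (Y (0, y) / y) * ((X (0, y) / y)\<^sup>2 + \<delta> * (Y (0, y) / y)\<^sup>2)) \<longlongrightarrow>
     pdv Y (0, 0) * ((pdv X (0, 0))\<^sup>2 + \<delta> * (pdv Y (0, 0))\<^sup>2)) (at 0)"
    by (intro tendsto_add tendsto_mult tendsto_power tendsto_const slope_at_origin *)
  moreover have "(Y (0, y) / y) * ((X (0, y) / y)\<^sup>2 + \<delta> * (Y (0, y) / y)\<^sup>2) = T y / y ^ 3" for y
    by (cases "y = 0") (simp_all add: T_def power2_eq_square power3_eq_cube field_simps)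
  ultimately have T3: "((\<lambda>y. T y / y ^ 3) \<longlongrightarrow> \<delta> * (pdv Y (0, 0)) ^ 3) (at 0)"
    using Xv by (simp add: power2_eq_square power3_eq_cube mult_ac)
  have T3': "((\<lambda>y. T (- y) / (- y) ^ 3) \<longlongrightarrow> \<delta> * (pdv Y (0, 0)) ^ 3) (at 0)"
  proof (rule filterlim_compose[OF T3])
    show "filterlim (uminus :: real \<Rightarrow> real) (at 0) (at 0)"
      by (rule filterlim_atI) (auto intro!: tendsto_eq_intros simp: eventually_at_filter)
  qed
  have lim: "((\<lambda>y. (T y - T (- y)) / y ^ 3) \<longlongrightarrow> \<delta> * (pdv Y (0, 0)) ^ 3 + \<delta> * (pdv Y (0, 0)) ^ 3) (at 0)"
    using tendsto_add[OF T3 T3'] by (simp add: diff_divide_distrib)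
  have cF: "isCont (\<lambda>y. folded_form W (0, y)) 0" "isCont (\<lambda>y. folded_form W (0, - y)) 0"
  proof -
    have "isCont (folded_form W) (0, 0)" by (rule smooth_near_isCont[OF smooth_near_folded_form[OF W]])
    then show "isCont (\<lambda>y. folded_form W (0, y)) 0" "isCont (\<lambda>y. folded_form W (0, - y)) 0"
      by (auto intro!: isCont_o2[where f = "\<lambda>y. (0, y)" and g = "folded_form W"]
          isCont_o2[where f = "\<lambda>y. (0, - y)" and g = "folded_form W"] continuous_intros)
  qed
  obtain L where L: "L \<ge> 0" "\<forall>\<^sub>F y in nhds 0. \<bar>\<psi>3 (folded_form W (0, y)) - \<psi>3 (folded_form W (0, - y))\<bar>
      \<le> L * norm (folded_form W (0, y) - folded_form W (0, - y))"
    by (rule smooth_near_lipschitz_along[OF *(8) cF]) auto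
  have n: "norm (folded_form W (0, y) - folded_form W (0, - y)) = 2 * \<bar>y\<bar> * \<bar>W (y\<^sup>2, 0)\<bar>" for y
  proof -
    have "folded_form W (0, y) - folded_form W (0, - y) = (2 * y * W (y\<^sup>2, 0)) *\<^sub>R axis 3 1"
      by (simp add: folded_form_def vector3_eq_iff axis_def)
    then show ?thesis by (simp add: abs_mult norm_axis_1)
  qed
  have e: "\<forall>\<^sub>F y in nhds 0. T y = \<psi>3 (folded_form W (0, y))"
    using eventually_nhds_slice(2)[OF *(11)] by (simp add: T_def S1_function_def)
  have e': "\<forall>\<^sub>F y in nhds (0::real). T (- y) = \<psi>3 (folded_form W (0, - y))"
    by (rule eventually_nhds_along[where f = uminus]) (use e in auto)
  have "((\<lambda>z. W (z, 0) / z) \<longlongrightarrow> 0) (at 0)" using slope_at_origin(1)[OF W W0(1)] W0 by simp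
  then have "((\<lambda>y. W (y\<^sup>2, 0) / y\<^sup>2) \<longlongrightarrow> 0) (at 0)"
    by (rule filterlim_compose) (auto intro!: filterlim_atI tendsto_eq_intros simp: eventually_at_filter)
  then have "((\<lambda>y. L * (2 * \<bar>W (y\<^sup>2, 0) / y\<^sup>2\<bar>)) \<longlongrightarrow> L * (2 * \<bar>0\<bar>)) (at 0)"
    by (intro tendsto_mult tendsto_const tendsto_rabs)
  then have small: "((\<lambda>y. L * (2 * \<bar>W (y\<^sup>2, 0) / y\<^sup>2\<bar>)) \<longlongrightarrow> 0) (at 0)" by simp
  have "\<forall>\<^sub>F y in nhds 0. norm ((T y - T (- y)) / y ^ 3) \<le> L * (2 * \<bar>W (y\<^sup>2, 0) / y\<^sup>2\<bar>)"
    using L(2) e e'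
  proof eventually_elim
    case (elim y)
    have "\<bar>T y - T (- y)\<bar> \<le> L * (2 * \<bar>y\<bar> * \<bar>W (y\<^sup>2, 0)\<bar>)" using elim n by simp
    then have "\<bar>T y - T (- y)\<bar> / \<bar>y\<bar> ^ 3 \<le> L * (2 * \<bar>y\<bar> * \<bar>W (y\<^sup>2, 0)\<bar>) / \<bar>y\<bar> ^ 3"
      by (rule divide_right_mono) simp
    also have "\<dots> = L * (2 * \<bar>W (y\<^sup>2, 0) / y\<^sup>2\<bar>)"
      by (cases "y = 0") (simp_all add: power3_eq_cube power2_eq_square abs_divide abs_mult)
    finally show ?case by (simp add: abs_divide power_abs)
  qed
  then have "\<forall>\<^sub>F y in at 0. norm ((T y - T (- y)) / y ^ 3) \<le> L * (2 * \<bar>W (y\<^sup>2, 0) / y\<^sup>2\<bar>)"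
    by (simp add: eventually_nhds_conv_at)
  then have "((\<lambda>y. (T y - T (- y)) / y ^ 3) \<longlongrightarrow> 0) (at 0)"
    using small by (rule Lim_null_comparison)
  then have "\<delta> * (pdv Y (0, 0)) ^ 3 + \<delta> * (pdv Y (0, 0)) ^ 3 = 0" by (rule LIM_unique[OF lim])
  then show False using \<delta> Yv by simp
qed

text \<open>\<open>S\<^sub>1\<^sup>+\<close> is injective, while \<open>S\<^sub>1\<^sup>-\<close> identifies \<open>(t, t)\<close> with \<open>(t, -t)\<close>.\<close>

lemma S1_minus_not_S1_plus:
  "\<not> A_equivalent (folded_form (S1_function (-1))) (0, 0) (folded_form (S1_function 1)) (0, 0)"
proof
  assume "A_equivalent (folded_form (S1_function (-1))) (0, 0) (folded_form (S1_function 1)) (0, 0)"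
  then obtain \<phi> \<phi>' \<psi> \<psi>' where 1: "inverse_germs (0, 0) \<phi> \<phi>'"
    "\<forall>\<^sub>F x in nhds (0, 0). \<psi> (folded_form (S1_function (-1)) x) = folded_form (S1_function 1) (\<phi> x)"
    by (auto simp: A_equivalent_iff)
  have "\<forall>\<^sub>F x in nhds (0, 0). \<phi>' (\<phi> x) = x" using 1 by (simp add: inverse_germs_def)
  with 1(2) have "\<forall>\<^sub>F x in nhds (0, 0). \<psi> (folded_form (S1_function (-1)) x) = folded_form (S1_function 1) (\<phi> x) \<and> \<phi>' (\<phi> x) = x"
    by (rule eventually_conj)
  then obtain r where r: "r > 0" "\<And>x y. \<bar>x\<bar> < r \<Longrightarrow> \<bar>y\<bar> < r \<Longrightarrow>
      \<psi> (folded_form (S1_function (-1)) (x, y)) = folded_form (S1_function 1) (\<phi> (x, y)) \<and> \<phi>' (\<phi> (x, y)) = (x, y)"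
    unfolding eventually_nhds_box by blast
  have inj: "p = q" if pq: "folded_form (S1_function 1) p = folded_form (S1_function 1) q" for p q
  proof -
    have f: "fst p = fst q" using arg_cong[OF pq, of "\<lambda>P. P $ 1"] by (simp add: folded_form_def)
    have s: "(snd p)\<^sup>2 = (snd q)\<^sup>2" using arg_cong[OF pq, of "\<lambda>P. P $ 2"] by (simp add: folded_form_def)
    have t: "snd p * ((fst p)\<^sup>2 + (snd p)\<^sup>2) = snd q * ((fst q)\<^sup>2 + (snd q)\<^sup>2)"
      using arg_cong[OF pq, of "\<lambda>P. P $ 3"]
      by (simp only: folded_form_def vector3_nth S1_function_def fst_conv snd_conv mult_1)
    have "snd p = snd q"
    proof (cases "(fst q)\<^sup>2 + (snd q)\<^sup>2 = 0")
      case True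
      then have "(snd q)\<^sup>2 = 0" by (simp add: add_nonneg_eq_0_iff)
      then show ?thesis using s by simp
    next
      case False
      have "snd p * ((fst q)\<^sup>2 + (snd q)\<^sup>2) = snd q * ((fst q)\<^sup>2 + (snd q)\<^sup>2)"
        using t unfolding f s .
      then show ?thesis by (rule mult_right_cancel[OF False, THEN iffD1])
    qed
    with f show ?thesis by (simp add: prod_eq_iff)
  qed
  define t where "t = r / 2"
  have t: "0 < t" "\<bar>t\<bar> < r" "\<bar>- t\<bar> < r" using r by (auto simp: t_def)
  have "folded_form (S1_function (-1)) (t, t) = folded_form (S1_function (-1)) (t, - t)"
    by (simp add: folded_form_def S1_function_def)
  then have "folded_form (S1_function 1) (\<phi> (t, t)) = folded_form (S1_function 1) (\<phi> (t, - t))"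
    using r(2)[OF t(2,2)] r(2)[OF t(2,3)] by metis
  then have "\<phi> (t, t) = \<phi> (t, - t)" by (rule inj)
  then have "(t, t) = (t, - t)" using r(2)[OF t(2,2)] r(2)[OF t(2,3)] by metis
  then show False using t by simp
qed

lemma S1_not_cross_cap:
  "\<not> A_equivalent (folded_form (S1_function \<delta>)) (0, 0) (folded_form snd) (0, 0)"
proof (rule not_cross_cap_folded_form[OF smooth_near_S1_function])
  have "S1_function \<delta> (0, x) / x = x" for x by (cases "x = 0") (simp_all add: S1_function_def power2_eq_square)
  then show "((\<lambda>x. S1_function \<delta> (0, x) / x) \<longlongrightarrow> 0) (at 0)" by simp
qed

section \<open>Families of lines over a coordinate\<close>

lemma smooth_near_deriv:
  fixes f :: "real \<Rightarrow> real"
  assumes "smooth_near t f"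
  shows "(f has_field_derivative deriv f t) (at t)" "smooth_near t (deriv f)"
proof -
  have D: "(f has_field_derivative frechet_derivative f (at x) 1) (at x)" if "smooth_near x f" for x
  proof -
    have d: "(f has_derivative frechet_derivative f (at x)) (at x)" by (rule smooth_near_has_derivative[OF that])
    have eq: "(*) (frechet_derivative f (at x) 1) = frechet_derivative f (at x)"
    proof
      fix t show "frechet_derivative f (at x) 1 * t = frechet_derivative f (at x) t"
        using linear_cmul[OF has_derivative_linear[OF d], of t 1] by simp
    qed
    show ?thesis unfolding has_field_derivative_def eq by (rule d)
  qed
  show "(f has_field_derivative deriv f t) (at t)" using D[OF assms] DERIV_imp_deriv[OF D[OF assms]] by simp
  have "\<forall>\<^sub>F x in nhds t. frechet_derivative f (at x) 1 = deriv f x"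
    using smooth_near_eventually[OF assms] by eventually_elim (rule DERIV_imp_deriv[OF D, symmetric])
  then show "smooth_near t (deriv f)" by (rule smooth_near_cong[OF smooth_near_derivative[OF assms]])
qed

lemma linear_factor:
  fixes f :: "real \<Rightarrow> real"
  assumes "(f has_field_derivative d) (at 0)" "f 0 = 0"
  obtains g where "isCont g 0" "g 0 = d" "\<forall>s. f s = s * g s"
proof -
  obtain g where "\<forall>z. f z - f 0 = g z * (z - 0)" "isCont g 0" "g 0 = d"
    using assms(1) unfolding CARAT_DERIV by blast
  then have "isCont g 0" "g 0 = d" "\<forall>s. f s = s * g s" using assms(2) by (auto simp: mult.commute)
  then show thesis by (rule that)
qed

text \<open>By l'Hopital's rule a factor \<open>s\<^sup>n\<close> of the derivative gives a factor \<open>s\<^sup>n\<^sup>+\<^sup>1\<close> of the function. When repeated, this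
  factors powers of \<open>s\<close> out of functions, which makes composition with other functions that vanish at \<open>0\<close> easy.\<close>

lemma integrate_factor:
  fixes f g :: "real \<Rightarrow> real"
  assumes "\<forall>\<^sub>F s in nhds 0. (f has_field_derivative s ^ n * g s) (at s)" "isCont g 0" "f 0 = 0"
  obtains G where "isCont G 0" "G 0 = g 0 / (n + 1)" "\<forall>s. f s = s ^ (n + 1) * G s"
proof -
  have D: "\<forall>\<^sub>F s in at 0. (f has_field_derivative s ^ n * g s) (at s)"
    using assms(1) by (simp add: eventually_nhds_conv_at)
  have nz: "\<forall>\<^sub>F s in at 0. s \<noteq> (0::real)" by (rule eventually_neq_at_within)
  have "isCont f 0" using eventually_nhds_x_imp_x[OF assms(1)] DERIV_isCont by blast
  then have f0: "(f \<longlongrightarrow> 0) (at 0)" using assms(3) by (simp add: isCont_def)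
  have "((\<lambda>s. f s / s ^ (n + 1)) \<longlongrightarrow> g 0 / (n + 1)) (at 0)"
  proof (rule lhopital[OF f0])
    have "((\<lambda>s::real. s ^ (n + 1)) \<longlongrightarrow> 0 ^ (n + 1)) (at 0)" by (intro tendsto_intros)
    then show "((\<lambda>s::real. s ^ (n + 1)) \<longlongrightarrow> 0) (at 0)" by simp
    show "\<forall>\<^sub>F s in at 0. s ^ (n + 1) \<noteq> (0::real)" using nz by eventually_elim simp
    show "\<forall>\<^sub>F s in at 0. (real n + 1) * s ^ n \<noteq> 0" using nz by eventually_elim simp
    show "\<forall>\<^sub>F s in at 0. (f has_field_derivative s ^ n * g s) (at s)" by (rule D)
    show "\<forall>\<^sub>F s in at 0. ((\<lambda>s. s ^ (n + 1)) has_field_derivative (real n + 1) * s ^ n) (at s)"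
    proof (rule always_eventually, rule allI)
      fix s :: real
      show "((\<lambda>s. s ^ (n + 1)) has_field_derivative (real n + 1) * s ^ n) (at s)"
        using DERIV_pow[of "n + 1" s UNIV] by (simp add: add.commute)
    qed
    have "((\<lambda>s. g s / (real n + 1)) \<longlongrightarrow> g 0 / (real n + 1)) (at 0)"
      using assms(2) by (intro tendsto_intros) (auto simp: isCont_def)
    moreover have ev: "\<forall>\<^sub>F s in at 0. s ^ n * g s / ((real n + 1) * s ^ n) = g s / (real n + 1)"
      using nz
    proof eventually_elim
      case (elim s)
      then show ?case using nonzero_mult_divide_mult_cancel_left[of "s ^ n" "g s" "real n + 1"] by (simp add: mult.commute)
    qed
    ultimately show "((\<lambda>s. s ^ n * g s / ((real n + 1) * s ^ n)) \<longlongrightarrow> g 0 / (n + 1)) (at 0)"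
      unfolding tendsto_cong[OF ev] by (simp add: add.commute)
  qed
  then have lim: "((\<lambda>s. f s / s ^ (n + 1)) \<longlongrightarrow> g 0 / (n + 1)) (at 0)" .
  define G where "G s = (if s = 0 then g 0 / (n + 1) else f s / s ^ (n + 1))" for s
  show thesis
  proof (rule that)
    have "(G \<longlongrightarrow> g 0 / (n + 1)) (at 0)"
      using lim by (subst LIM_equal[where g = "\<lambda>s. f s / s ^ (n + 1)"]) (simp_all add: G_def)
    then show "isCont G 0" by (simp add: isCont_def G_def)
    show "G 0 = g 0 / (n + 1)" by (simp add: G_def)
    show "\<forall>s. f s = s ^ (n + 1) * G s" using assms(3) by (simp add: G_def)
  qed
qed

lemma quadratic_factor:
  fixes f :: "real \<Rightarrow> real"
  assumes f: "smooth_near 0 f" and "f 0 = 0" "deriv f 0 = 0"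
  obtains G where "isCont G 0" "G 0 = deriv (deriv f) 0 / 2" "\<forall>s. f s = s\<^sup>2 * G s"
proof -
  obtain g where g: "isCont g 0" "g 0 = deriv (deriv f) 0" "\<forall>s. deriv f s = s * g s"
    by (rule linear_factor[OF smooth_near_deriv(1)[OF smooth_near_deriv(2)[OF f]] assms(3)])
  have "\<forall>\<^sub>F s in nhds 0. (f has_field_derivative s ^ 1 * g s) (at s)"
    using smooth_near_eventually[OF f]
  proof eventually_elim
    case (elim s)
    then show ?case using smooth_near_deriv(1)[OF elim] g(3) by simp
  qed
  then obtain G where G: "isCont G 0" "G 0 = g 0 / (1 + 1)" "\<forall>s. f s = s ^ (1 + 1) * G s"
    using integrate_factor[of f 1 g] g(1) assms(2) by auto
  show thesis by (rule that[of G]) (use G g in \<open>simp_all add: power2_eq_square\<close>)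
qed

lemma cubic_factor:
  fixes f :: "real \<Rightarrow> real"
  assumes f: "smooth_near 0 f" and "f 0 = 0" "deriv f 0 = 0" "deriv (deriv f) 0 = 0"
  obtains G where "isCont G 0" "G 0 = deriv (deriv (deriv f)) 0 / 6" "\<forall>s. f s = s ^ 3 * G s"
proof -
  obtain g where g: "isCont g 0" "g 0 = deriv (deriv (deriv f)) 0 / 2" "\<forall>s. deriv f s = s\<^sup>2 * g s"
    by (rule quadratic_factor[OF smooth_near_deriv(2)[OF f] assms(3,4)])
  have "\<forall>\<^sub>F s in nhds 0. (f has_field_derivative s ^ 2 * g s) (at s)"
    using smooth_near_eventually[OF f]
  proof eventually_elim
    case (elim s)
    then show ?case using smooth_near_deriv(1)[OF elim] g(3) by simp
  qed
  then obtain G where G: "isCont G 0" "G 0 = g 0 / (2 + 1)" "\<forall>s. f s = s ^ (2 + 1) * G s"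
    using integrate_factor[of f 2 g] g(1) assms(2) by auto
  show thesis by (rule that[of G]) (use G g in \<open>simp_all add: power3_eq_cube eval_nat_numeral\<close>)
qed

lemma smooth_near_line_family:
  fixes a0 a1 :: "real \<Rightarrow> real"
  assumes "smooth_near 0 a0" "smooth_near 0 a1"
  shows "smooth_near (0, 0) (\<lambda>q. a0 (snd q) + fst q * a1 (snd q))"
proof -
  have "smooth_near (0, 0) (\<lambda>q::real\<times>real. a0 (snd q))" "smooth_near (0, 0) (\<lambda>q::real\<times>real. a1 (snd q))"
    using smooth_near_compose[where g = snd and p = "(0::real, 0::real)", OF _ smooth_near_snd] assms by auto
  then show ?thesis by (intro smooth_near_add smooth_near_mult smooth_near_fst)
qed

lemma pdv_line_family:
  fixes a0 a1 :: "real \<Rightarrow> real"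
  assumes "smooth_near 0 a0" "smooth_near 0 a1"
  shows "\<forall>\<^sub>F q in nhds (0, 0). pdv (\<lambda>q. a0 (snd q) + fst q * a1 (snd q)) q = deriv a0 (snd q) + fst q * deriv a1 (snd q)"
proof -
  have e: "\<forall>\<^sub>F q in nhds (0::real, 0::real). smooth_near (snd q) a0" "\<forall>\<^sub>F q in nhds (0::real, 0::real). smooth_near (snd q) a1"
    by (rule eventually_nhds_along[where f = snd]; use smooth_near_eventually[OF assms(1)] smooth_near_eventually[OF assms(2)] in simp)+
  from e smooth_near_eventually[OF smooth_near_line_family[OF assms]] show ?thesis
  proof eventually_elim
    case (elim q)
    obtain x s where q: "q = (x, s)" by force
    have "((\<lambda>s. a0 s + x * a1 s) has_field_derivative deriv a0 s + x * deriv a1 s) (at s)"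
      using smooth_near_deriv(1)[OF elim(1)] smooth_near_deriv(1)[OF elim(2)] q by (auto intro!: derivative_eq_intros)
    moreover have "((\<lambda>s. a0 s + x * a1 s) has_field_derivative pdv (\<lambda>q. a0 (snd q) + fst q * a1 (snd q)) (x, s)) (at s)"
      using DERIV_pdv[of x s "\<lambda>q. a0 (snd q) + fst q * a1 (snd q)"] elim(3) q by simp
    ultimately show ?case unfolding q snd_conv fst_conv by (rule DERIV_unique[rotated])
  qed
qed

text \<open>The normal form of a family of lines whose first component function has a fold. The curve \<open>\<sigma> (x, 0)\<close> of critical points
  has slope \<open>-a\<^sub>1'/a\<^sub>0''\<close>.\<close>

lemma line_family_fold:
  fixes a0 a1 b0 b1 :: "real \<Rightarrow> real"
  assumes s: "smooth_near 0 a0" "smooth_near 0 a1" "smooth_near 0 b0" "smooth_near 0 b1"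
    and crit: "deriv a0 0 = 0" and nd: "deriv (deriv a0) 0 \<noteq> 0"
  obtains \<sigma> W where "smooth_near (0, 0) \<sigma>" "\<sigma> (0, 0) = 0" "pdv \<sigma> (0, 0) > 0"
    "((\<lambda>x. \<sigma> (x, 0)) has_field_derivative - deriv a1 0 / deriv (deriv a0) 0) (at 0)"
    "smooth_near (0, 0) W"
    "\<forall>\<^sub>F x in nhds 0. W (0, x) = (deriv b0 (\<sigma> (x, 0)) + x * deriv b1 (\<sigma> (x, 0))) * pdv \<sigma> (x, 0)"
    "\<forall>\<^sub>F y in nhds 0. b0 (\<sigma> (0, y)) - b0 (\<sigma> (0, - y)) = 2 * y * W (y\<^sup>2, 0)"
    "A_equivalent (\<lambda>q. vector [fst q, a0 (snd q) + fst q * a1 (snd q), b0 (snd q) + fst q * b1 (snd q)]) (0, 0) (folded_form W) (0, 0)"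
proof -
  define A where "A = (\<lambda>q. a0 (snd q) + fst q * a1 (snd q))"
  define B where "B = (\<lambda>q. b0 (snd q) + fst q * b1 (snd q))"
  have A: "smooth_near (0, 0) A" and B: "smooth_near (0, 0) B"
    unfolding A_def B_def by (intro smooth_near_line_family s)+
  have Av: "\<forall>\<^sub>F q in nhds (0, 0). pdv A q = deriv a0 (snd q) + fst q * deriv a1 (snd q)"
    and Bv: "\<forall>\<^sub>F q in nhds (0, 0). pdv B q = deriv b0 (snd q) + fst q * deriv b1 (snd q)"
    unfolding A_def B_def by (intro pdv_line_family s)+
  have Av0: "pdv A (0, 0) = 0" using eventually_nhds_x_imp_x[OF Av] crit by simp
  have "pdv (pdv A) (0, 0) = deriv (deriv a0) 0"
  proof -
    have "\<forall>\<^sub>F y in nhds 0. pdv A (0, y) = deriv a0 (snd (0::real, y)) + fst (0::real, y) * deriv a1 (snd (0::real, y))"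
      by (rule eventually_nhds_slice(2)[OF Av])
    then have e: "\<forall>\<^sub>F y in nhds 0. pdv A (0, y) = deriv a0 y" by simp
    have "((\<lambda>y. pdv A (0, y)) has_field_derivative deriv (deriv a0) 0) (at 0)"
      by (subst DERIV_cong_ev[OF refl e refl]) (rule smooth_near_deriv(1)[OF smooth_near_deriv(2)[OF s(1)]])
    then show ?thesis by (rule DERIV_unique[OF DERIV_pdv[OF smooth_near_pdv[OF A]]])
  qed
  then have Avv: "pdv (pdv A) (0, 0) \<noteq> 0" using nd by simp
  obtain \<sigma> W where n: "smooth_near (0, 0) \<sigma>" "\<sigma> (0, 0) = 0" "pdv \<sigma> (0, 0) > 0"
    "\<forall>\<^sub>F x in nhds 0. pdv A (x, \<sigma> (x, 0)) = 0"
    "smooth_near (0, 0) W"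
    "\<forall>\<^sub>F q in nhds (0, 0). B (fst q, \<sigma> q) - B (fst q, \<sigma> (fst q, - snd q)) = 2 * snd q * W ((snd q)\<^sup>2, fst q)"
    "A_equivalent (folded_form W) (0, 0) (\<lambda>q. vector [fst q, A q, B q]) (0, 0)"
    by (rule fold_normal_form[OF A B Av0 Avv])
  define u where "u x = \<sigma> (x, 0)" for x
  have u0: "u 0 = 0" using n by (simp add: u_def)
  have su: "smooth_near 0 u"
    unfolding u_def by (rule smooth_near_compose[OF _ smooth_near_slice]) (use n(1) in simp)
  have du: "(u has_field_derivative deriv u 0) (at 0)" by (rule smooth_near_deriv(1)[OF su])
  have cu: "isCont (\<lambda>x. (x, u x)) 0" using smooth_near_isCont[OF su] by (intro continuous_intros)
  have along: "\<forall>\<^sub>F x in nhds 0. P (x, u x)" if "\<forall>\<^sub>F q in nhds (0, 0). P q" for P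
    by (rule eventually_nhds_along[OF cu]) (use that u0 in simp)
  have slope: "deriv u 0 = - deriv a1 0 / deriv (deriv a0) 0"
  proof -
    have "((\<lambda>x. deriv a0 (u x)) has_field_derivative deriv (deriv a0) (u 0) * deriv u 0) (at 0)"
      by (rule DERIV_chain2[OF _ du]) (use smooth_near_deriv(1)[OF smooth_near_deriv(2)[OF s(1)]] u0 in simp)
    moreover have "((\<lambda>x. deriv a1 (u x)) has_field_derivative deriv (deriv a1) (u 0) * deriv u 0) (at 0)"
      by (rule DERIV_chain2[OF _ du]) (use smooth_near_deriv(1)[OF smooth_near_deriv(2)[OF s(2)]] u0 in simp)
    ultimately have "((\<lambda>x. deriv a0 (u x) + x * deriv a1 (u x)) has_field_derivative
        deriv (deriv a0) (u 0) * deriv u 0 + (1 * deriv a1 (u 0) + deriv (deriv a1) (u 0) * deriv u 0 * 0)) (at 0)"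
      by (intro DERIV_add DERIV_mult DERIV_ident)
    moreover have "\<forall>\<^sub>F x in nhds 0. deriv a0 (u x) + x * deriv a1 (u x) = 0"
      using along[OF Av] n(4) by eventually_elim (simp add: u_def)
    then have "((\<lambda>x. deriv a0 (u x) + x * deriv a1 (u x)) has_field_derivative 0) (at 0)"
      by (subst DERIV_cong_ev[OF refl _ refl]) auto
    ultimately have "deriv (deriv a0) (u 0) * deriv u 0 + (1 * deriv a1 (u 0) + deriv (deriv a1) (u 0) * deriv u 0 * 0) = 0"
      by (rule DERIV_unique)
    then show ?thesis using nd u0 by (simp add: field_simps)
  qed
  have W0: "\<forall>\<^sub>F x in nhds 0. W (0, x) = (deriv b0 (u x) + x * deriv b1 (u x)) * pdv \<sigma> (x, 0)"
  proof -
    have 1: "\<forall>\<^sub>F x in nhds 0. \<forall>\<^sub>F q in nhds (x, 0). B (fst q, \<sigma> q) - B (fst q, \<sigma> (fst q, - snd q)) = 2 * snd q * W ((snd q)\<^sup>2, fst q)"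
      by (rule eventually_nhds_slice(1)) (use n(6) in \<open>simp add: eventually_eventually\<close>)
    have 2: "\<forall>\<^sub>F x in nhds 0. smooth_near (0, x) W" by (rule eventually_nhds_slice(2)[OF smooth_near_eventually[OF n(5)]])
    have 3: "\<forall>\<^sub>F x in nhds 0. smooth_near (x, 0) \<sigma>" by (rule eventually_nhds_slice(1)[OF smooth_near_eventually[OF n(1)]])
    from 1 2 3 along[OF smooth_near_eventually[OF B]] along[OF Bv] show ?thesis
    proof eventually_elim
      case (elim x)
      have d: "((\<lambda>y. B (x, \<sigma> (x, y))) has_field_derivative pdv B (x, u x) * pdv \<sigma> (x, 0)) (at 0)"
        by (rule DERIV_chain2[of "\<lambda>y. B (x, y)"]) (use DERIV_pdv[OF elim(4)] DERIV_pdv[OF elim(3)] in \<open>simp_all add: u_def\<close>)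
      have "((\<lambda>y. B (x, \<sigma> (x, - y))) has_field_derivative pdv B (x, u x) * pdv \<sigma> (x, 0) * (-1)) (at 0)"
        by (rule DERIV_chain2[of "\<lambda>y. B (x, \<sigma> (x, y))"]) (use d in \<open>auto intro!: derivative_eq_intros\<close>)
      from DERIV_diff[OF d this]
      have d1: "((\<lambda>y. B (x, \<sigma> (x, y)) - B (x, \<sigma> (x, - y))) has_field_derivative 2 * (pdv B (x, u x) * pdv \<sigma> (x, 0))) (at 0)"
        by (simp add: mult.commute)
      have "((\<lambda>y. W (y\<^sup>2, x)) has_field_derivative (2 * 0) * pdu W (0\<^sup>2, x) + 0 * pdv W (0\<^sup>2, x)) (at 0)"
        by (rule DERIV_along_curve) (use elim(2) in \<open>auto intro!: derivative_eq_intros\<close>)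
      then have d2: "((\<lambda>y. 2 * y * W (y\<^sup>2, x)) has_field_derivative 2 * W (0, x)) (at 0)"
        by (auto intro!: derivative_eq_intros)
      have e: "\<forall>\<^sub>F y in nhds 0. B (x, \<sigma> (x, y)) - B (x, \<sigma> (x, - y)) = 2 * y * W (y\<^sup>2, x)"
        using eventually_nhds_slice(2)[OF elim(1)] by simp
      have "((\<lambda>y. B (x, \<sigma> (x, y)) - B (x, \<sigma> (x, - y))) has_field_derivative 2 * W (0, x)) (at 0)"
        by (subst DERIV_cong_ev[OF refl e refl]) (rule d2)
      then have "2 * W (0, x) = 2 * (pdv B (x, u x) * pdv \<sigma> (x, 0))" using d1 by (rule DERIV_unique)
      then show ?case using elim(5) by simp
    qed
  qed
  have Wz: "\<forall>\<^sub>F y in nhds 0. b0 (\<sigma> (0, y)) - b0 (\<sigma> (0, - y)) = 2 * y * W (y\<^sup>2, 0)"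
    using eventually_nhds_slice(2)[OF n(6)] by (simp add: B_def)
  have "A_equivalent (\<lambda>q. vector [fst q, A q, B q]) (0, 0) (folded_form W) (0, 0)"
    by (rule A_equivalent_sym[OF n(7) smooth_near_isCont[OF smooth_near_folded_form[OF n(5)]]])
  then show thesis
    using that[OF n(1-3) _ n(5) W0[unfolded u_def] Wz] du slope by (simp add: A_def B_def u_def[abs_def])
qed

text \<open>Here the third component has the fold, so it takes the place of the second one, and the linear term \<open>y\<^sub>1'(0) x s\<close> of the other
  component gives \<open>W\<close> a nonzero derivative.\<close>

lemma line_family_cross_cap:
  fixes y0 y1 z0 z1 :: "real \<Rightarrow> real"
  assumes s: "smooth_near 0 y0" "smooth_near 0 y1" "smooth_near 0 z0" "smooth_near 0 z1"
    and y: "deriv y0 0 = 0" "deriv y1 0 \<noteq> 0"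
    and z: "deriv z0 0 = 0" "deriv z1 0 = 0" "deriv (deriv z0) 0 \<noteq> 0"
  shows "A_equivalent (\<lambda>q. vector [fst q, y0 (snd q) + fst q * y1 (snd q), z0 (snd q) + fst q * z1 (snd q)]) (0, 0)
    (folded_form snd) (0, 0)"
proof -
  obtain \<sigma> W where n: "smooth_near (0, 0) \<sigma>" "\<sigma> (0, 0) = 0" "pdv \<sigma> (0, 0) > 0"
    "((\<lambda>x. \<sigma> (x, 0)) has_field_derivative - deriv z1 0 / deriv (deriv z0) 0) (at 0)"
    "smooth_near (0, 0) W"
    "\<forall>\<^sub>F x in nhds 0. W (0, x) = (deriv y0 (\<sigma> (x, 0)) + x * deriv y1 (\<sigma> (x, 0))) * pdv \<sigma> (x, 0)"
    "\<forall>\<^sub>F y in nhds 0. y0 (\<sigma> (0, y)) - y0 (\<sigma> (0, - y)) = 2 * y * W (y\<^sup>2, 0)"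
    "A_equivalent (\<lambda>q. vector [fst q, z0 (snd q) + fst q * z1 (snd q), y0 (snd q) + fst q * y1 (snd q)]) (0, 0) (folded_form W) (0, 0)"
    by (rule line_family_fold[OF s(3,4,1,2) z(1,3)])
  define u where "u x = \<sigma> (x, 0)" for x
  have u0: "u 0 = 0" using n by (simp add: u_def)
  have du: "(u has_field_derivative 0) (at 0)" using n(4) z by (simp add: u_def[abs_def])
  have W0: "W (0, 0) = 0" using eventually_nhds_x_imp_x[OF n(6)] n(2) y by simp
  have d1: "((\<lambda>x. deriv y0 (u x)) has_field_derivative deriv (deriv y0) (u 0) * 0) (at 0)"
    by (rule DERIV_chain2[OF _ du]) (use smooth_near_deriv(1)[OF smooth_near_deriv(2)[OF s(1)]] u0 in simp)
  have d2: "((\<lambda>x. deriv y1 (u x)) has_field_derivative deriv (deriv y1) (u 0) * 0) (at 0)"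
    by (rule DERIV_chain2[OF _ du]) (use smooth_near_deriv(1)[OF smooth_near_deriv(2)[OF s(2)]] u0 in simp)
  have d3: "((\<lambda>x. pdv \<sigma> (x, 0)) has_field_derivative pdu (pdv \<sigma>) (0, 0)) (at 0)"
    by (rule DERIV_pdu[OF smooth_near_pdv[OF n(1)]])
  have "((\<lambda>x. (deriv y0 (u x) + x * deriv y1 (u x)) * pdv \<sigma> (x, 0)) has_field_derivative deriv y1 0 * pdv \<sigma> (0, 0)) (at 0)"
    using d1 d2 d3 u0 y by (auto intro!: derivative_eq_intros)
  moreover have e: "\<forall>\<^sub>F x in nhds 0. W (0, x) = (deriv y0 (u x) + x * deriv y1 (u x)) * pdv \<sigma> (x, 0)"
    using n(6) by (simp add: u_def)
  ultimately have "((\<lambda>x. W (0, x)) has_field_derivative deriv y1 0 * pdv \<sigma> (0, 0)) (at 0)"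
    by (subst DERIV_cong_ev[OF refl e refl])
  then have "pdv W (0, 0) = deriv y1 0 * pdv \<sigma> (0, 0)" by (rule DERIV_unique[OF DERIV_pdv[OF n(5)]])
  then have "pdv W (0, 0) \<noteq> 0" using y n(3) by simp
  from A_equivalent_trans[OF A_equivalent_swap_components
      A_equivalent_trans[OF n(8) folded_form_cross_cap[OF n(5) W0 this]]]
  show ?thesis .
qed

lemma line_family_degenerate:
  fixes y0 y1 z0 z1 :: "real \<Rightarrow> real"
  assumes s: "smooth_near 0 y0" "smooth_near 0 y1" "smooth_near 0 z0" "smooth_near 0 z1"
    and y: "y0 0 = 0" "deriv y0 0 = 0" "deriv (deriv y0) 0 = 0"
    and z: "z0 0 = 0" "deriv z0 0 = 0" "deriv (deriv z0) 0 = 0"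
  shows "\<not> A_equivalent (\<lambda>q. vector [fst q, y0 (snd q) + fst q * y1 (snd q), z0 (snd q) + fst q * z1 (snd q)]) (0, 0)
    (folded_form V) (0, 0)"
proof (rule not_equivalent_to_folded_form)
  let ?F = "\<lambda>q. vector [fst q, y0 (snd q) + fst q * y1 (snd q), z0 (snd q) + fst q * z1 (snd q)] :: real^3"
  show "isCont ?F (0, 0)"
    by (intro smooth_near_isCont smooth_near_vector3 smooth_near_fst smooth_near_line_family s)
  obtain G where G: "isCont G 0" "G 0 = deriv (deriv y0) 0 / 2" "\<forall>s. y0 s = s\<^sup>2 * G s"
    by (rule quadratic_factor[OF s(1) y(1,2)])
  obtain H where H: "isCont H 0" "H 0 = deriv (deriv z0) 0 / 2" "\<forall>s. z0 s = s\<^sup>2 * H s"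
    by (rule quadratic_factor[OF s(3) z(1,2)])
  have "?F (0, t) - ?F (0, 0) = t\<^sup>2 *\<^sub>R vector [0, G t, H t]" for t
    using G(3) H(3) y z by (simp add: vector3_eq_iff)
  then have n: "norm (?F (0, t) - ?F (0, 0)) / t\<^sup>2 = norm (vector [0, G t, H t] :: real^3)" if "t \<noteq> 0" for t
    using that by simp
  have "(vector [0, G t, H t] :: real^3) = G t *\<^sub>R vector [0, 1, 0] + H t *\<^sub>R vector [0, 0, 1]" for t
    by (simp add: vector3_eq_iff)
  moreover have "((\<lambda>t. norm (G t *\<^sub>R vector [0, 1, 0] + H t *\<^sub>R vector [0, 0, 1] :: real^3)) \<longlongrightarrow>
      norm (G 0 *\<^sub>R vector [0, 1, 0] + H 0 *\<^sub>R vector [0, 0, 1] :: real^3)) (at 0)"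
    using G(1) H(1) by (intro tendsto_intros) (simp_all add: isCont_def)
  ultimately have "((\<lambda>t. norm (vector [0, G t, H t] :: real^3)) \<longlongrightarrow> 0) (at 0)"
    using G(2) H(2) y z by simp
  then show "((\<lambda>t. norm (?F (0, t) - ?F (0, 0)) / t\<^sup>2) \<longlongrightarrow> 0) (at 0)"
    by (subst LIM_equal[where g = "\<lambda>t. norm (vector [0, G t, H t] :: real^3)"]) (use n in simp_all)
qed

text \<open>The coefficients of \<open>z\<close> and of \<open>x\<^sup>2\<close> in \<open>W (z, x)\<close> are positive multiples of the two factors \<open>z\<^sub>0'''\<close> and \<open>m (z\<^sub>0''' m + 2 z\<^sub>1'')\<close>
  of \<open>d\<close>, where \<open>m\<close> is the slope of the curve of critical points of the second component.\<close>

lemma line_family_S1: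
  fixes y0 y1 z0 z1 :: "real \<Rightarrow> real"
  assumes s: "smooth_near 0 y0" "smooth_near 0 y1" "smooth_near 0 z0" "smooth_near 0 z1"
    and y: "deriv y0 0 = 0" "deriv (deriv y0) 0 \<noteq> 0"
    and z: "z0 0 = 0" "deriv z0 0 = 0" "deriv z1 0 = 0" "deriv (deriv z0) 0 = 0"
    and m: "m = - deriv y1 0 / deriv (deriv y0) 0"
    and d: "d = deriv (deriv (deriv z0)) 0 * (m * (deriv (deriv (deriv z0)) 0 * m + 2 * deriv (deriv z1) 0))"
    and F: "F = (\<lambda>q. vector [fst q, y0 (snd q) + fst q * y1 (snd q), z0 (snd q) + fst q * z1 (snd q)])"
  shows "\<not> A_equivalent F (0, 0) (folded_form snd) (0, 0)"
    and "A_equivalent F (0, 0) (folded_form (S1_function 1)) (0, 0) \<longleftrightarrow> d > 0"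
    and "A_equivalent F (0, 0) (folded_form (S1_function (-1))) (0, 0) \<longleftrightarrow> d < 0"
proof -
  obtain \<sigma> W where n: "smooth_near (0, 0) \<sigma>" "\<sigma> (0, 0) = 0" "pdv \<sigma> (0, 0) > 0"
    "((\<lambda>x. \<sigma> (x, 0)) has_field_derivative - deriv y1 0 / deriv (deriv y0) 0) (at 0)"
    "smooth_near (0, 0) W"
    "\<forall>\<^sub>F x in nhds 0. W (0, x) = (deriv z0 (\<sigma> (x, 0)) + x * deriv z1 (\<sigma> (x, 0))) * pdv \<sigma> (x, 0)"
    "\<forall>\<^sub>F y in nhds 0. z0 (\<sigma> (0, y)) - z0 (\<sigma> (0, - y)) = 2 * y * W (y\<^sup>2, 0)"
    "A_equivalent (\<lambda>q. vector [fst q, y0 (snd q) + fst q * y1 (snd q), z0 (snd q) + fst q * z1 (snd q)]) (0, 0) (folded_form W) (0, 0)"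
    by (rule line_family_fold[OF s y])
  define p where "p = deriv (deriv (deriv z0)) 0"
  define q where "q = deriv (deriv z1) 0"
  define \<tau> where "\<tau> = pdv \<sigma> (0, 0)"
  define u where "u x = \<sigma> (x, 0)" for x
  have u0: "u 0 = 0" using n by (simp add: u_def)
  have du: "(u has_field_derivative m) (at 0)" using n(4) m by (simp add: u_def[abs_def])
  have cu: "isCont u 0" by (rule DERIV_isCont[OF du])
  obtain v where v: "isCont v 0" "v 0 = m" "\<forall>x. u x = x * v x"
    by (rule linear_factor[OF du u0])
  obtain g where g: "isCont g 0" "g 0 = deriv (deriv (deriv z0)) 0 / 2" "\<forall>s. deriv z0 s = s\<^sup>2 * g s"
    by (rule quadratic_factor[OF smooth_near_deriv(2)[OF s(3)] z(2,4)])
  obtain h where h: "isCont h 0" "h 0 = deriv (deriv z1) 0" "\<forall>s. deriv z1 s = s * h s"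
    by (rule linear_factor[OF smooth_near_deriv(1)[OF smooth_near_deriv(2)[OF s(4)]] z(3)])
  obtain G where G: "isCont G 0" "G 0 = deriv (deriv (deriv z0)) 0 / 6" "\<forall>s. z0 s = s ^ 3 * G s"
    by (rule cubic_factor[OF s(3) z(1,2,4)])
  have W00: "W (0, 0) = 0" using eventually_nhds_x_imp_x[OF n(6)] n(2) z by simp
  \<comment> \<open>the coefficient of \<open>x\<^sup>2\<close> in \<open>W\<close>\<close>
  define w where "w x = ((v x)\<^sup>2 * g (u x) + v x * h (u x)) * pdv \<sigma> (x, 0)" for x
  have Wx: "\<forall>\<^sub>F x in nhds 0. W (0, x) = x\<^sup>2 * w x"
    using n(6)
  proof eventually_elim
    case (elim x)
    have "W (0, x) = (deriv z0 (u x) + x * deriv z1 (u x)) * pdv \<sigma> (x, 0)" using elim by (simp add: u_def)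
    also have "deriv z0 (u x) = (x * v x)\<^sup>2 * g (u x)" using g(3) v(3) by metis
    also have "deriv z1 (u x) = (x * v x) * h (u x)" using h(3) v(3) by metis
    finally show ?case by (simp add: w_def power2_eq_square algebra_simps)
  qed
  have gu: "isCont (\<lambda>x. g (u x)) 0" "isCont (\<lambda>x. h (u x)) 0"
    using isCont_o2[OF cu, of g] isCont_o2[OF cu, of h] g(1) h(1) u0 by auto
  have "isCont (\<lambda>x. pdv \<sigma> (x, 0)) 0" by (rule DERIV_isCont[OF DERIV_pdu[OF smooth_near_pdv[OF n(1)]]])
  then have cw: "isCont w 0" unfolding w_def using gu v(1) by (intro continuous_intros)
  have w0: "w 0 = (m\<^sup>2 * p / 2 + m * q) * \<tau>" using v(2) g(2) h(2) u0 by (simp add: w_def p_def q_def \<tau>_def)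
  have Wlim: "((\<lambda>x. W (0, x) / x\<^sup>2) \<longlongrightarrow> w 0) (at 0)"
  proof -
    have "\<forall>\<^sub>F x in at 0. W (0, x) = x\<^sup>2 * w x" using Wx by (simp add: eventually_nhds_conv_at)
    moreover have "\<forall>\<^sub>F x in at 0. x \<noteq> (0::real)" by (rule eventually_neq_at_within)
    ultimately have e: "\<forall>\<^sub>F x in at 0. W (0, x) / x\<^sup>2 = w x" by eventually_elim simp
    show ?thesis unfolding tendsto_cong[OF e] using cw by (simp add: isCont_def)
  qed
  have Wlim1: "((\<lambda>x. W (0, x) / x) \<longlongrightarrow> 0) (at 0)"
  proof -
    have "((\<lambda>x. x * (W (0, x) / x\<^sup>2)) \<longlongrightarrow> 0 * w 0) (at 0)" by (intro tendsto_mult Wlim tendsto_ident_at)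
    then show ?thesis
      by (subst LIM_equal[where g = "\<lambda>x. x * (W (0, x) / x\<^sup>2)"]) (simp_all add: power2_eq_square)
  qed
  have Wv: "pdv W (0, 0) = 0" by (rule LIM_unique[OF slope_at_origin(2)[OF n(5) W00] Wlim1])
  have Wvv: "pdv (pdv W) (0, 0) = 2 * w 0"
  proof -
    obtain k where k: "isCont k 0" "k 0 = pdv (pdv W) (0, 0)" "\<forall>x. pdv W (0, x) = x * k x"
      by (rule linear_factor[OF DERIV_pdv[OF smooth_near_pdv[OF n(5)]] Wv])
    have "\<forall>\<^sub>F x in nhds 0. ((\<lambda>x. W (0, x)) has_field_derivative x ^ 1 * k x) (at x)"
      using eventually_nhds_slice(2)[OF smooth_near_eventually[OF n(5)]]
    proof eventually_elim
      case (elim x)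
      then show ?case using DERIV_pdv[OF elim] k(3) by simp
    qed
    then obtain K where K: "isCont K 0" "K 0 = k 0 / (real 1 + 1)" "\<forall>x. W (0, x) = x ^ (1 + 1) * K x"
      using integrate_factor[of "\<lambda>x. W (0, x)" 1 k] k(1) W00 by auto
    have "(K \<longlongrightarrow> K 0) (at 0)" using K(1) by (simp add: isCont_def)
    moreover have "W (0, x) / x\<^sup>2 = K x" if "x \<noteq> 0" for x using K(3) that by (simp add: power2_eq_square)
    ultimately have "((\<lambda>x. W (0, x) / x\<^sup>2) \<longlongrightarrow> K 0) (at 0)"
      by (subst LIM_equal[where g = K]) auto
    then have "K 0 = w 0" using Wlim by (rule LIM_unique)
    then show ?thesis using K(2) k(2) by simp
  qed
  \<comment> \<open>the coefficient of \<open>z\<close> in \<open>W\<close>\<close>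
  have Wu: "pdu W (0, 0) = \<tau> ^ 3 * p / 6"
  proof -
    define r where "r y = \<sigma> (0, y)" for y
    have dr: "(r has_field_derivative \<tau>) (at 0)" unfolding r_def[abs_def] \<tau>_def by (rule DERIV_pdv[OF n(1)])
    have r0: "r 0 = 0" using n by (simp add: r_def)
    obtain k where k: "isCont k 0" "k 0 = \<tau>" "\<forall>y. r y = y * k y" by (rule linear_factor[OF dr r0])
    have cG: "isCont (\<lambda>y. G (r y)) 0" using isCont_o2[OF DERIV_isCont[OF dr], of G] G(1) r0 by simp
    define l where "l y = (k y) ^ 3 * G (r y)" for y
    have cl: "isCont l 0" unfolding l_def using k(1) cG by (intro continuous_intros)
    have cl': "isCont (\<lambda>y. l (- y)) 0" by (rule isCont_o2[where f = uminus and g = l]) (use cl in simp_all)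
    have zl: "z0 (\<sigma> (0, y)) = y ^ 3 * l y" for y
      using G(3) k(3) by (simp add: l_def r_def[symmetric] power_mult_distrib)
    have "\<forall>\<^sub>F y in at 0. z0 (\<sigma> (0, y)) - z0 (\<sigma> (0, - y)) = 2 * y * W (y\<^sup>2, 0)"
      using n(7) by (simp add: eventually_nhds_conv_at)
    moreover have "\<forall>\<^sub>F y in at 0. y \<noteq> (0::real)" by (rule eventually_neq_at_within)
    ultimately have e: "\<forall>\<^sub>F y in at 0. W (y\<^sup>2, 0) / y\<^sup>2 = (l y + l (- y)) / 2"
    proof eventually_elim
      case (elim y)
      have "y * (y\<^sup>2 * (l y + l (- y))) = y * (2 * W (y\<^sup>2, 0))"
        using elim(1) by (simp add: zl power2_eq_square power3_eq_cube algebra_simps)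
      then have "y\<^sup>2 * (l y + l (- y)) = 2 * W (y\<^sup>2, 0)" using elim(2) by simp
      then have "W (y\<^sup>2, 0) = y\<^sup>2 * (l y + l (- y)) / 2" by simp
      then show ?case using elim(2) by simp
    qed
    have "((\<lambda>y. (l y + l (- y)) / 2) \<longlongrightarrow> (l 0 + l (- 0)) / 2) (at 0)"
      using cl cl' by (intro tendsto_intros) (simp_all add: isCont_def)
    then have "((\<lambda>y. W (y\<^sup>2, 0) / y\<^sup>2) \<longlongrightarrow> l 0) (at 0)" unfolding tendsto_cong[OF e] by simp
    moreover have "((\<lambda>y. W (y\<^sup>2, 0) / y\<^sup>2) \<longlongrightarrow> pdu W (0, 0)) (at 0)"
      by (rule filterlim_compose[OF slope_at_origin(1)[OF n(5) W00]])
        (auto intro!: filterlim_atI tendsto_eq_intros simp: eventually_at_filter)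
    ultimately have "pdu W (0, 0) = l 0" by (rule LIM_unique[rotated])
    then show ?thesis using k(2) G(2) r0 by (simp add: l_def p_def)
  qed
  have t: "\<tau> > 0" using n(3) by (simp add: \<tau>_def)
  have dw: "d * (\<tau> ^ 4 / 6) = pdv (pdv W) (0, 0) * pdu W (0, 0)"
    unfolding Wvv Wu w0 d p_def[symmetric] q_def[symmetric]
    by (simp add: field_simps power2_eq_square eval_nat_numeral)
  have t4: "\<tau> ^ 4 / 6 > 0" using t by simp
  have sd: "sgn d = sgn (pdv (pdv W) (0, 0)) * sgn (pdu W (0, 0))"
    using arg_cong[OF dw, of sgn] unfolding sgn_mult sgn_pos[OF t4] by simp
  have FW: "A_equivalent F (0, 0) (folded_form W) (0, 0)" using n(8) by (simp add: F)
  have "smooth_near (0, 0) F"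
    unfolding F by (intro smooth_near_vector3 smooth_near_fst smooth_near_line_family s)
  then have cF: "isCont F (0, 0)" by (rule smooth_near_isCont)
  have FW': "A_equivalent (folded_form W) (0, 0) (folded_form V) (0, 0)" if "A_equivalent F (0, 0) (folded_form V) (0, 0)" for V
    by (rule A_equivalent_trans[OF A_equivalent_sym[OF FW cF] that])
  show "\<not> A_equivalent F (0, 0) (folded_form snd) (0, 0)"
    using FW' not_cross_cap_folded_form[OF n(5) Wlim1] by blast
  have S1: "A_equivalent F (0, 0) (folded_form (S1_function (sgn d))) (0, 0)" if "d \<noteq> 0"
  proof -
    have "pdv (pdv W) (0, 0) \<noteq> 0" "pdu W (0, 0) \<noteq> 0" using sd that by (auto simp: sgn_zero_iff)
    from A_equivalent_trans[OF FW folded_form_S1[OF n(5) W00 Wv this]] show ?thesis using sd by simp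
  qed
  have zero: "\<not> A_equivalent F (0, 0) (folded_form (S1_function \<delta>)) (0, 0)" if "d = 0" "\<delta> \<noteq> 0" for \<delta>
  proof -
    have "w 0 = 0 \<or> pdu W (0, 0) = 0" using dw Wvv that by auto
    then have "\<not> A_equivalent (folded_form W) (0, 0) (folded_form (S1_function \<delta>)) (0, 0)"
    proof
      assume "w 0 = 0"
      then show ?thesis using not_S1_folded_form[OF n(5)] Wlim by simp
    next
      assume "pdu W (0, 0) = 0"
      then show ?thesis using not_S1_folded_form'[OF n(5) W00 _ that(2) Wlim1] by simp
    qed
    then show ?thesis using FW' by blast
  qed
  have excl: "\<not> (A_equivalent F (0, 0) (folded_form (S1_function 1)) (0, 0) \<and> A_equivalent F (0, 0) (folded_form (S1_function (-1))) (0, 0))"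
    using A_equivalent_trans[OF A_equivalent_sym[OF _ cF]] S1_minus_not_S1_plus by blast
  show "A_equivalent F (0, 0) (folded_form (S1_function 1)) (0, 0) \<longleftrightarrow> d > 0"
    using S1 zero[of 1] excl by (cases d "0::real" rule: linorder_cases) auto
  show "A_equivalent F (0, 0) (folded_form (S1_function (-1))) (0, 0) \<longleftrightarrow> d < 0"
    using S1 zero[of "-1"] excl by (cases d "0::real" rule: linorder_cases) auto
qed

lemma A_equivalent_cross_cap_exclusive:
  assumes "isCont F (0, 0)" "A_equivalent F (0, 0) (folded_form snd) (0, 0)"
  shows "\<not> A_equivalent F (0, 0) (folded_form (S1_function \<delta>)) (0, 0)"
proof
  assume S: "A_equivalent F (0, 0) (folded_form (S1_function \<delta>)) (0, 0)"
  show False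
    using A_equivalent_trans[OF A_equivalent_sym[OF S assms(1)] assms(2)] S1_not_cross_cap by blast
qed

section \<open>The normal ruled surface as a family of lines\<close>

lemma deriv_translate: "deriv (\<lambda>s. f (a + s)) = (\<lambda>s. deriv f (a + s))" for f :: "real \<Rightarrow> real"
proof
  fix s
  have "((\<lambda>s. f (a + s)) has_field_derivative D) (at s) \<longleftrightarrow> (f has_field_derivative D) (at (a + s))" for D
    using DERIV_shift[of f D s a] by (simp add: add.commute)
  then show "deriv (\<lambda>s. f (a + s)) s = deriv f (a + s)" by (simp add: deriv_def)
qed

lemma eventually_deriv_cong:
  assumes "\<forall>\<^sub>F x in nhds (t::real). f x = (g x :: real)"
  shows "\<forall>\<^sub>F x in nhds t. deriv f x = deriv g x"
  using assms[THEN eventually_eventually[THEN iffD2]] by eventually_elim (rule deriv_cong_ev, auto)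

lemma
  fixes f g :: "real \<Rightarrow> real"
  assumes f: "smooth_near t f" and g: "smooth_near t g"
  shows deriv_add: "\<forall>\<^sub>F x in nhds t. deriv (\<lambda>x. f x + g x) x = deriv f x + deriv g x"
    and deriv_diff: "\<forall>\<^sub>F x in nhds t. deriv (\<lambda>x. f x - g x) x = deriv f x - deriv g x"
    and deriv_mult: "\<forall>\<^sub>F x in nhds t. deriv (\<lambda>x. f x * g x) x = deriv f x * g x + f x * deriv g x"
proof -
  have D: "\<forall>\<^sub>F x in nhds t. (f has_field_derivative deriv f x) (at x) \<and> (g has_field_derivative deriv g x) (at x)"
    using smooth_near_eventually[OF f] smooth_near_eventually[OF g] by eventually_elim (simp add: smooth_near_deriv(1))
  show "\<forall>\<^sub>F x in nhds t. deriv (\<lambda>x. f x + g x) x = deriv f x + deriv g x"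
    using D by eventually_elim (auto intro!: DERIV_imp_deriv DERIV_add)
  show "\<forall>\<^sub>F x in nhds t. deriv (\<lambda>x. f x - g x) x = deriv f x - deriv g x"
    using D by eventually_elim (auto intro!: DERIV_imp_deriv DERIV_diff)
  show "\<forall>\<^sub>F x in nhds t. deriv (\<lambda>x. f x * g x) x = deriv f x * g x + f x * deriv g x"
    using D by eventually_elim (auto intro!: DERIV_imp_deriv derivative_eq_intros)
qed

lemma deriv2_add:
  fixes f g :: "real \<Rightarrow> real"
  assumes f: "smooth_near t f" and g: "smooth_near t g"
  shows "\<forall>\<^sub>F x in nhds t. deriv (deriv (\<lambda>x. f x + g x)) x = deriv (deriv f) x + deriv (deriv g) x"
  using eventually_deriv_cong[OF deriv_add[OF f g]] deriv_add[OF smooth_near_deriv(2)[OF f] smooth_near_deriv(2)[OF g]]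
  by eventually_elim simp

lemma deriv2_diff:
  fixes f g :: "real \<Rightarrow> real"
  assumes f: "smooth_near t f" and g: "smooth_near t g"
  shows "\<forall>\<^sub>F x in nhds t. deriv (deriv (\<lambda>x. f x - g x)) x = deriv (deriv f) x - deriv (deriv g) x"
  using eventually_deriv_cong[OF deriv_diff[OF f g]] deriv_diff[OF smooth_near_deriv(2)[OF f] smooth_near_deriv(2)[OF g]]
  by eventually_elim simp

lemma deriv3_diff:
  fixes f g :: "real \<Rightarrow> real"
  assumes f: "smooth_near t f" and g: "smooth_near t g"
  shows "\<forall>\<^sub>F x in nhds t. deriv (deriv (deriv (\<lambda>x. f x - g x))) x = deriv (deriv (deriv f)) x - deriv (deriv (deriv g)) x"
  using eventually_deriv_cong[OF deriv2_diff[OF f g]]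
    deriv_diff[OF smooth_near_deriv(2)[OF smooth_near_deriv(2)[OF f]] smooth_near_deriv(2)[OF smooth_near_deriv(2)[OF g]]]
  by eventually_elim simp

lemma deriv2_mult:
  fixes f g :: "real \<Rightarrow> real"
  assumes f: "smooth_near t f" and g: "smooth_near t g"
  shows "\<forall>\<^sub>F x in nhds t. deriv (deriv (\<lambda>x. f x * g x)) x = deriv (deriv f) x * g x + 2 * deriv f x * deriv g x + f x * deriv (deriv g) x"
proof -
  note f' = smooth_near_deriv(2)[OF f] and g' = smooth_near_deriv(2)[OF g]
  from eventually_deriv_cong[OF deriv_mult[OF f g]] deriv_add[OF smooth_near_mult[OF f' g] smooth_near_mult[OF f g']]
    deriv_mult[OF f' g] deriv_mult[OF f g'] show ?thesis
    by eventually_elim simp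
qed

lemma deriv3_mult:
  fixes f g :: "real \<Rightarrow> real"
  assumes f: "smooth_near t f" and g: "smooth_near t g"
  shows "\<forall>\<^sub>F x in nhds t. deriv (deriv (deriv (\<lambda>x. f x * g x))) x = deriv (deriv (deriv f)) x * g x +
    3 * deriv (deriv f) x * deriv g x + 3 * deriv f x * deriv (deriv g) x + f x * deriv (deriv (deriv g)) x"
proof -
  note f' = smooth_near_deriv(2)[OF f] and g' = smooth_near_deriv(2)[OF g]
  from eventually_deriv_cong[OF eventually_deriv_cong[OF deriv_mult[OF f g]]]
    deriv2_add[OF smooth_near_mult[OF f' g] smooth_near_mult[OF f g']]
    deriv2_mult[OF f' g] deriv2_mult[OF f g'] show ?thesis
    by eventually_elim simp
qed

lemmas at_point = eventually_nhds_x_imp_x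

lemma
  fixes \<beta> b :: "real \<Rightarrow> real"
  assumes \<beta>: "smooth_near t \<beta>" and b: "smooth_near t b" "b t = 1" "deriv b t = 0" and \<beta>0: "\<beta> t = 0"
  shows quotient_derivatives: "deriv (\<lambda>x. \<beta> x / b x) t = deriv \<beta> t"
      "deriv (deriv (\<lambda>x. \<beta> x / b x)) t = deriv (deriv \<beta>) t"
    and quotient_derivative3: "deriv \<beta> t = 0 \<Longrightarrow> deriv (deriv (deriv (\<lambda>x. \<beta> x / b x))) t = deriv (deriv (deriv \<beta>)) t"
proof -
  define z where "z = (\<lambda>x. \<beta> x / b x)"
  have z: "smooth_near t z" unfolding z_def using b by (intro smooth_near_divide \<beta>) auto
  have "\<forall>\<^sub>F x in nhds t. b x \<noteq> 0" by (rule eventually_nhds_nonzero(2)[OF smooth_near_isCont[OF b(1)]]) (use b in simp)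
  then have e: "\<forall>\<^sub>F x in nhds t. \<beta> x = z x * b x" by eventually_elim (simp add: z_def)
  note e1 = eventually_deriv_cong[OF e]
  note e2 = eventually_deriv_cong[OF e1]
  note e3 = eventually_deriv_cong[OF e2]
  have z0: "z t = 0" using \<beta>0 by (simp add: z_def)
  show d1: "deriv (\<lambda>x. \<beta> x / b x) t = deriv \<beta> t"
    using at_point[OF e1] at_point[OF deriv_mult[OF z b(1)]] z0 b by (simp add: z_def[symmetric])
  show "deriv (deriv (\<lambda>x. \<beta> x / b x)) t = deriv (deriv \<beta>) t"
    using at_point[OF e2] at_point[OF deriv2_mult[OF z b(1)]] z0 b by (simp add: z_def[symmetric])
  show "deriv (deriv (deriv (\<lambda>x. \<beta> x / b x))) t = deriv (deriv (deriv \<beta>)) t" if "deriv \<beta> t = 0"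
    using at_point[OF e3] at_point[OF deriv3_mult[OF z b(1)]] z0 b d1 that by (simp add: z_def[symmetric])
qed

text \<open>Derivatives at a point of the components, in a fixed direction, of a curve and its frame.\<close>

lemma frame_component_derivatives:
  fixes cf ef hf nf \<kappa>s \<kappa>\<nu> \<kappa>t :: "real \<Rightarrow> real"
  assumes sm: "smooth_near t cf" "smooth_near t ef" "smooth_near t hf" "smooth_near t nf"
      "smooth_near t \<kappa>s" "smooth_near t \<kappa>\<nu>" "smooth_near t \<kappa>t"
    and c: "\<forall>\<^sub>F x in nhds t. deriv cf x = ef x"
    and e: "\<forall>\<^sub>F x in nhds t. deriv ef x = \<kappa>s x * hf x + \<kappa>\<nu> x * nf x"
    and h: "\<forall>\<^sub>F x in nhds t. deriv hf x = \<kappa>t x * nf x - \<kappa>s x * ef x"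
    and n: "\<forall>\<^sub>F x in nhds t. deriv nf x = 0 - \<kappa>\<nu> x * ef x - \<kappa>t x * hf x"
    and \<kappa>t0: "\<kappa>t t = 0"
  shows "deriv cf t = ef t"
    and "deriv (deriv cf) t = \<kappa>s t * hf t + \<kappa>\<nu> t * nf t"
    and "deriv (deriv (deriv cf)) t = deriv \<kappa>s t * hf t - \<kappa>s t * (\<kappa>s t * ef t) + deriv \<kappa>\<nu> t * nf t - \<kappa>\<nu> t * (\<kappa>\<nu> t * ef t)"
    and "deriv nf t = - \<kappa>\<nu> t * ef t"
    and "deriv (deriv nf) t = - deriv \<kappa>\<nu> t * ef t - \<kappa>\<nu> t * (\<kappa>s t * hf t + \<kappa>\<nu> t * nf t) - deriv \<kappa>t t * hf t"
    and "deriv (deriv (deriv nf)) t = - deriv (deriv \<kappa>\<nu>) t * ef t - 2 * deriv \<kappa>\<nu> t * (\<kappa>s t * hf t + \<kappa>\<nu> t * nf t)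
      - \<kappa>\<nu> t * (deriv \<kappa>s t * hf t - \<kappa>s t * (\<kappa>s t * ef t) + deriv \<kappa>\<nu> t * nf t - \<kappa>\<nu> t * (\<kappa>\<nu> t * ef t))
      - deriv (deriv \<kappa>t) t * hf t + 2 * deriv \<kappa>t t * (\<kappa>s t * ef t)"
proof -
  note m = smooth_near_mult
  have z: "smooth_near t (\<lambda>x. 0::real)" by simp
  show c1: "deriv cf t = ef t" by (rule at_point[OF c])
  have h1: "deriv hf t = - \<kappa>s t * ef t" using at_point[OF h] \<kappa>t0 by simp
  show n1: "deriv nf t = - \<kappa>\<nu> t * ef t" using at_point[OF n] \<kappa>t0 by simp
  have e1: "deriv ef t = \<kappa>s t * hf t + \<kappa>\<nu> t * nf t" by (rule at_point[OF e])
  show "deriv (deriv cf) t = \<kappa>s t * hf t + \<kappa>\<nu> t * nf t"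
    using at_point[OF eventually_deriv_cong[OF c]] e1 by simp
  have e2: "deriv (deriv ef) t = deriv \<kappa>s t * hf t - \<kappa>s t * (\<kappa>s t * ef t) + deriv \<kappa>\<nu> t * nf t - \<kappa>\<nu> t * (\<kappa>\<nu> t * ef t)"
    using at_point[OF eventually_deriv_cong[OF e]] at_point[OF deriv_add[OF m[OF sm(5,3)] m[OF sm(6,4)]]]
      at_point[OF deriv_mult[OF sm(5,3)]] at_point[OF deriv_mult[OF sm(6,4)]] h1 n1
    by simp
  show "deriv (deriv (deriv cf)) t = deriv \<kappa>s t * hf t - \<kappa>s t * (\<kappa>s t * ef t) + deriv \<kappa>\<nu> t * nf t - \<kappa>\<nu> t * (\<kappa>\<nu> t * ef t)"
    using at_point[OF eventually_deriv_cong[OF eventually_deriv_cong[OF c]]] e2 by simp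
  have h2: "0 = 0 * deriv (deriv hf) t" by simp
  have d0: "deriv (\<lambda>x::real. 0::real) = (\<lambda>x. 0)" by (simp add: fun_eq_iff)
  show n2: "deriv (deriv nf) t = - deriv \<kappa>\<nu> t * ef t - \<kappa>\<nu> t * (\<kappa>s t * hf t + \<kappa>\<nu> t * nf t) - deriv \<kappa>t t * hf t"
    using at_point[OF eventually_deriv_cong[OF n]]
      at_point[OF deriv_diff[OF smooth_near_diff[OF z m[OF sm(6,2)]] m[OF sm(7,3)]]]
      at_point[OF deriv_diff[OF z m[OF sm(6,2)]]]
      at_point[OF deriv_mult[OF sm(6,2)]] at_point[OF deriv_mult[OF sm(7,3)]] e1 \<kappa>t0
    by (simp add: d0)
  show "deriv (deriv (deriv nf)) t = - deriv (deriv \<kappa>\<nu>) t * ef t - 2 * deriv \<kappa>\<nu> t * (\<kappa>s t * hf t + \<kappa>\<nu> t * nf t)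
      - \<kappa>\<nu> t * (deriv \<kappa>s t * hf t - \<kappa>s t * (\<kappa>s t * ef t) + deriv \<kappa>\<nu> t * nf t - \<kappa>\<nu> t * (\<kappa>\<nu> t * ef t))
      - deriv (deriv \<kappa>t) t * hf t + 2 * deriv \<kappa>t t * (\<kappa>s t * ef t)"
    using at_point[OF eventually_deriv_cong[OF eventually_deriv_cong[OF n]]]
      at_point[OF deriv2_diff[OF smooth_near_diff[OF z m[OF sm(6,2)]] m[OF sm(7,3)]]]
      at_point[OF deriv2_diff[OF z m[OF sm(6,2)]]]
      at_point[OF deriv2_mult[OF sm(6,2)]] at_point[OF deriv2_mult[OF sm(7,3)]] e1 e2 h1 \<kappa>t0
    by (simp add: d0 algebra_simps)
qed

lemma orthonormal3_expansion:
  assumes "orthonormal3 a b c"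
  shows "P = (P \<bullet> a) *\<^sub>R a + (P \<bullet> b) *\<^sub>R b + (P \<bullet> c) *\<^sub>R c"
proof -
  have o: "a \<bullet> a = 1" "b \<bullet> b = 1" "c \<bullet> c = 1" "a \<bullet> b = 0" "a \<bullet> c = 0" "b \<bullet> c = 0" "b \<bullet> a = 0" "c \<bullet> a = 0" "c \<bullet> b = 0"
    using assms by (auto simp: orthonormal3_def norm_eq_1 inner_commute)
  have d: "a \<noteq> b" "a \<noteq> c" "b \<noteq> c" "0 \<notin> {a, b, c}" using o by auto
  have "pairwise orthogonal {a, b, c}" using o by (auto simp: pairwise_def orthogonal_def)
  then have i: "independent {a, b, c}" by (rule pairwise_orthogonal_independent[OF _ d(4)])
  have "card {a, b, c} = 3" using d by simp
  then have span: "UNIV \<subseteq> span {a, b, c}"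
    by (intro card_ge_dim_independent[OF subset_UNIV i]) simp
  define r where "r = P - ((P \<bullet> a) *\<^sub>R a + (P \<bullet> b) *\<^sub>R b + (P \<bullet> c) *\<^sub>R c)"
  have "orthogonal r x" if "x \<in> {a, b, c}" for x
    using that o by (auto simp: r_def orthogonal_def inner_diff_left inner_add_left)
  then have "orthogonal r r" using orthogonal_to_span[of r "{a, b, c}" r] span by blast
  then show ?thesis by (simp add: r_def orthogonal_def)
qed

text \<open>In the orthonormal frame at the singular point the lines become graphs over the direction of the normal,
  which is the direction of the line through that point.\<close>

lemma normal_ruled_surface_line_family:
  fixes c e h n :: "real \<Rightarrow> real^3" and \<kappa>s \<kappa>\<nu> \<kappa>t :: "real \<Rightarrow> real"
  assumes sm: "smooth_near u0 c" "smooth_near u0 e" "smooth_near u0 h" "smooth_near u0 n"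
      "smooth_near u0 \<kappa>s" "smooth_near u0 \<kappa>\<nu>" "smooth_near u0 \<kappa>t"
    and dc: "\<forall>\<^sub>F u in nhds u0. (c has_vector_derivative e u) (at u)"
    and de: "\<forall>\<^sub>F u in nhds u0. (e has_vector_derivative (\<kappa>s u *\<^sub>R h u + \<kappa>\<nu> u *\<^sub>R n u)) (at u)"
    and dh: "\<forall>\<^sub>F u in nhds u0. (h has_vector_derivative (- \<kappa>s u *\<^sub>R e u + \<kappa>t u *\<^sub>R n u)) (at u)"
    and dn: "\<forall>\<^sub>F u in nhds u0. (n has_vector_derivative (- \<kappa>\<nu> u *\<^sub>R e u - \<kappa>t u *\<^sub>R h u)) (at u)"
    and on: "orthonormal3 (e u0) (h u0) (n u0)" and \<kappa>t0: "\<kappa>t u0 = 0" and w0: "w0 * \<kappa>\<nu> u0 = 1"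
  obtains y0 y1 z0 z1 :: "real \<Rightarrow> real"
  where "smooth_near 0 y0" "smooth_near 0 y1" "smooth_near 0 z0" "smooth_near 0 z1"
    "A_equivalent (normal_ruled_surface c n) (u0, w0)
      (\<lambda>q. vector [fst q, y0 (snd q) + fst q * y1 (snd q), z0 (snd q) + fst q * z1 (snd q)]) (0, 0)"
    "y0 0 = 0" "deriv y0 0 = 0" "deriv (deriv y0) 0 = - w0 * deriv \<kappa>\<nu> u0" "deriv y1 0 = - \<kappa>\<nu> u0"
    "z0 0 = 0" "deriv z0 0 = 0" "deriv (deriv z0) 0 = - w0 * deriv \<kappa>t u0" "deriv z1 0 = 0"
    "deriv \<kappa>t u0 = 0 \<longrightarrow> deriv (deriv z1) 0 = - \<kappa>\<nu> u0 * \<kappa>s u0"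
    "deriv \<kappa>t u0 = 0 \<longrightarrow> deriv (deriv (deriv z0)) 0 = - w0 * (2 * \<kappa>s u0 * deriv \<kappa>\<nu> u0 + deriv (deriv \<kappa>t) u0)"
proof -
  define e0 where "e0 = e u0"
  define h0 where "h0 = h u0"
  define n0 where "n0 = n u0"
  define p0 where "p0 = c u0 + w0 *\<^sub>R n0"
  have o: "e0 \<bullet> e0 = 1" "h0 \<bullet> h0 = 1" "n0 \<bullet> n0 = 1" "e0 \<bullet> h0 = 0" "e0 \<bullet> n0 = 0" "h0 \<bullet> n0 = 0" "h0 \<bullet> e0 = 0" "n0 \<bullet> e0 = 0" "n0 \<bullet> h0 = 0"
    using on by (auto simp: orthonormal3_def norm_eq_1 inner_commute e0_def h0_def n0_def)
  have shift: "smooth_near 0 (\<lambda>s. f (u0 + s))" if "smooth_near u0 f" for f :: "real \<Rightarrow> 'b::real_normed_vector"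
    by (rule smooth_near_compose[where f = f]) (use that in \<open>auto intro: smooth_near_add\<close>)
  have shift_ev: "\<forall>\<^sub>F s in nhds 0. P (u0 + s)" if "\<forall>\<^sub>F u in nhds u0. P u" for P
    by (rule eventually_nhds_along[where f = "\<lambda>s. u0 + s"]) (use that in \<open>auto intro!: continuous_intros\<close>)
  define cf where "cf v s = (c (u0 + s) - p0) \<bullet> v" for v s
  define ef where "ef v s = e (u0 + s) \<bullet> v" for v s
  define hf where "hf v s = h (u0 + s) \<bullet> v" for v s
  define nf where "nf v s = n (u0 + s) \<bullet> v" for v s
  have fs: "smooth_near 0 (cf v)" "smooth_near 0 (ef v)" "smooth_near 0 (hf v)" "smooth_near 0 (nf v)" for v
    unfolding cf_def ef_def hf_def nf_def
    by (intro smooth_near_inner smooth_near_diff smooth_near_const shift sm)+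
  have vd: "deriv (\<lambda>s. (f (u0 + s) - q) \<bullet> v) s = f' \<bullet> v" if "(f has_vector_derivative f') (at (u0 + s))" for f :: "real \<Rightarrow> real^3" and f' q v s
  proof (rule DERIV_imp_deriv)
    have "((\<lambda>s. f (u0 + s)) has_derivative (\<lambda>t. t *\<^sub>R f')) (at s)"
    proof (rule has_derivative_compose[of "\<lambda>s. u0 + s" "\<lambda>t. t" s UNIV f "\<lambda>t. t *\<^sub>R f'"])
      show "((\<lambda>s. u0 + s) has_derivative (\<lambda>t. t)) (at s)" by (auto intro!: derivative_eq_intros)
    qed (use that in \<open>simp add: has_vector_derivative_def\<close>)
    then have "((\<lambda>s. (f (u0 + s) - q) \<bullet> v) has_derivative (\<lambda>t. (t *\<^sub>R f') \<bullet> v)) (at s)"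
      by (auto intro!: derivative_eq_intros)
    then show "((\<lambda>s. (f (u0 + s) - q) \<bullet> v) has_field_derivative f' \<bullet> v) (at s)"
      by (simp add: has_field_derivative_def mult_commute_abs)
  qed
  have ode: "\<forall>\<^sub>F s in nhds 0. deriv (cf v) s = ef v s"
    "\<forall>\<^sub>F s in nhds 0. deriv (ef v) s = \<kappa>s (u0 + s) * hf v s + \<kappa>\<nu> (u0 + s) * nf v s"
    "\<forall>\<^sub>F s in nhds 0. deriv (hf v) s = \<kappa>t (u0 + s) * nf v s - \<kappa>s (u0 + s) * ef v s"
    "\<forall>\<^sub>F s in nhds 0. deriv (nf v) s = 0 - \<kappa>\<nu> (u0 + s) * ef v s - \<kappa>t (u0 + s) * hf v s" for v
  proof -
    show "\<forall>\<^sub>F s in nhds 0. deriv (cf v) s = ef v s"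
      using shift_ev[OF dc] by eventually_elim (simp add: cf_def[abs_def] ef_def vd)
    show "\<forall>\<^sub>F s in nhds 0. deriv (ef v) s = \<kappa>s (u0 + s) * hf v s + \<kappa>\<nu> (u0 + s) * nf v s"
      using shift_ev[OF de]
    proof eventually_elim
      case (elim s)
      from vd[OF elim, of 0 v] show ?case by (simp add: ef_def[abs_def] hf_def nf_def inner_add_left)
    qed
    show "\<forall>\<^sub>F s in nhds 0. deriv (hf v) s = \<kappa>t (u0 + s) * nf v s - \<kappa>s (u0 + s) * ef v s"
      using shift_ev[OF dh]
    proof eventually_elim
      case (elim s)
      from vd[OF elim, of 0 v] show ?case by (simp add: ef_def hf_def[abs_def] nf_def inner_add_left inner_diff_left)
    qed
    show "\<forall>\<^sub>F s in nhds 0. deriv (nf v) s = 0 - \<kappa>\<nu> (u0 + s) * ef v s - \<kappa>t (u0 + s) * hf v s"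
      using shift_ev[OF dn]
    proof eventually_elim
      case (elim s)
      from vd[OF elim, of 0 v] show ?case by (simp add: ef_def hf_def nf_def[abs_def] inner_add_left inner_diff_left)
    qed
  qed
  have J: "deriv (cf v) 0 = ef v 0"
    "deriv (deriv (cf v)) 0 = \<kappa>s u0 * hf v 0 + \<kappa>\<nu> u0 * nf v 0"
    "deriv (deriv (deriv (cf v))) 0 = deriv \<kappa>s u0 * hf v 0 - \<kappa>s u0 * (\<kappa>s u0 * ef v 0) + deriv \<kappa>\<nu> u0 * nf v 0 - \<kappa>\<nu> u0 * (\<kappa>\<nu> u0 * ef v 0)"
    "deriv (nf v) 0 = - \<kappa>\<nu> u0 * ef v 0"
    "deriv (deriv (nf v)) 0 = - deriv \<kappa>\<nu> u0 * ef v 0 - \<kappa>\<nu> u0 * (\<kappa>s u0 * hf v 0 + \<kappa>\<nu> u0 * nf v 0) - deriv \<kappa>t u0 * hf v 0"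
    "deriv (deriv (deriv (nf v))) 0 = - deriv (deriv \<kappa>\<nu>) u0 * ef v 0 - 2 * deriv \<kappa>\<nu> u0 * (\<kappa>s u0 * hf v 0 + \<kappa>\<nu> u0 * nf v 0)
      - \<kappa>\<nu> u0 * (deriv \<kappa>s u0 * hf v 0 - \<kappa>s u0 * (\<kappa>s u0 * ef v 0) + deriv \<kappa>\<nu> u0 * nf v 0 - \<kappa>\<nu> u0 * (\<kappa>\<nu> u0 * ef v 0))
      - deriv (deriv \<kappa>t) u0 * hf v 0 + 2 * deriv \<kappa>t u0 * (\<kappa>s u0 * ef v 0)" for v
    using frame_component_derivatives[OF fs[of v] shift[OF sm(5)] shift[OF sm(6)] shift[OF sm(7)] ode] \<kappa>t0
    by (simp_all add: deriv_translate)
  have vals: "cf n0 0 = - w0" "cf e0 0 = 0" "cf h0 0 = 0" "ef e0 0 = 1" "ef h0 0 = 0" "ef n0 0 = 0"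
    "hf e0 0 = 0" "hf h0 0 = 1" "hf n0 0 = 0" "nf e0 0 = 0" "nf h0 0 = 0" "nf n0 0 = 1"
    using o by (simp_all add: cf_def ef_def hf_def nf_def p0_def e0_def[symmetric] h0_def[symmetric] n0_def[symmetric])
  define a where "a = cf n0"
  define b where "b = nf n0"
  have a: "smooth_near 0 a" "a 0 = - w0" "deriv a 0 = 0" using fs J(1)[of n0] vals by (simp_all add: a_def)
  have b: "smooth_near 0 b" "b 0 = 1" "deriv b 0 = 0" using fs J(4)[of n0] vals by (simp_all add: b_def)
  define y1 where "y1 = (\<lambda>s. nf e0 s / b s)"
  define z1 where "z1 = (\<lambda>s. nf h0 s / b s)"
  define y0 where "y0 = (\<lambda>s. cf e0 s - a s * y1 s)"
  define z0 where "z0 = (\<lambda>s. cf h0 s - a s * z1 s)"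
  have y1: "smooth_near 0 y1" "y1 0 = 0" and z1: "smooth_near 0 z1" "z1 0 = 0"
    unfolding y1_def z1_def using b vals by (auto intro!: smooth_near_divide fs)
  have y0: "smooth_near 0 y0" and z0: "smooth_near 0 z0"
    unfolding y0_def z0_def by (intro smooth_near_diff smooth_near_mult fs a y1 z1)+
  have y1d: "deriv y1 0 = - \<kappa>\<nu> u0" "deriv (deriv y1) 0 = - deriv \<kappa>\<nu> u0"
    using quotient_derivatives[OF fs(4)[of e0] b] J(4,5)[of e0] vals by (simp_all add: y1_def)
  have z1d: "deriv z1 0 = 0" "deriv (deriv z1) 0 = - \<kappa>\<nu> u0 * \<kappa>s u0 - deriv \<kappa>t u0"
    using quotient_derivatives[OF fs(4)[of h0] b] J(4,5)[of h0] vals by (simp_all add: z1_def)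
  have z1d3: "deriv (deriv (deriv z1)) 0 = - 2 * deriv \<kappa>\<nu> u0 * \<kappa>s u0 - \<kappa>\<nu> u0 * deriv \<kappa>s u0 - deriv (deriv \<kappa>t) u0"
    using quotient_derivative3[OF fs(4)[of h0] b] J(4,6)[of h0] vals by (simp add: z1_def)
  have y0d: "deriv y0 0 = 0" "deriv (deriv y0) 0 = - w0 * deriv \<kappa>\<nu> u0"
    unfolding y0_def
    using at_point[OF deriv_diff[OF fs(1)[of e0] smooth_near_mult[OF a(1) y1(1)]]]
      at_point[OF deriv2_diff[OF fs(1)[of e0] smooth_near_mult[OF a(1) y1(1)]]]
      at_point[OF deriv_mult[OF a(1) y1(1)]] at_point[OF deriv2_mult[OF a(1) y1(1)]] J(1,2)[of e0] vals a y1 y1d w0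
    by simp_all
  have w0': "w0 * (\<kappa>\<nu> u0 * \<kappa>s u0) = \<kappa>s u0" using w0 by (simp add: mult.assoc[symmetric])
  have z0d: "deriv z0 0 = 0" "deriv (deriv z0) 0 = - w0 * deriv \<kappa>t u0"
    unfolding z0_def
    using at_point[OF deriv_diff[OF fs(1)[of h0] smooth_near_mult[OF a(1) z1(1)]]]
      at_point[OF deriv2_diff[OF fs(1)[of h0] smooth_near_mult[OF a(1) z1(1)]]]
      at_point[OF deriv_mult[OF a(1) z1(1)]] at_point[OF deriv2_mult[OF a(1) z1(1)]] J(1,2)[of h0] vals a z1 z1d w0'
    by (simp_all add: algebra_simps)
  have z0d3: "deriv (deriv (deriv z0)) 0 = - w0 * (2 * \<kappa>s u0 * deriv \<kappa>\<nu> u0 + deriv (deriv \<kappa>t) u0)"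
  proof -
    have "deriv (deriv (deriv z0)) 0 = deriv \<kappa>s u0 + w0 * deriv (deriv (deriv z1)) 0"
      unfolding z0_def
      using at_point[OF deriv3_diff[OF fs(1)[of h0] smooth_near_mult[OF a(1) z1(1)]]]
        at_point[OF deriv3_mult[OF a(1) z1(1)]] J(3)[of h0] vals a z1 z1d by simp
    also have "\<dots> = deriv \<kappa>s u0 * (1 - w0 * \<kappa>\<nu> u0) - w0 * (2 * \<kappa>s u0 * deriv \<kappa>\<nu> u0 + deriv (deriv \<kappa>t) u0)"
      unfolding z1d3 by (simp add: algebra_simps)
    finally show ?thesis using w0 by simp
  qed
  let ?F = "\<lambda>q. vector [fst q, y0 (snd q) + fst q * y1 (snd q), z0 (snd q) + fst q * z1 (snd q)] :: real^3"
  have "A_equivalent (normal_ruled_surface c n) (u0, w0) ?F (0, 0)"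
  proof -
    have snd_comp: "smooth_near (x, 0) (\<lambda>q. f (snd q))" if "smooth_near 0 f" for f :: "real \<Rightarrow> real" and x :: real
      by (rule smooth_near_compose[OF _ smooth_near_snd]) (use that in simp)
    have fst_comp: "smooth_near (u0, w) (\<lambda>q. f (fst q - u0))" if "smooth_near 0 f" for f :: "real \<Rightarrow> real" and w :: real
      by (rule smooth_near_compose[where f = f]) (use that in \<open>auto intro!: smooth_near_diff smooth_near_fst\<close>)
    have bnz: "\<forall>\<^sub>F s in nhds 0. b s \<noteq> 0"
      by (rule eventually_nhds_nonzero(2)[OF smooth_near_isCont[OF b(1)]]) (use b in simp)
    define \<phi> where "\<phi> q = (a (fst q - u0) + snd q * b (fst q - u0), fst q - u0)" for q :: "real \<times> real"
    define \<phi>' where "\<phi>' q = (u0 + snd q, (fst q - a (snd q)) / b (snd q))" for q :: "real \<times> real"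
    have p0': "\<phi> (u0, w0) = (0, 0)" using a b by (simp add: \<phi>_def)
    have bnz1: "\<forall>\<^sub>F q in nhds (u0, w0). b (fst q - u0) \<noteq> 0"
      by (rule eventually_nhds_along[where f = "\<lambda>q. fst q - u0"]) (use bnz in \<open>auto intro!: continuous_intros\<close>)
    have bnz2: "\<forall>\<^sub>F q in nhds (0::real, 0::real). b (snd q) \<noteq> 0"
      by (rule eventually_nhds_along[where f = snd]) (use bnz in simp_all)
    have ph: "inverse_germs (u0, w0) \<phi> \<phi>'"
    proof (rule inverse_germsI)
      show "smooth_near (u0, w0) \<phi>"
        unfolding \<phi>_def
        by (intro smooth_near_Pair smooth_near_add smooth_near_mult smooth_near_snd smooth_near_diff smooth_near_fst smooth_near_const fst_comp a b)
      have "smooth_near (0, 0) \<phi>'"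
        unfolding \<phi>'_def
        by (intro smooth_near_Pair smooth_near_add smooth_near_divide smooth_near_snd smooth_near_diff smooth_near_fst smooth_near_const snd_comp a b)
          (use b in simp)
      then show "smooth_near (\<phi> (u0, w0)) \<phi>'" by (simp add: p0')
      show "\<forall>\<^sub>F x in nhds (u0, w0). \<phi>' (\<phi> x) = x"
        using bnz1 by eventually_elim (simp add: \<phi>_def \<phi>'_def prod_eq_iff)
      show "\<forall>\<^sub>F y in nhds (\<phi> (u0, w0)). \<phi> (\<phi>' y) = y"
        unfolding p0' using bnz2 by eventually_elim (simp add: \<phi>_def \<phi>'_def prod_eq_iff)
    qed
    define \<psi> where "\<psi> P = (vector [(P - p0) \<bullet> n0, (P - p0) \<bullet> e0, (P - p0) \<bullet> h0] :: real^3)" for P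
    define \<psi>' where "\<psi>' Q = p0 + (Q $ 1) *\<^sub>R n0 + (Q $ 2) *\<^sub>R e0 + (Q $ 3) *\<^sub>R h0" for Q :: "real^3"
    have ps: "inverse_germs P \<psi> \<psi>'" for P
    proof (rule inverse_germsI)
      show "smooth_near P \<psi>" unfolding \<psi>_def
        by (intro smooth_near_vector3 smooth_near_inner smooth_near_diff smooth_near_const smooth_near_id)
      show "smooth_near (\<psi> P) \<psi>'" unfolding \<psi>'_def
        by (intro smooth_near_add smooth_near_const smooth_near_scaleR smooth_near_nth)
      have "\<psi>' (\<psi> x) = x" for x
        using orthonormal3_expansion[OF on, of "x - p0"] by (simp add: \<psi>_def \<psi>'_def e0_def h0_def n0_def algebra_simps)
      then show "\<forall>\<^sub>F x in nhds P. \<psi>' (\<psi> x) = x" by simp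
      have "\<psi> (\<psi>' x) = x" for x
        using o by (simp add: \<psi>_def \<psi>'_def vector3_eq_iff inner_add_left)
      then show "\<forall>\<^sub>F x in nhds (\<psi> P). \<psi> (\<psi>' x) = x" by simp
    qed
    show ?thesis
    proof (rule A_equivalentI[where F = "normal_ruled_surface c n", OF ph ps p0'])
      show "\<forall>\<^sub>F x in nhds (u0, w0). \<psi> (normal_ruled_surface c n x) = ?F (\<phi> x)"
        using bnz1
      proof eventually_elim
        case (elim x)
        obtain u w where x: "x = (u, w)" by force
        define s where "s = u - u0"
        have comp: "(c u + w *\<^sub>R n u - p0) \<bullet> v = cf v s + w * nf v s" for v
          by (simp add: cf_def nf_def s_def inner_add_left inner_diff_left algebra_simps)
        have bs: "b s \<noteq> 0" using elim x by (simp add: s_def)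
        have "cf v s - a s * (nf v s / b s) + (a s + w * b s) * (nf v s / b s) = cf v s + w * nf v s" for v
          using bs by (simp add: field_simps)
        then show ?case
          unfolding x normal_ruled_surface_def \<psi>_def \<phi>_def
          by (simp add: vector3_eq_iff comp s_def[symmetric] y0_def y1_def z0_def z1_def a_def[symmetric] b_def[symmetric])
      qed
    qed
  qed
  moreover have "y0 0 = 0" "z0 0 = 0" using vals y1 z1 by (simp_all add: y0_def z0_def)
  ultimately show thesis
    using that[OF y0 y1(1) z0 z1(1)] y0d y1d(1) z0d z1d z0d3 by simp
qed


lemma smooth_near_vector_derivative:
  fixes c :: "real \<Rightarrow> 'b::real_normed_vector"
  assumes "smooth_near t c"
  shows "(c has_vector_derivative D1 c t) (at t)" "smooth_near t (D1 c)"
proof -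
  have D: "(c has_vector_derivative frechet_derivative c (at x) 1) (at x)" if "smooth_near x c" for x
  proof -
    have d: "(c has_derivative frechet_derivative c (at x)) (at x)" by (rule smooth_near_has_derivative[OF that])
    have eq: "(\<lambda>t. t *\<^sub>R frechet_derivative c (at x) 1) = frechet_derivative c (at x)"
    proof
      fix t show "t *\<^sub>R frechet_derivative c (at x) 1 = frechet_derivative c (at x) t"
        using linear_cmul[OF has_derivative_linear[OF d], of t 1] by simp
    qed
    show ?thesis unfolding has_vector_derivative_def eq by (rule d)
  qed
  show "(c has_vector_derivative D1 c t) (at t)" using D[OF assms] vector_derivative_at[OF D[OF assms]] by simp
  have "\<forall>\<^sub>F x in nhds t. frechet_derivative c (at x) 1 = D1 c x"
    using smooth_near_eventually[OF assms] by eventually_elim (rule vector_derivative_at[OF D, symmetric])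
  then show "smooth_near t (D1 c)" by (rule smooth_near_cong[OF smooth_near_derivative[OF assms]])
qed

text \<open>The partial derivatives are \<open>(1 - w \<kappa>\<^sub>\<nu>) c' - w \<kappa>\<^sub>t h\<close> and \<open>n\<close>, which are orthogonal.\<close>

lemma normal_ruled_surface_singular:
  fixes c n :: "real \<Rightarrow> real^3"
  assumes c: "(c has_vector_derivative e) (at u)" and n: "(n has_vector_derivative (- k *\<^sub>R e - t *\<^sub>R h)) (at u)"
    and on: "orthonormal3 e h (n u)" and rank: "rank_at (normal_ruled_surface c n) (u, w) < 2"
  shows "w * k = 1" "t = 0"
proof -
  have o: "e \<bullet> e = 1" "h \<bullet> h = 1" "n u \<bullet> n u = 1" "e \<bullet> h = 0" "e \<bullet> n u = 0" "h \<bullet> n u = 0"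
    using on by (auto simp: orthonormal3_def norm_eq_1)
  define X where "X = (1 - w * k) *\<^sub>R e - (w * t) *\<^sub>R h"
  have "((\<lambda>q. c (fst q) + snd q *\<^sub>R n (fst q)) has_derivative
     (\<lambda>v. fst v *\<^sub>R e + (w *\<^sub>R (fst v *\<^sub>R (- k *\<^sub>R e - t *\<^sub>R h)) + snd v *\<^sub>R n u))) (at (u, w))"
  proof -
    have c': "((\<lambda>q. c (fst q)) has_derivative (\<lambda>v. fst v *\<^sub>R e)) (at (u, w))"
      by (rule has_derivative_compose[OF has_derivative_fst[OF has_derivative_ident], where g = c and g' = "\<lambda>t. t *\<^sub>R e"])
        (use c in \<open>simp add: has_vector_derivative_def\<close>)
    have n': "((\<lambda>q. n (fst q)) has_derivative (\<lambda>v. fst v *\<^sub>R (- k *\<^sub>R e - t *\<^sub>R h))) (at (u, w))"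
      by (rule has_derivative_compose[OF has_derivative_fst[OF has_derivative_ident], where g = n and g' = "\<lambda>s. s *\<^sub>R (- k *\<^sub>R e - t *\<^sub>R h)"])
        (use n in \<open>simp add: has_vector_derivative_def\<close>)
    have "((\<lambda>q. snd q *\<^sub>R n (fst q)) has_derivative (\<lambda>v. snd (u, w) *\<^sub>R (fst v *\<^sub>R (- k *\<^sub>R e - t *\<^sub>R h)) + snd v *\<^sub>R n (fst (u, w)))) (at (u, w))"
      by (rule has_derivative_scaleR[OF has_derivative_snd[OF has_derivative_ident] n'])
    from has_derivative_add[OF c' this] show ?thesis by simp
  qed
  then have "(normal_ruled_surface c n has_derivative (\<lambda>v. fst v *\<^sub>R X + snd v *\<^sub>R n u)) (at (u, w))"
    by (simp add: normal_ruled_surface_def case_prod_unfold X_def algebra_simps)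
  then have D: "frechet_derivative (normal_ruled_surface c n) (at (u, w)) = (\<lambda>v. fst v *\<^sub>R X + snd v *\<^sub>R n u)"
    by (rule frechet_derivative_at[symmetric])
  have "X = 0"
  proof (rule ccontr)
    assume X: "X \<noteq> 0"
    have Xn: "X \<bullet> n u = 0" using o by (simp add: X_def inner_diff_left)
    then have ne: "X \<noteq> n u" using o by auto
    have "n u \<noteq> 0" using o by auto
    then have "0 \<notin> {X, n u}" using X by auto
    moreover have "pairwise orthogonal {X, n u}" using Xn by (auto simp: pairwise_def orthogonal_def inner_commute)
    ultimately have "independent {X, n u}" by (intro pairwise_orthogonal_independent)
    moreover have "{X, n u} \<subseteq> range (\<lambda>v::real\<times>real. fst v *\<^sub>R X + snd v *\<^sub>R n u)"
    proof -
      have "X \<in> range (\<lambda>v::real\<times>real. fst v *\<^sub>R X + snd v *\<^sub>R n u)"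
        by (rule range_eqI[where x = "(1, 0)"]) simp
      moreover have "n u \<in> range (\<lambda>v::real\<times>real. fst v *\<^sub>R X + snd v *\<^sub>R n u)"
        by (rule range_eqI[where x = "(0, 1)"]) simp
      ultimately show ?thesis by simp
    qed
    ultimately have "card {X, n u} \<le> dim (range (\<lambda>v::real\<times>real. fst v *\<^sub>R X + snd v *\<^sub>R n u))"
      by (rule independent_card_le_dim[rotated])
    then show False using rank ne unfolding rank_at_def D by simp
  qed
  then have "X \<bullet> e = 0" "X \<bullet> h = 0" by simp_all
  moreover have "h \<bullet> e = 0" using o by (simp add: inner_commute)
  ultimately have "1 - w * k = 0" "w * t = 0" using o by (simp_all add: X_def inner_diff_left)
  then show "w * k = 1" "t = 0" by auto
qed

section \<open>Singularities of normal ruled surfaces\<close>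

text \<open>On the singular curve the second \<open>v\<close>-derivative of the frontal is \<open>h\<close>, so that the adapted frame is the frame
  in which the curvatures are defined.\<close>

lemma adapted_frame:
  assumes fr: "frontal_on U f \<nu>" and ad: "adapted_coordinates U f \<nu> V \<phi> h" and u: "(u, 0) \<in> V"
  defines "c \<equiv> \<lambda>u. f (\<phi> (u, 0))" and "hc \<equiv> \<lambda>u. h (u, 0)" and "n \<equiv> \<lambda>u. \<nu> (\<phi> (u, 0))"
  shows "smooth_near u c" "smooth_near u hc" "smooth_near u n" "orthonormal3 (D1 c u) (hc u) (n u)"
proof -
  have oV: "open V" and sph: "smooth_on V \<phi>" and sub: "\<phi> ` V \<subseteq> U" and sh: "smooth_on V h"
    using ad by (auto simp: adapted_coordinates_def diffeo_on_def)
  have oU: "open U" and sf: "smooth_on U f" and sn: "smooth_on U \<nu>" using fr by (auto simp: frontal_on_def)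
  have pU: "\<phi> (u, 0) \<in> U" using sub u by auto
  have slice: "smooth_near u (\<lambda>u::real. (u, 0::real))" by (intro smooth_near_Pair smooth_near_id smooth_near_const)
  have ph: "smooth_near (u, 0) \<phi>" by (rule smooth_nearI[OF sph oV u])
  have phi: "smooth_near u (\<lambda>u. \<phi> (u, 0))" by (rule smooth_near_compose[where f = \<phi>, OF ph slice])
  show c: "smooth_near u c" unfolding c_def
    by (rule smooth_near_compose[where f = f, OF smooth_nearI[OF sf oU pU] phi])
  show "smooth_near u n" unfolding n_def
    by (rule smooth_near_compose[where f = \<nu>, OF smooth_nearI[OF sn oU pU] phi])
  have hu: "smooth_near (u, 0) h" by (rule smooth_nearI[OF sh oV u])
  show "smooth_near u hc" unfolding hc_def by (rule smooth_near_compose[where f = h, OF hu slice])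
  define g where "g = f \<circ> \<phi>"
  have g: "smooth_near (u, 0) g" unfolding g_def o_def
    by (rule smooth_near_compose[OF smooth_nearI[OF sf oU pU] ph])
  have "(c has_vector_derivative pdu g (u, 0)) (at u)"
    using has_vector_derivative_pdu[OF g] by (simp add: c_def g_def)
  then have D1c: "D1 c u = pdu g (u, 0)" by (rule vector_derivative_at)
  have "pdv (pdv g) (u, 0) = h (u, 0)"
  proof -
    have d1: "((\<lambda>v. pdv g (u, v)) has_vector_derivative pdv (pdv g) (u, 0)) (at 0)"
      by (rule has_vector_derivative_pdv[OF smooth_near_pdv[OF g]])
    have "((\<lambda>v. v *\<^sub>R h (u, v)) has_vector_derivative (0 *\<^sub>R pdv h (u, 0) + 1 *\<^sub>R h (u, 0))) (at 0)"
      by (rule has_vector_derivative_scaleR[OF _ has_vector_derivative_pdv[OF hu]]) (auto intro!: derivative_eq_intros)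
    moreover have "open ((\<lambda>v. (u, v)) -` V)" by (intro open_vimage oV continuous_intros)
    moreover have "v *\<^sub>R h (u, v) = pdv g (u, v)" if "v \<in> (\<lambda>v. (u, v)) -` V" for v
      using ad that by (auto simp: adapted_coordinates_def g_def)
    ultimately have d2: "((\<lambda>v. pdv g (u, v)) has_vector_derivative h (u, 0)) (at 0)"
      using u by (auto simp: has_vector_derivative_def intro: has_derivative_transform_within_open)
    show ?thesis by (rule vector_derivative_unique_at[OF d1 d2])
  qed
  then show "orthonormal3 (D1 c u) (hc u) (n u)"
    using ad u by (auto simp: adapted_coordinates_def D1c hc_def n_def g_def)
qed

theorem theorem3p7:
  fixes f \<nu> h :: "real \<times> real \<Rightarrow> real^3"
    and U V :: "(real \<times> real) set"
    and \<phi> :: "real \<times> real \<Rightarrow> real \<times> real"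
    and I :: "real set"
    and c hc n :: "real \<Rightarrow> real^3"
    and \<kappa>s \<kappa>\<nu> \<kappa>t :: "real \<Rightarrow> real"
    and NR :: "real \<times> real \<Rightarrow> real^3"
    and u0 w0 :: real
  assumes "frontal_on U f \<nu>" and "(0, 0) \<in> U" and "f (0, 0) = 0"
    and "pure_frontal_singular_point U f \<nu> (0, 0)"
    and "adapted_coordinates U f \<nu> V \<phi> h"
    and "I = {u. (u, 0) \<in> V}"
    and "c = (\<lambda>u. f (\<phi> (u, 0)))"
    and "hc = (\<lambda>u. h (u, 0))"
    and "n = (\<lambda>u. \<nu> (\<phi> (u, 0)))"
    and "frame_curvatures I c hc n \<kappa>s \<kappa>\<nu> \<kappa>t"
    and "NR = normal_ruled_surface c n"
    and "noncylindrical I n"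
    and "\<not> developable I c n"
    and "(u0, w0) \<in> singular_set (I \<times> UNIV) NR"
  shows "(has_cross_cap NR (u0, w0) \<longleftrightarrow> deriv \<kappa>t u0 \<noteq> 0) \<and>
    (has_S1_minus NR (u0, w0) \<longleftrightarrow>
       deriv \<kappa>t u0 = 0 \<and>
       deriv (deriv \<kappa>t) u0 * (2 * \<kappa>s u0 * deriv \<kappa>\<nu> u0 + deriv (deriv \<kappa>t) u0) < 0) \<and>
    (has_S1_plus NR (u0, w0) \<longleftrightarrow>
       deriv \<kappa>t u0 = 0 \<and> deriv \<kappa>\<nu> u0 \<noteq> 0 \<and>
       deriv (deriv \<kappa>t) u0 * (2 * \<kappa>s u0 * deriv \<kappa>\<nu> u0 + deriv (deriv \<kappa>t) u0) > 0)"
proof -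
  note fr = assms(1) and ad = assms(5) and I = assms(6) and c = assms(7) and hc = assms(8) and n = assms(9)
    and curv = assms(10) and NR = assms(11) and sing = assms(14)
  have u0: "u0 \<in> I" and rank: "rank_at (normal_ruled_surface c n) (u0, w0) < 2"
    using sing by (auto simp: singular_set_def NR)
  have frame: "smooth_near u c" "smooth_near u hc" "smooth_near u n" "orthonormal3 (D1 c u) (hc u) (n u)" if "u \<in> I" for u
    using adapted_frame[OF fr ad, of u] that unfolding I c hc n by simp_all
  have "open V" using ad by (auto simp: adapted_coordinates_def diffeo_on_def)
  then have "open I" unfolding I using open_vimage[of V "\<lambda>u. (u, 0)"] by (simp add: vimage_def continuous_intros)
  then have onI: "\<forall>\<^sub>F u in nhds u0. P u" if "\<And>u. u \<in> I \<Longrightarrow> P u" for P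
    using u0 that unfolding eventually_nhds by blast
  have sD1c: "smooth_near u (D1 c)" and dc: "(c has_vector_derivative D1 c u) (at u)" if "u \<in> I" for u
    using smooth_near_vector_derivative[OF frame(1)[OF that]] by auto
  have eqs: "D1 (D1 c) u = \<kappa>s u *\<^sub>R hc u + \<kappa>\<nu> u *\<^sub>R n u" "D1 hc u = - \<kappa>s u *\<^sub>R D1 c u + \<kappa>t u *\<^sub>R n u"
    "D1 n u = - \<kappa>\<nu> u *\<^sub>R D1 c u - \<kappa>t u *\<^sub>R hc u" if "u \<in> I" for u
    using curv that by (auto simp: frame_curvatures_def)
  have de: "(D1 c has_vector_derivative (\<kappa>s u *\<^sub>R hc u + \<kappa>\<nu> u *\<^sub>R n u)) (at u)"
    and dh: "(hc has_vector_derivative (- \<kappa>s u *\<^sub>R D1 c u + \<kappa>t u *\<^sub>R n u)) (at u)"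
    and dn: "(n has_vector_derivative (- \<kappa>\<nu> u *\<^sub>R D1 c u - \<kappa>t u *\<^sub>R hc u)) (at u)" if "u \<in> I" for u
    using smooth_near_vector_derivative(1)[OF sD1c[OF that]] smooth_near_vector_derivative(1)[OF frame(2)[OF that]]
      smooth_near_vector_derivative(1)[OF frame(3)[OF that]] eqs[OF that] by simp_all
  have inner: "D1 c u \<bullet> hc u = 0" "D1 c u \<bullet> n u = 0" "hc u \<bullet> n u = 0" "hc u \<bullet> hc u = 1" "n u \<bullet> n u = 1"
    "n u \<bullet> hc u = 0" if "u \<in> I" for u
    using frame(4)[OF that] by (auto simp: orthonormal3_def norm_eq_1 inner_commute)
  have s\<kappa>: "smooth_near u0 \<kappa>s" "smooth_near u0 \<kappa>\<nu>" "smooth_near u0 \<kappa>t"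
  proof -
    have "smooth_near u0 (\<lambda>u. D1 (D1 c) u \<bullet> hc u)" "smooth_near u0 (\<lambda>u. D1 (D1 c) u \<bullet> n u)" "smooth_near u0 (\<lambda>u. D1 hc u \<bullet> n u)"
      by (intro smooth_near_inner smooth_near_vector_derivative(2) frame u0)+
    moreover have "\<forall>\<^sub>F u in nhds u0. D1 (D1 c) u \<bullet> hc u = \<kappa>s u" "\<forall>\<^sub>F u in nhds u0. D1 (D1 c) u \<bullet> n u = \<kappa>\<nu> u"
      "\<forall>\<^sub>F u in nhds u0. D1 hc u \<bullet> n u = \<kappa>t u"
      by (rule onI, simp add: eqs inner inner_add_left inner_diff_left)+
    ultimately show "smooth_near u0 \<kappa>s" "smooth_near u0 \<kappa>\<nu>" "smooth_near u0 \<kappa>t"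
      using smooth_near_cong by blast+
  qed
  have w: "w0 * \<kappa>\<nu> u0 = 1" "\<kappa>t u0 = 0"
    using normal_ruled_surface_singular[OF dc[OF u0] dn[OF u0] frame(4)[OF u0] rank] by auto
  obtain y0 y1 z0 z1 :: "real \<Rightarrow> real" where
    sm: "smooth_near 0 y0" "smooth_near 0 y1" "smooth_near 0 z0" "smooth_near 0 z1"
    and eqv: "A_equivalent (normal_ruled_surface c n) (u0, w0)
      (\<lambda>q. vector [fst q, y0 (snd q) + fst q * y1 (snd q), z0 (snd q) + fst q * z1 (snd q)]) (0, 0)"
    and y: "y0 0 = 0" "deriv y0 0 = 0" "deriv (deriv y0) 0 = - w0 * deriv \<kappa>\<nu> u0" "deriv y1 0 = - \<kappa>\<nu> u0"
    and z: "z0 0 = 0" "deriv z0 0 = 0" "deriv (deriv z0) 0 = - w0 * deriv \<kappa>t u0" "deriv z1 0 = 0"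
    and z3: "deriv \<kappa>t u0 = 0 \<longrightarrow> deriv (deriv z1) 0 = - \<kappa>\<nu> u0 * \<kappa>s u0"
      "deriv \<kappa>t u0 = 0 \<longrightarrow> deriv (deriv (deriv z0)) 0 = - w0 * (2 * \<kappa>s u0 * deriv \<kappa>\<nu> u0 + deriv (deriv \<kappa>t) u0)"
    by (rule normal_ruled_surface_line_family[OF frame(1)[OF u0] sD1c[OF u0] frame(2,3)[OF u0] s\<kappa>
        onI[OF dc] onI[OF de] onI[OF dh] onI[OF dn] frame(4)[OF u0] w(2,1)])
  define F where "F = (\<lambda>q. vector [fst q, y0 (snd q) + fst q * y1 (snd q), z0 (snd q) + fst q * z1 (snd q)] :: real^3)"
  have "smooth_near (0, 0) F"
    unfolding F_def by (intro smooth_near_vector3 smooth_near_fst smooth_near_line_family sm)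
  then have cF: "isCont F (0, 0)" by (rule smooth_near_isCont)
  have NF: "A_equivalent NR (u0, w0) F (0, 0)" using eqv by (simp add: NR F_def)
  have "smooth_near (u0, w0) NR"
  proof -
    have "smooth_near (u0, w0) (\<lambda>q. c (fst q))" "smooth_near (u0, w0) (\<lambda>q. n (fst q))"
      by (rule smooth_near_compose[OF _ smooth_near_fst], use frame u0 in simp)+
    then show ?thesis
      unfolding NR normal_ruled_surface_def case_prod_unfold
      by (intro smooth_near_add smooth_near_scaleR smooth_near_snd)
  qed
  then have cN: "isCont NR (u0, w0)" by (rule smooth_near_isCont)
  have iff: "A_equivalent NR (u0, w0) (folded_form W) (0, 0) \<longleftrightarrow> A_equivalent F (0, 0) (folded_form W) (0, 0)" for W
    using A_equivalent_trans[OF NF] A_equivalent_trans[OF A_equivalent_sym[OF NF cN]] by blast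
  have nz: "w0 \<noteq> 0" "\<kappa>\<nu> u0 \<noteq> 0" using w(1) by auto
  define K T where "K = deriv \<kappa>\<nu> u0" and "T = deriv (deriv \<kappa>t) u0"
  define D where "D = 2 * \<kappa>s u0 * K + T"
  have goal: "(A_equivalent F (0, 0) (folded_form snd) (0, 0) \<longleftrightarrow> deriv \<kappa>t u0 \<noteq> 0) \<and>
    (A_equivalent F (0, 0) (folded_form (S1_function (-1))) (0, 0) \<longleftrightarrow> deriv \<kappa>t u0 = 0 \<and> T * D < 0) \<and>
    (A_equivalent F (0, 0) (folded_form (S1_function 1)) (0, 0) \<longleftrightarrow> deriv \<kappa>t u0 = 0 \<and> K \<noteq> 0 \<and> T * D > 0)"
  proof (cases "deriv \<kappa>t u0 = 0")
    case False
    have cc: "A_equivalent F (0, 0) (folded_form snd) (0, 0)"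
      unfolding F_def by (rule line_family_cross_cap[OF sm y(2) _ z(2,4)]) (use y z nz False in simp_all)
    then show ?thesis using False A_equivalent_cross_cap_exclusive[OF cF] by simp
  next
    case t: True
    show ?thesis
    proof (cases "K = 0")
      case True
      have "\<not> A_equivalent F (0, 0) (folded_form W) (0, 0)" for W
        unfolding F_def by (rule line_family_degenerate[OF sm y(1,2) _ z(1,2)]) (use y z t True in \<open>simp_all add: K_def\<close>)
      moreover have "\<not> T * D < 0" using True by (simp add: D_def)
      ultimately show ?thesis using t True by simp
    next
      case False
      define m where "m = - deriv y1 0 / deriv (deriv y0) 0"
      define d where "d = deriv (deriv (deriv z0)) 0 * (m * (deriv (deriv (deriv z0)) 0 * m + 2 * deriv (deriv z1) 0))"
      have y2: "deriv (deriv y0) 0 \<noteq> 0" and z2: "deriv (deriv z0) 0 = 0"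
        using y z nz False t by (simp_all add: K_def)
      note S = line_family_S1[OF sm y(2) y2 z(1,2,4) z2 m_def d_def F_def]
      have "d = (\<kappa>\<nu> u0 / K)\<^sup>2 * (T * D)"
      proof -
        have vals: "m = - \<kappa>\<nu> u0 / (w0 * K)" "deriv (deriv (deriv z0)) 0 = - w0 * D" "deriv (deriv z1) 0 = - \<kappa>\<nu> u0 * \<kappa>s u0"
          using y z3 t by (simp_all add: m_def K_def T_def D_def)
        have "- w0 * D * m + 2 * (- \<kappa>\<nu> u0 * \<kappa>s u0) = \<kappa>\<nu> u0 * T / K"
          unfolding vals(1) D_def using nz False by (simp add: field_simps)
        then have "d = - w0 * D * (m * (\<kappa>\<nu> u0 * T / K))" unfolding d_def vals(2,3) by simp
        also have "\<dots> = (\<kappa>\<nu> u0 / K)\<^sup>2 * (T * D)"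
          unfolding vals(1) using nz False by (simp add: field_simps power2_eq_square)
        finally show ?thesis .
      qed
      moreover have "(\<kappa>\<nu> u0 / K)\<^sup>2 > 0" using nz False by simp
      ultimately have "d > 0 \<longleftrightarrow> T * D > 0" "d < 0 \<longleftrightarrow> T * D < 0"
        using zero_less_mult_iff[of "(\<kappa>\<nu> u0 / K)\<^sup>2" "T * D"] mult_less_0_iff[of "(\<kappa>\<nu> u0 / K)\<^sup>2" "T * D"] by simp_all
      then show ?thesis using S t False by simp
    qed
  qed
  then show ?thesis
    unfolding has_cross_cap_iff has_S1_minus_iff has_S1_plus_iff iff K_def T_def D_def .
qed

end
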